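(* For every finite subgroup $G$ of $\mathrm{GL}_2(\mathbb{R})$ there exists a translation surface $T$ whose Veech group $\mathrm{GL}_2(T)$ is equal to $G$.
   Context: A translation surface $T$ is a compact connected $2$-dimensional manifold (without boundary) containing a discrete subset $\Sigma\subset T$ such that $T\setminus\Sigma$ is equipped with a maximal atlas whose transition functions are translations of $\mathbb{R}^2$; $\Sigma$ is called the set of cone points of $T$. The atlas induces a flat metric on $T\setminus\Sigma$, and each point of $\Sigma$ is a cone point of this metric with cone angle a positive integer multiple of $2\pi$. The translation structure trivializes the tangent bundle of $T\setminus\Sigma$, so the derivative of a diffeomorphism of $T\setminus\Sigma$ at a point is a well-defined element of $\mathrm{GL}_2(\mathbb{R})$. The affine group $\mathrm{Aff}(T)$ is the group of all homeomorphisms $f:T\to T$ with $f(\Sigma)=\Sigma$ that restrict to diffeomorphisms of $T\setminus\Sigma$ with constant derivative. The Veech group $\mathrm{GL}_2(T)\subset \mathrm{GL}_2(\mathbb{R})$ is the image of the homomorphism $\mathrm{Aff}(T)\to\mathrm{GL}_2(\mathbb{R})$ sending $f$ to its derivative. Both orientation-preserving and orientation-reversing maps are allowed. *)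

theory Defs
  imports "HOL-Analysis.Analysis" "HOL-Algebra.Group"
begin

definition GL2 :: "(real^2^2) monoid" where
  "GL2 = \<lparr>carrier = {A. invertible A}, mult = (**), one = mat 1\<rparr>"

text \<open>
  A chart is a pair of a domain and a map. The values of the map outside the domain are
  irrelevant; a maximal atlas contains a chart together with all its modifications off the domain.
\<close>

type_synonym 'a chart = "'a set \<times> ('a \<Rightarrow> real^2)"

record 'a flat_surface =
  underlying :: "'a topology"
  cone_points :: "'a set"
  atlas :: "'a chart set"

definition surface_2d :: "'a topology \<Rightarrow> bool" where
  "surface_2d X \<longleftrightarrow>
     Hausdorff_space X \<and> second_countable X \<and>
     (\<forall>p \<in> topspace X. \<exists>U V. openin X U \<and> p \<in> U \<and> open (V :: (real^2) set) \<and>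
        subtopology X U homeomorphic_space top_of_set V)"

definition regular_points :: "'a flat_surface \<Rightarrow> 'a set" where
  "regular_points T = topspace (underlying T) - cone_points T"

definition regular_part :: "'a flat_surface \<Rightarrow> 'a topology" where
  "regular_part T = subtopology (underlying T) (regular_points T)"

definition is_chart :: "'a topology \<Rightarrow> 'a chart \<Rightarrow> bool" where
  "is_chart X = (\<lambda>(U, \<phi>). openin X U \<and> open (\<phi> ` U) \<and>
     homeomorphic_map (subtopology X U) (top_of_set (\<phi> ` U)) \<phi>)"

text \<open>
  On a disconnected overlap the transition function may be a different translation on each
  component, so the condition is local.
\<close>

definition translation_compatible :: "'a topology \<Rightarrow> 'a chart \<Rightarrow> 'a chart \<Rightarrow> bool" where
  "translation_compatible X = (\<lambda>(U, \<phi>) (V, \<psi>).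
     \<forall>x \<in> U \<inter> V. \<exists>W c. openin X W \<and> x \<in> W \<and> W \<subseteq> U \<inter> V \<and> (\<forall>y \<in> W. \<psi> y = \<phi> y + c))"

definition translation_atlas :: "'a topology \<Rightarrow> 'a chart set \<Rightarrow> bool" where
  "translation_atlas X \<A> \<longleftrightarrow>
     (\<forall>c \<in> \<A>. is_chart X c) \<and> (\<Union>(fst ` \<A>) = topspace X) \<and>
     (\<forall>c \<in> \<A>. \<forall>d \<in> \<A>. translation_compatible X c d)"

definition maximal_translation_atlas :: "'a topology \<Rightarrow> 'a chart set \<Rightarrow> bool" where
  "maximal_translation_atlas X \<A> \<longleftrightarrow>
     translation_atlas X \<A> \<and> (\<forall>\<B>. translation_atlas X \<B> \<and> \<A> \<subseteq> \<B> \<longrightarrow> \<B> = \<A>)"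

text \<open>
  A map to the plane is a local isometry for the flat metric induced by the atlas iff near each
  point its distances agree with those measured in a chart.
\<close>

definition flat_local_isometry ::
    "'a flat_surface \<Rightarrow> 'a set \<Rightarrow> ('a \<Rightarrow> 'b::metric_space) \<Rightarrow> bool" where
  "flat_local_isometry T U f \<longleftrightarrow>
     (\<forall>x \<in> U. \<exists>(V, \<phi>) \<in> atlas T. \<exists>W. openin (regular_part T) W \<and> x \<in> W \<and> W \<subseteq> U \<inter> V \<and>
        (\<forall>y \<in> W. \<forall>z \<in> W. dist (f y) (f z) = dist (\<phi> y) (\<phi> z)))"

text \<open>
  The Euclidean cone of angle \<open>2 * pi * k\<close> is the \<open>k\<close>-fold cyclic covering of a flat disc
  branched over its centre: the disc with coordinate \<open>z\<close> and the pull-back of the flat metric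
  along \<open>z \<mapsto> z ^ k\<close>. A point is a cone point of this angle if it has a neighbourhood \<open>U\<close> with a
  homeomorphism \<open>h\<close> onto such a cone that sends it to the apex and is locally isometric away
  from it.
\<close>

definition cone_point_of_multiplicity :: "'a flat_surface \<Rightarrow> 'a \<Rightarrow> nat \<Rightarrow> bool" where
  "cone_point_of_multiplicity T p k \<longleftrightarrow>
     (\<exists>U h. \<exists>r > 0. openin (underlying T) U \<and> U \<inter> cone_points T = {p} \<and>
        homeomorphic_map (subtopology (underlying T) U) (top_of_set (ball (0::complex) r)) h \<and>
        h p = 0 \<and> flat_local_isometry T (U - {p}) (\<lambda>x. h x ^ k))"

definition translation_surface :: "'a flat_surface \<Rightarrow> bool" where
  "translation_surface T \<longleftrightarrow>
     topspace (underlying T) \<noteq> {} \<and> surface_2d (underlying T) \<and>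
     compact_space (underlying T) \<and> connected_space (underlying T) \<and>
     cone_points T \<subseteq> topspace (underlying T) \<and>
     subtopology (underlying T) (cone_points T) = discrete_topology (cone_points T) \<and>
     maximal_translation_atlas (regular_part T) (atlas T) \<and>
     (\<forall>p \<in> cone_points T. \<exists>k \<ge> 1. cone_point_of_multiplicity T p k)"

definition has_flat_derivative ::
    "'a flat_surface \<Rightarrow> ('a \<Rightarrow> 'a) \<Rightarrow> real^2^2 \<Rightarrow> 'a \<Rightarrow> bool" where
  "has_flat_derivative T f A x \<longleftrightarrow>
     (\<forall>(U, \<phi>) \<in> atlas T. \<forall>(V, \<psi>) \<in> atlas T. x \<in> U \<and> f x \<in> V \<longrightarrow>
        ((\<psi> \<circ> f \<circ> inv_into U \<phi>) has_derivative (\<lambda>v. A *v v)) (at (\<phi> x)))"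

text \<open>
  A diffeomorphism with constant derivative is affine in charts, so requiring the map and its
  inverse to be differentiable everywhere is the same as requiring them to be smooth. Elements are
  fixed to be \<^const>\<open>undefined\<close> off the surface.
\<close>

definition affine_group :: "'a flat_surface \<Rightarrow> ('a \<Rightarrow> 'a) set" where
  "affine_group T = {f \<in> extensional (topspace (underlying T)).
     homeomorphic_map (underlying T) (underlying T) f \<and> f ` cone_points T = cone_points T \<and>
     (\<exists>A. \<forall>x \<in> regular_points T. has_flat_derivative T f A x) \<and>
     (\<forall>y \<in> regular_points T.
        \<exists>B. has_flat_derivative T (inv_into (topspace (underlying T)) f) B y)}"

definition constant_derivative :: "'a flat_surface \<Rightarrow> ('a \<Rightarrow> 'a) \<Rightarrow> real^2^2" where
  "constant_derivative T f = (THE A. \<forall>x \<in> regular_points T. has_flat_derivative T f A x)"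

definition veech_group :: "'a flat_surface \<Rightarrow> (real^2^2) set" where
  "veech_group T = constant_derivative T ` affine_group T"

end

theory Submission
  imports Defs
begin

text \<open>
  Glue opposite sides of a regular polygon with \<open>N = 8 n\<close> sides by translations. All corners become
  one cone point of multiplicity \<open>N / 2 - 1\<close>, and the dihedral group of order \<open>2 N\<close> acts by
  affine maps. A finite linear group is conjugate to a subgroup of this dihedral group for suitable
  \<open>n\<close>; the conjugating linear map is composed with all charts, so that one may assume that \<open>G\<close> is
  dihedral or cyclic. To cut the Veech group down to \<open>G\<close>, the \<open>G\<close>-orbit of a generic point \<open>q\<close> of the polygon
  is declared to consist of cone points of multiplicity one.

  Let \<open>f\<close> be an affine map with derivative \<open>B\<close>. It cannot move the corner point, since a coordinate
  at a marked point is injective and one at the corner point is not. Let \<open>K\<close> be a countable field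
  that contains all coordinates of the polygon. Choosing representatives in the polygon, the
  difference \<open>f x - B x\<close> is locally constant modulo \<open>K\<close>, hence constant modulo \<open>K\<close>. Comparing
  corners shows that \<open>B\<close> has entries in \<open>K\<close>. Comparing \<open>q\<close> with a corner gives \<open>g q - B q \<in> K\<close> for
  some \<open>g \<in> G\<close>, and as \<open>q\<close> is generic over \<open>K\<close> this forces \<open>B = g\<close>.
\<close>

section \<open>Regular polygons with opposite sides glued\<close>

text \<open>The unmarked surface is too symmetric: besides the dihedral group its Veech group
  contains parabolic matrices, whose affine maps do not preserve the polygon. So nothing can be
  assumed about where an affine map sends a side. What survives is arithmetic: another choice of
  representative changes a point by a gluing translation, and a field containing all of these is
  still countable, so that points generic over it exist.

  The factor 8 has three reasons. Divisibility by \<open>n\<close> makes the roots of unity that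
  occur in \<open>G\<close> symmetries of the polygon. Divisibility by 4 makes all corners one
  point: crossing a side moves a corner by \<open>k = N / 2 - 1\<close> places, up to sign, and this
  is prime to \<open>N\<close> exactly if it is odd. Finally \<open>N \<ge> 8\<close> gives
  \<open>k \<ge> 3\<close>; a square would give a torus, whose corner point has multiplicity one
  like the other marked points and could be moved.

  The conjugating linear map enters only in the charts, so the polygon stays regular; the price is a
  correction of the model coordinate at the cone points (\<open>skew_root\<close>).\<close>

definition roots :: "nat \<Rightarrow> complex set" where
  "roots N = {u. u ^ N = 1}"

lemma roots_1: "1 \<in> roots N"
  and roots_mult: "u \<in> roots N \<Longrightarrow> v \<in> roots N \<Longrightarrow> u * v \<in> roots N"
  and roots_uminus: "even N \<Longrightarrow> u \<in> roots N \<Longrightarrow> - u \<in> roots N"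
  by (auto simp: roots_def power_mult_distrib)

lemma roots_power: "u \<in> roots N \<Longrightarrow> u ^ m \<in> roots N"
  by (metis (mono_tags, lifting) mem_Collect_eq mult.commute power_mult power_one roots_def)

lemma roots_cnj: "u \<in> roots N \<Longrightarrow> cnj u \<in> roots N"
  by (metis (mono_tags, lifting) complex_cnj_one complex_cnj_power mem_Collect_eq roots_def)

lemma roots_inverse: "u \<in> roots N \<Longrightarrow> inverse u \<in> roots N"
  by (simp add: roots_def power_inverse)

lemma norm_roots:
  assumes "N > 0" "u \<in> roots N"
  shows "norm u = 1"
proof (rule power_eq_imp_eq_base)
  show "norm u ^ N = 1 ^ N"
    using assms(2) by (simp add: roots_def flip: norm_power)
qed (use assms in auto)

lemma roots_nonzero: "N > 0 \<Longrightarrow> u \<in> roots N \<Longrightarrow> u \<noteq> 0"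
  using norm_roots[of N u] by auto

lemma roots_mult_cnj: "N > 0 \<Longrightarrow> u \<in> roots N \<Longrightarrow> u * cnj u = 1"
  by (simp add: complex_norm_square[symmetric] norm_roots)

lemma roots_cis: "N > 0 \<Longrightarrow> u \<in> roots N \<longleftrightarrow> (\<exists>m<N. u = cis (2 * pi * m / N))"
  using Complex.bij_betw_roots_unity[of N] unfolding bij_betw_def roots_def by (auto simp: set_eq_iff image_iff)

lemma finite_roots: "N > 0 \<Longrightarrow> finite (roots N)"
  using finite_roots_unity[of N] by (simp add: roots_def)

lemma cis_int_roots: "N > 0 \<Longrightarrow> cis (2 * pi * of_int m / N) \<in> roots N"
  by (simp add: roots_def Complex.DeMoivre)

text \<open>The argument of \<open>z\<close> is rounded to a multiple of \<open>2 * pi / N\<close>.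
  This reduces questions about the polygon and about the cone to a single sector around the positive
  real axis.\<close>

lemma nearest_root:
  assumes "N > 0"
  shows "\<exists>u\<in>roots N. \<exists>\<phi>. \<bar>\<phi>\<bar> \<le> pi / N \<and> z = of_real (norm z) * u * cis \<phi>"
proof -
  define m where "m = round (Arg z * N / (2 * pi))"
  define \<phi> where "\<phi> = Arg z - 2 * pi * of_int m / N"
  have "\<bar>\<phi>\<bar> = 2 * pi / N * \<bar>of_int m - Arg z * N / (2 * pi)\<bar>"
    using assms unfolding \<phi>_def by (simp add: abs_mult[symmetric] field_simps abs_minus_commute del: abs_mult)
  also have "\<dots> \<le> 2 * pi / N * (1 / 2)"
    unfolding m_def by (intro mult_left_mono of_int_round_abs_le) auto
  finally have "\<bar>\<phi>\<bar> \<le> pi / N"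
    by simp
  moreover have "z = of_real (norm z) * cis (2 * pi * of_int m / N) * cis \<phi>"
    by (simp add: \<phi>_def cis_mult mult.assoc rcis_cmod_Arg[unfolded rcis_def])
  ultimately show ?thesis
    using cis_int_roots[OF assms] by blast
qed

lemma inner_mult_unit: "norm u = 1 \<Longrightarrow> inner (u * z) (u * w) = inner z (w :: complex)"
  by (simp add: inner_complex_def norm_complex_def power2_eq_square[symmetric]) algebra

lemma inner_cis: "inner (cis a) (cis b) = cos (a - b)"
  by (simp add: inner_complex_def cos_diff)

text \<open>With \<open>x\<close> half the argument of \<open>t\<close>, the difference
  \<open>cos \<phi> - inner t (cis \<phi>)\<close> factors as
  \<open>2 * sin x * sin (x - \<phi>)\<close>, and \<open>pi / N \<le> x \<le> pi - pi / N\<close>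
  keeps both factors nonnegative. Equality is a tie between \<open>1\<close> and a neighbouring
  root; such ties are the corners of the polygon and the boundary rays of the sectors at the cone
  point.\<close>

lemma root_inner_cis:
  assumes N: "N > 0" and t: "t \<in> roots N" "t \<noteq> 1" and \<phi>: "\<bar>\<phi>\<bar> \<le> pi / N"
  shows "inner t (cis \<phi>) \<le> cos \<phi>"
    and "inner t (cis \<phi>) = cos \<phi> \<Longrightarrow>
      \<phi> = pi / N \<and> t = cis (2 * pi / N) \<or> \<phi> = - pi / N \<and> t = cis (- 2 * pi / N)"
proof -
  obtain m where m: "m < N" "t = cis (2 * pi * m / N)"
    using t roots_cis[OF N] by blast
  have m0: "m \<ge> 1"
    using m t by (cases m) auto
  define x where "x = pi * m / N"
  have "pi / N \<le> x"
    using m0 N by (simp add: x_def field_simps)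
  moreover have "x \<le> pi - pi / N"
  proof -
    have "real m + 1 \<le> N" using m by linarith
    then have "pi * (real m + 1) \<le> pi * N" by (intro mult_left_mono) auto
    then show ?thesis using N by (simp add: x_def field_simps)
  qed
  moreover have "pi / N > 0" using N by simp
  ultimately have x: "0 \<le> x - \<phi>" "x - \<phi> \<le> pi" "0 < x" "x < pi"
    using \<phi> by auto
  have eq: "cos \<phi> - inner t (cis \<phi>) = 2 * sin x * sin (x - \<phi>)"
  proof -
    have "cos \<phi> - cos (2 * x - \<phi>) = 2 * sin ((\<phi> + (2 * x - \<phi>)) / 2) * sin (((2 * x - \<phi>) - \<phi>) / 2)"
      by (rule cos_diff_cos)
    also have "((2 * x - \<phi>) - \<phi>) / 2 = x - \<phi>" by simp
    finally have "cos \<phi> - cos (2 * x - \<phi>) = 2 * sin x * sin (x - \<phi>)" by simp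
    then show ?thesis by (simp add: m inner_cis x_def field_simps)
  qed
  moreover have "sin x > 0" "sin (x - \<phi>) \<ge> 0"
    using x by (auto intro: sin_gt_zero sin_ge_zero)
  ultimately show "inner t (cis \<phi>) \<le> cos \<phi>"
    by (smt (verit, best) mult_nonneg_nonneg)
  assume "inner t (cis \<phi>) = cos \<phi>"
  with eq \<open>sin x > 0\<close> have "sin (x - \<phi>) = 0" by simp
  with x have "x - \<phi> = 0 \<or> x - \<phi> = pi"
    by (smt (verit) sin_gt_zero)
  then show "\<phi> = pi / N \<and> t = cis (2 * pi / N) \<or> \<phi> = - pi / N \<and> t = cis (- 2 * pi / N)"
  proof
    assume "x - \<phi> = 0"
    then have "\<phi> = pi / N" "x = pi / N" using \<phi> \<open>pi / N \<le> x\<close> by auto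
    then show ?thesis using m by (simp add: x_def mult.assoc)
  next
    assume *: "x - \<phi> = pi"
    then have "\<phi> = - pi / N" "x = pi - pi / N" using \<phi> \<open>x \<le> pi - pi / N\<close> by auto
    moreover have "t = cis (2 * x)" using m by (simp add: x_def mult.assoc)
    moreover have "2 * (pi - pi / N) = 2 * pi + - 2 * pi / N"
      by (simp add: right_diff_distrib)
    ultimately have "t = cis (2 * pi) * cis (- 2 * pi / N)"
      by (simp only: cis_mult)
    then have "t = cis (- 2 * pi / N)" by (simp only: cis_2pi mult_1)
    then show ?thesis using \<open>\<phi> = - pi / N\<close> by blast
  qed
qed

text \<open>The regular polygon circumscribed about the unit circle: the roots of unity are the
  outer unit normals of its sides, so opposite sides differ by the translation
  \<open>2 * u\<close>.\<close>

definition ngon :: "nat \<Rightarrow> complex set" where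
  "ngon N = {z. \<forall>u\<in>roots N. inner u z \<le> 1}"

definition corners :: "nat \<Rightarrow> complex set" where
  "corners N = {z \<in> ngon N. \<exists>u\<in>roots N. \<exists>v\<in>roots N. u \<noteq> v \<and> inner u z = 1 \<and> inner v z = 1}"

text \<open>All corners are put into one class outright. This makes the relation transitive on the
  polygon without chains of side translations.\<close>

definition glued :: "nat \<Rightarrow> complex \<Rightarrow> complex \<Rightarrow> bool" where
  "glued N z w \<longleftrightarrow> z = w \<or> z \<in> corners N \<and> w \<in> corners N \<or>
     (\<exists>u\<in>roots N. inner u z = 1 \<and> w = z - 2 * u)"

text \<open>This is the corner between the sides with normals \<open>1\<close> and
  \<open>cis (2 * pi / N)\<close>.\<close>

definition corner :: "nat \<Rightarrow> complex" where
  "corner N = Complex 1 (tan (pi / N))"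

lemma convex_ngon: "convex (ngon N)"
proof -
  have "ngon N = (\<Inter>u\<in>roots N. {z. inner u z \<le> 1})"
    by (auto simp: ngon_def)
  then show ?thesis
    by (simp add: convex_INT convex_halfspace_le)
qed

lemma closed_ngon: "closed (ngon N)"
proof -
  have "ngon N = (\<Inter>u\<in>roots N. {z. inner u z \<le> 1})"
    by (auto simp: ngon_def)
  then show ?thesis
    by (simp add: closed_INT closed_halfspace_le)
qed

section \<open>Dihedral symmetries of the polygon\<close>

lemma inner_mult_root:
  assumes "N > 0" "g \<in> roots N"
  shows "inner u (g * z) = inner (inverse g * u) z"
proof -
  have "inner u (g * z) = inner (g * (inverse g * u)) (g * z)"
    using roots_nonzero[OF assms(1,2)] by (simp add: field_simps)
  then show ?thesis
    using inner_mult_unit[OF norm_roots[OF assms(1,2)]] by simp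
qed

lemma ngon_mult:
  assumes "N > 0" "g \<in> roots N" "z \<in> ngon N"
  shows "g * z \<in> ngon N"
  using assms roots_mult[OF roots_inverse[OF assms(2)]]
  by (simp add: ngon_def inner_mult_root[OF assms(1,2)])

lemma inner_cnj: "inner (cnj u) z = inner u (cnj z)"
  by (simp add: inner_complex_def)

lemma ngon_cnj: "z \<in> ngon N \<Longrightarrow> cnj z \<in> ngon N"
  by (simp add: ngon_def roots_cnj flip: inner_cnj)

lemma corners_mult:
  assumes "N > 0" "g \<in> roots N" "z \<in> corners N"
  shows "g * z \<in> corners N"
proof -
  obtain u v where uv: "u \<in> roots N" "v \<in> roots N" "u \<noteq> v" "inner u z = 1" "inner v z = 1"
    using assms(3) unfolding corners_def by blast
  have "inner (g * u) (g * z) = 1" "inner (g * v) (g * z) = 1" "g * u \<noteq> g * v"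
    using uv inner_mult_unit[OF norm_roots[OF assms(1,2)]] roots_nonzero[OF assms(1,2)] by auto
  then show ?thesis
    using uv assms ngon_mult roots_mult unfolding corners_def by blast
qed

lemma corners_cnj:
  assumes "z \<in> corners N"
  shows "cnj z \<in> corners N"
proof -
  obtain u v where uv: "u \<in> roots N" "v \<in> roots N" "u \<noteq> v" "inner u z = 1" "inner v z = 1"
    using assms unfolding corners_def by blast
  then have "inner (cnj u) (cnj z) = 1" "inner (cnj v) (cnj z) = 1" "cnj u \<noteq> cnj v"
    by (auto simp: inner_cnj)
  then show ?thesis
    using uv assms ngon_cnj roots_cnj unfolding corners_def by blast
qed

text \<open>On the side with normal \<open>u\<close> the gluing translation agrees with the
  reflection in the line through the origin orthogonal to \<open>u\<close>. For a root
  \<open>u\<close> this reflection is a symmetry of the polygon, so the translation carries sides to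
  sides and corners to corners.\<close>

lemma on_side: 
  assumes "norm u = 1" "inner u z = 1"
  shows "z - 2 * u = - u * u * cnj z"
proof -
  have *: "u * cnj z + cnj u * z = 2"
    using assms(2) by (simp add: complex_eq_iff inner_complex_def algebra_simps)
  have "u * cnj u = 1"
    using assms by (simp add: complex_norm_square[symmetric])
  then have "u * u * cnj z + z = u * (u * cnj z + cnj u * z)"
    by (simp add: algebra_simps)
  also have "\<dots> = 2 * u"
    unfolding * by simp
  finally show ?thesis
    by (simp add: algebra_simps)
qed

lemma opposite_side:
  assumes "N > 0" "even N" "u \<in> roots N" "inner u z = 1"
  shows "z \<in> ngon N \<Longrightarrow> z - 2 * u \<in> ngon N" "z \<in> corners N \<Longrightarrow> z - 2 * u \<in> corners N"
    and "inner (- u) (z - 2 * u) = 1"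
proof -
  have eq: "z - 2 * u = (- (u * u)) * cnj z"
    using on_side[OF norm_roots[OF assms(1,3)] assms(4)] by simp
  have "- (u * u) \<in> roots N"
    using assms by (simp add: roots_uminus roots_mult)
  then show "z \<in> ngon N \<Longrightarrow> z - 2 * u \<in> ngon N" "z \<in> corners N \<Longrightarrow> z - 2 * u \<in> corners N"
    unfolding eq using ngon_mult[OF assms(1)] corners_mult[OF assms(1)] ngon_cnj corners_cnj by blast+
  have "inner u u = 1"
    using norm_roots[OF assms(1,3)] by (simp add: dot_square_norm)
  then have "inner u (2 * u) = 2"
    using inner_scaleR_right[of u 2 u] by (simp add: scaleR_conv_of_real)
  then show "inner (- u) (z - 2 * u) = 1"
    using assms by (simp add: inner_diff_right)
qed

section \<open>The gluing as an equivalence relation\<close>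

lemma glued_refl: "glued N z z"
  by (simp add: glued_def)

lemma glued_sym:
  assumes "N > 0" "even N" "glued N z w"
  shows "glued N w z"
  using assms(3) unfolding glued_def
proof (elim disjE)
  assume "\<exists>u\<in>roots N. inner u z = 1 \<and> w = z - 2 * u"
  then obtain u where u: "u \<in> roots N" "inner u z = 1" "w = z - 2 * u" by blast
  then have "- u \<in> roots N" "inner (- u) w = 1" "z = w - 2 * (- u)"
    using opposite_side[OF assms(1,2)] roots_uminus[OF assms(2)] by auto
  then show "w = z \<or> w \<in> corners N \<and> z \<in> corners N \<or> (\<exists>u\<in>roots N. inner u w = 1 \<and> z = w - 2 * u)"
    by blast
qed auto

lemma glued_corner:
  assumes "N > 0" "even N" "glued N z w" "z \<in> corners N"
  shows "w \<in> corners N"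
  using assms opposite_side unfolding glued_def by blast

text \<open>A polygon point that is no corner lies on at most one side, so two successive side
  translations through it cancel.\<close>

lemma glued_trans:
  assumes N: "N > 0" "even N" and g: "glued N z w" "glued N w y" and w: "w \<in> ngon N"
  shows "glued N z y"
proof (cases "w \<in> corners N")
  case True
  then show ?thesis
    using glued_corner[OF N g(2)] glued_corner[OF N glued_sym[OF N g(1)]] by (simp add: glued_def)
next
  case False
  consider "z = w" | "w = y" | u v where "u \<in> roots N" "inner u z = 1" "w = z - 2 * u"
    "v \<in> roots N" "inner v w = 1" "y = w - 2 * v"
    using g False glued_corner[OF N g(1)] unfolding glued_def by blast
  then show ?thesis
  proof cases
    case 3
    have "- u \<in> roots N" "inner (- u) w = 1"
      using opposite_side(3)[OF N 3(1,2)] 3 roots_uminus[OF N(2)] by auto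
    then have "v = - u"
      using 3 False w unfolding corners_def by blast
    then show ?thesis
      using 3 by (simp add: glued_def)
  qed (use g in auto)
qed

lemma glued_ngon:
  assumes "N > 0" "even N" "glued N z w" "z \<in> ngon N"
  shows "w \<in> ngon N"
  using assms opposite_side unfolding glued_def by (auto simp: corners_def)

lemma glued_mult:
  assumes "N > 0" "g \<in> roots N" "glued N z w"
  shows "glued N (g * z) (g * w)"
  using assms(3) unfolding glued_def
proof (elim disjE)
  assume "\<exists>u\<in>roots N. inner u z = 1 \<and> w = z - 2 * u"
  then obtain u where u: "u \<in> roots N" "inner u z = 1" "w = z - 2 * u" by blast
  then have "g * u \<in> roots N" "inner (g * u) (g * z) = 1" "g * w = g * z - 2 * (g * u)"
    using assms by (auto simp: roots_mult inner_mult_unit[OF norm_roots[OF assms(1,2)]] algebra_simps)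
  then show "g * z = g * w \<or> g * z \<in> corners N \<and> g * w \<in> corners N \<or>
    (\<exists>u\<in>roots N. inner u (g * z) = 1 \<and> g * w = g * z - 2 * u)"
    by blast
qed (use assms corners_mult in auto)

lemma glued_cnj:
  assumes "glued N z w"
  shows "glued N (cnj z) (cnj w)"
  using assms unfolding glued_def
proof (elim disjE)
  assume "\<exists>u\<in>roots N. inner u z = 1 \<and> w = z - 2 * u"
  then obtain u where u: "u \<in> roots N" "inner u z = 1" "w = z - 2 * u" by blast
  then have "cnj u \<in> roots N" "inner (cnj u) (cnj z) = 1" "cnj w = cnj z - 2 * cnj u"
    by (auto simp: roots_cnj inner_cnj)
  then show "cnj z = cnj w \<or> cnj z \<in> corners N \<and> cnj w \<in> corners N \<or>
    (\<exists>u\<in>roots N. inner u (cnj z) = 1 \<and> cnj w = cnj z - 2 * u)"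
    by blast
qed (use corners_cnj in auto)

section \<open>Position of the corners\<close>

lemma cis_cos_tan: "cos a \<noteq> 0 \<Longrightarrow> cis a = of_real (cos a) * Complex 1 (tan a)"
  by (simp add: complex_eq_iff tan_def)

lemma cos_pi_div_pos: "N > 2 \<Longrightarrow> cos (pi / real N) > 0"
  by (rule cos_gt_zero) (auto simp: field_simps)

text \<open>Let \<open>w\<close> be the root nearest to \<open>z\<close>. Its side imposes the
  strongest bound in the direction of \<open>z\<close>, except for a tie at angle
  \<open>pi / N\<close>, where a neighbour of \<open>w\<close> imposes the same one. Hence two sides
  through \<open>z\<close> are neighbours and \<open>z\<close> is determined by them.\<close>

lemma ngon_sides:
  assumes N: "N > 2" and z: "z \<in> ngon N" and u: "u \<in> roots N" "inner u z = 1"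
    and v: "v \<in> roots N" "inner v z = 1" "u \<noteq> v"
  shows "z = u * corner N \<and> v = u * cis (2 * pi / N) \<or> z = v * corner N \<and> u = v * cis (2 * pi / N)"
proof -
  have N0: "N > 0" using N by simp
  obtain w \<phi> where w: "w \<in> roots N" and \<phi>: "\<bar>\<phi>\<bar> \<le> pi / N" and zw: "z = of_real (norm z) * w * cis \<phi>"
    using nearest_root[OF N0] by blast
  define \<rho> where "\<rho> = norm z"
  have z0: "z \<noteq> 0" using u by auto
  then have \<rho>: "\<rho> > 0" by (simp add: \<rho>_def)
  have zw': "z = \<rho> *\<^sub>R (w * cis \<phi>)"
    by (subst zw) (simp add: \<rho>_def scaleR_conv_of_real mult_ac)
  have inn: "inner (w * s) z = \<rho> * inner s (cis \<phi>)" for s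
    unfolding zw' by (simp only: inner_scaleR_right inner_mult_unit[OF norm_roots[OF N0 w]])
  have le1: "\<rho> * cos \<phi> \<le> 1"
    using z w inn[of 1] by (auto simp: ngon_def)
  have other: "\<exists>s. t = w * s \<and> s \<in> roots N" if "t \<in> roots N" for t
    using that w roots_nonzero[OF N0 w] roots_mult[OF that roots_inverse[OF w]]
    by (intro exI[of _ "t * inverse w"]) simp
  obtain s where s: "u = w * s" "s \<in> roots N" using other u by blast
  obtain t where t: "v = w * t" "t \<in> roots N" using other v by blast
  have st: "s \<noteq> t" using s t v by auto
  have key: "\<phi> = pi / N \<and> x = cis (2 * pi / N) \<or> \<phi> = - pi / N \<and> x = cis (- 2 * pi / N)"
    "\<rho> * cos \<phi> = 1"
    if x: "x \<in> roots N" "x \<noteq> 1" "inner (w * x) z = 1" for x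
  proof -
    have "inner x (cis \<phi>) \<le> cos \<phi>" using root_inner_cis(1)[OF N0 x(1,2) \<phi>] .
    then have "\<rho> * inner x (cis \<phi>) \<le> \<rho> * cos \<phi>" using \<rho> by simp
    then show e: "\<rho> * cos \<phi> = 1" using le1 x inn by auto
    then have "inner x (cis \<phi>) = cos \<phi>" using x inn \<rho>
      by (metis mult_cancel_left less_irrefl)
    then show "\<phi> = pi / N \<and> x = cis (2 * pi / N) \<or> \<phi> = - pi / N \<and> x = cis (- 2 * pi / N)"
      using root_inner_cis(2)[OF N0 x(1,2) \<phi>] by blast
  qed
  have pn: "pi / N \<noteq> - pi / N" using N by simp
  have main: "z = w * corner N \<and> w * x = w * cis (2 * pi / N) \<or>
      z = w * x * corner N \<and> w = w * x * cis (2 * pi / N)"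
    if x: "x \<in> roots N" "x \<noteq> 1" "inner (w * x) z = 1" for x
    using key(1)[OF x]
  proof (elim disjE conjE)
    have c: "cos (pi / N) > 0" using cos_pi_div_pos[OF N] .
    have tau: "cis (pi / N) = of_real (cos (pi / N)) * corner N"
      unfolding corner_def using c by (intro cis_cos_tan) auto
    {
      assume a: "\<phi> = pi / N" "x = cis (2 * pi / N)"
      have "z = of_real (\<rho> * cos \<phi>) * (w * corner N)"
        unfolding zw' a using tau by (simp add: scaleR_conv_of_real)
      then have "z = w * corner N" by (simp only: key(2)[OF x] of_real_1 mult_1)
      then show ?thesis using a by blast
    next
      assume a: "\<phi> = - pi / N" "x = cis (- 2 * pi / N)"
      have "cis \<phi> = cis (- 2 * pi / N) * cis (pi / N)"
        using a by (simp add: cis_mult field_simps)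
      then have "z = of_real (\<rho> * cos \<phi>) * (w * x * corner N)"
        unfolding zw' using a tau by (simp add: scaleR_conv_of_real)
      then have "z = w * x * corner N" by (simp only: key(2)[OF x] of_real_1 mult_1)
      moreover have "x * cis (2 * pi / N) = 1" using a by (simp add: cis_mult)
      ultimately show ?thesis by (simp add: mult.assoc)
    }
  qed
  show ?thesis
  proof (cases "s = 1")
    case True
    then show ?thesis using main[OF t(2)] s t st v by auto
  next
    case s1: False
    show ?thesis
    proof (cases "t = 1")
      case True
      then show ?thesis using main[OF s(2) s1] s t u by auto
    next
      case False
      have "s = t"
        using key(1)[OF s(2) s1] key(1)[OF t(2) False] u v s t pn by auto
      then show ?thesis using st by simp
    qed
  qed
qed

lemma corner_in_corners:
  assumes N: "N > 2"
  shows "corner N \<in> corners N"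
    and "inner (cis (2 * pi / N)) (corner N) = 1" "inner 1 (corner N) = 1"
    and "u \<in> roots N \<Longrightarrow> inner u (corner N) = 1 \<Longrightarrow> u = 1 \<or> u = cis (2 * pi / N)"
proof -
  have N0: "N > 0" using N by simp
  have c: "cos (pi / N) > 0" using cos_pi_div_pos[OF N] .
  then have tau: "corner N = (1 / cos (pi / N)) *\<^sub>R cis (pi / N)"
    unfolding corner_def by (simp add: complex_eq_iff tan_def)
  have inn: "inner t (corner N) = inner t (cis (pi / N)) / cos (pi / N)" for t
    by (simp add: tau)
  have le: "inner t (corner N) \<le> 1" if "t \<in> roots N" for t
  proof (cases "t = 1")
    case False
    then show ?thesis
      using root_inner_cis(1)[OF N0 that, of "pi / N"] c by (simp add: inn field_simps)
  qed (simp add: corner_def inner_complex_def)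
  show 1: "inner 1 (corner N) = 1" by (simp add: corner_def inner_complex_def)
  have "inner (cis (2 * pi / N)) (cis (pi / N)) = cos (pi / N)"
    by (simp add: inner_cis field_simps)
  then show 2: "inner (cis (2 * pi / N)) (corner N) = 1" using c by (simp add: inn)
  have "cis (2 * pi / N) \<noteq> 1"
  proof
    assume "cis (2 * pi / N) = 1"
    then have "sin (2 * pi / N) = 0" by (simp add: complex_eq_iff)
    moreover have "sin (2 * pi / N) > 0" using N by (intro sin_gt_zero) (auto simp: field_simps)
    ultimately show False by simp
  qed
  moreover have "cis (2 * pi / N) \<in> roots N" using cis_int_roots[OF N0, of 1] by simp
  ultimately show "corner N \<in> corners N"
    using le 1 2 roots_1 unfolding corners_def ngon_def by blast
  assume u: "u \<in> roots N" "inner u (corner N) = 1"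
  show "u = 1 \<or> u = cis (2 * pi / N)"
  proof (rule ccontr)
    assume n: "\<not> ?thesis"
    then have "inner u (cis (pi / N)) = cos (pi / N)" using u c by (simp add: inn)
    then show False
      using root_inner_cis(2)[OF N0 u(1), of "pi / N"] n c N by (auto simp: field_simps)
  qed
qed

lemma corners_eq: "N > 2 \<Longrightarrow> corners N = (\<lambda>u. u * corner N) ` roots N"
proof safe
  fix z assume N: "N > 2" and "z \<in> corners N"
  then obtain u v where "u \<in> roots N" "v \<in> roots N" "u \<noteq> v" "inner u z = 1" "inner v z = 1" "z \<in> ngon N"
    unfolding corners_def by blast
  then show "z \<in> (\<lambda>u. u * corner N) ` roots N"
    using ngon_sides[OF N, of z u v] by blast
next
  fix u assume "N > 2" "u \<in> roots N"
  then show "u * corner N \<in> corners N"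
    by (intro corners_mult corner_in_corners) auto
qed

text \<open>There are finitely many sides, so those that do not contain \<open>x\<close> stay away
  from a common ball; near \<open>x\<close> only the sides through \<open>x\<close> matter.\<close>

lemma strict_sides_nbhd:
  assumes "N > 0"
  shows "\<exists>e>0. \<forall>z\<in>cball x e. \<forall>u\<in>roots N. inner u x < 1 \<longrightarrow> inner u z < 1"
proof -
  define U where "U = (\<Inter>u\<in>{u\<in>roots N. inner u x < 1}. {z. inner u z < 1})"
  have "open U" unfolding U_def
    using finite_roots[OF assms] by (intro open_INT) (auto simp: open_halfspace_lt)
  moreover have "x \<in> U" by (simp add: U_def)
  ultimately obtain e where "e > 0" "cball x e \<subseteq> U"
    by (meson open_contains_cball)
  then show ?thesis
    unfolding U_def by (intro exI[of _ e]) blast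
qed

lemma compact_ngon:
  assumes "N > 2"
  shows "compact (ngon N)"
proof -
  have N0: "N > 0" using assms by simp
  have "norm z \<le> 1 / cos (pi / N)" if "z \<in> ngon N" for z
  proof -
    obtain w \<phi> where w: "w \<in> roots N" and \<phi>: "\<bar>\<phi>\<bar> \<le> pi / N" and zw: "z = of_real (norm z) * w * cis \<phi>"
      using nearest_root[OF N0] by blast
    have "z = w * (norm z *\<^sub>R cis \<phi>)"
      by (subst zw) (simp add: scaleR_conv_of_real mult_ac)
    then have "inner w z = inner (w * 1) (w * (norm z *\<^sub>R cis \<phi>))"
      by simp
    also have "\<dots> = norm z * cos \<phi>"
      unfolding inner_mult_unit[OF norm_roots[OF N0 w]] by (simp add: inner_complex_def)
    finally have "norm z * cos \<phi> \<le> 1" using that w by (auto simp: ngon_def)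
    moreover have "cos (pi / N) \<le> cos \<phi>"
      using cos_monotone_0_pi_le[of "\<bar>\<phi>\<bar>" "pi / N"] \<phi> assms by (simp add: field_simps)
    then have "norm z * cos (pi / N) \<le> norm z * cos \<phi>"
      by (intro mult_left_mono) auto
    ultimately show ?thesis
      using cos_pi_div_pos[OF assms] by (simp add: field_simps)
  qed
  then have "bounded (ngon N)"
    by (auto simp: bounded_iff)
  then show ?thesis
    by (simp add: compact_eq_bounded_closed closed_ngon)
qed

section \<open>Quotient topologies\<close>

text \<open>The quotient is carried by the image of \<open>f\<close> in the target type instead of
  by a set of equivalence classes, because the surface has to live in a prescribed type.\<close>

definition final_topology :: "'b topology \<Rightarrow> ('b \<Rightarrow> 'a) \<Rightarrow> 'a topology" where
  "final_topology X f = topology (\<lambda>U. U \<subseteq> f ` topspace X \<and> openin X {x \<in> topspace X. f x \<in> U})"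

lemma openin_final_topology:
  "openin (final_topology X f) U \<longleftrightarrow> U \<subseteq> f ` topspace X \<and> openin X {x \<in> topspace X. f x \<in> U}"
proof -
  have "istopology (\<lambda>U. U \<subseteq> f ` topspace X \<and> openin X {x \<in> topspace X. f x \<in> U})"
    unfolding istopology_def
  proof (intro conjI allI impI)
    fix S T
    assume "S \<subseteq> f ` topspace X \<and> openin X {x \<in> topspace X. f x \<in> S}"
      and "T \<subseteq> f ` topspace X \<and> openin X {x \<in> topspace X. f x \<in> T}"
    moreover have "{x \<in> topspace X. f x \<in> S \<inter> T} = {x \<in> topspace X. f x \<in> S} \<inter> {x \<in> topspace X. f x \<in> T}"
      by auto
    ultimately show "S \<inter> T \<subseteq> f ` topspace X" "openin X {x \<in> topspace X. f x \<in> S \<inter> T}"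
      by (auto simp: openin_Int)
  next
    fix \<K>
    assume *: "\<forall>K\<in>\<K>. K \<subseteq> f ` topspace X \<and> openin X {x \<in> topspace X. f x \<in> K}"
    have "{x \<in> topspace X. f x \<in> \<Union>\<K>} = (\<Union>K\<in>\<K>. {x \<in> topspace X. f x \<in> K})"
      by auto
    then show "openin X {x \<in> topspace X. f x \<in> \<Union>\<K>}"
      using * by (auto intro!: openin_Union)
    show "\<Union>\<K> \<subseteq> f ` topspace X"
      using * by blast
  qed
  then show ?thesis
    by (simp add: final_topology_def topology_inverse')
qed

lemma topspace_final_topology [simp]: "topspace (final_topology X f) = f ` topspace X"
proof
  show "topspace (final_topology X f) \<subseteq> f ` topspace X"
    using openin_final_topology[of X f "topspace (final_topology X f)"] by simp
  have "{x \<in> topspace X. f x \<in> f ` topspace X} = topspace X"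
    by auto
  then have "openin (final_topology X f) (f ` topspace X)"
    by (simp add: openin_final_topology)
  then show "f ` topspace X \<subseteq> topspace (final_topology X f)"
    by (rule openin_subset)
qed

lemma quotient_map_final_topology: "quotient_map X (final_topology X f) f"
  unfolding quotient_map_def by (simp add: openin_final_topology)

lemma closed_map_saturation:
  assumes q: "quotient_map X Y f"
    and sat: "\<And>C. closedin X C \<Longrightarrow> closedin X {x \<in> topspace X. f x \<in> f ` C}"
  shows "closed_map X Y f"
  unfolding closed_map_def
proof safe
  fix C assume C: "closedin X C"
  then have "f ` C \<subseteq> topspace Y"
    using q closedin_subset unfolding quotient_map_def by blast
  then show "closedin Y (f ` C)"
    using q sat[OF C] unfolding quotient_map_closedin by blast
qed

text \<open>The detour through normality is taken because normality passes to closed continuous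
  images, whereas the Hausdorff property by itself does not.\<close>

lemma Hausdorff_closed_quotient:
  assumes X: "compact_space X" "Hausdorff_space X"
    and q: "quotient_map X Y f" and c: "closed_map X Y f"
  shows "Hausdorff_space Y"
proof -
  have "normal_space X"
    using X by (simp add: compact_Hausdorff_or_regular_imp_normal_space)
  then have "normal_space Y"
    using normal_space_continuous_closed_map_image[OF _ _ c] q
    by (simp add: quotient_imp_continuous_map quotient_imp_surjective_map)
  moreover have "t1_space Y"
    using X(2) q c by (meson Hausdorff_imp_t1_space t1_space_closed_map_image quotient_imp_surjective_map)
  ultimately show ?thesis
    by (simp add: normal_t1_eq_Hausdorff_space normal_t1_imp_Hausdorff_space)
qed

text \<open>Images of basic open sets need not be open. The base of \<open>Y\<close> consists
  instead of the sets \<open>V F\<close> of points whose whole fibre lies in the union of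
  \<open>F\<close>: they are open because \<open>f\<close> is closed, and since fibres are compact,
  finite \<open>F\<close> suffice, which keeps the base countable.\<close>

lemma second_countable_closed_quotient:
  assumes X: "compact_space X" "second_countable X"
    and q: "quotient_map X Y f" and c: "closed_map X Y f" and t1: "t1_space Y"
  shows "second_countable Y"
proof -
  obtain \<B> where B: "countable \<B>" "\<And>V. V \<in> \<B> \<Longrightarrow> openin X V"
    "\<And>U x. openin X U \<Longrightarrow> x \<in> U \<Longrightarrow> \<exists>V \<in> \<B>. x \<in> V \<and> V \<subseteq> U"
    using X(2) unfolding second_countable_def by metis
  define V where "V F = topspace Y - f ` (topspace X - \<Union>F)" for F
  define \<C> where "\<C> = V ` {F. finite F \<and> F \<subseteq> \<B>}"
  have surj: "f ` topspace X = topspace Y"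
    using quotient_imp_surjective_map[OF q] .
  have "countable \<C>"
    unfolding \<C>_def using B(1) by (intro countable_image countable_Collect_finite_subset)
  moreover have "openin Y W" if W: "W \<in> \<C>" for W
  proof -
    obtain F where F: "W = V F" "F \<subseteq> \<B>" using W unfolding \<C>_def by blast
    then have "openin X (\<Union>F)" using B(2) by blast
    then have "closedin Y (f ` (topspace X - \<Union>F))"
      using c unfolding closed_map_def by blast
    then show ?thesis unfolding F V_def by blast
  qed
  moreover have "\<exists>W\<in>\<C>. p \<in> W \<and> W \<subseteq> U" if U: "openin Y U" "p \<in> U" for U p
  proof -
    define K where "K = {x \<in> topspace X. f x \<in> {p}}"
    have p: "p \<in> topspace Y" using U openin_subset by blast
    have "closedin Y {p}" using t1 p by (simp add: t1_space_closedin_singleton)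
    then have "closedin X K"
      using q p unfolding quotient_map_closedin K_def by blast
    then have K: "compactin X K" using X(1) closedin_compact_space by blast
    have O: "openin X {x \<in> topspace X. f x \<in> U}"
      using q U openin_subset unfolding quotient_map_def by blast
    define \<U> where "\<U> = {V \<in> \<B>. V \<subseteq> {x \<in> topspace X. f x \<in> U}}"
    have "K \<subseteq> \<Union>\<U>"
      using B(3)[OF O] U unfolding K_def \<U>_def by blast
    moreover have "\<forall>V\<in>\<U>. openin X V" using B(2) by (simp add: \<U>_def)
    ultimately obtain F where F: "finite F" "F \<subseteq> \<U>" "K \<subseteq> \<Union>F"
      using K unfolding compactin_def by metis
    have "p \<in> V F" using F(3) p by (auto simp: V_def K_def)
    moreover have "V F \<subseteq> U"
    proof
      fix y assume y: "y \<in> V F"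
      then obtain x where "x \<in> topspace X" "y = f x"
        using surj unfolding V_def by blast
      then show "y \<in> U"
        using y F(2) unfolding V_def \<U>_def by blast
    qed
    moreover have "V F \<in> \<C>" using F by (auto simp: \<C>_def \<U>_def)
    ultimately show ?thesis by blast
  qed
  ultimately show ?thesis
    unfolding second_countable_def by blast
qed

text \<open>A map on a compact saturated piece of \<open>S\<close> that identifies the same points
  as \<open>f\<close> descends to a coordinate of the quotient. The closed ball supplies
  compactness: in the open ball, the complement of the image of an open set is cut out by the image
  of a compact set, which makes \<open>h\<close> open.\<close>

lemma quotient_coordinate:
  fixes H :: "'b::t2_space \<Rightarrow> 'c::real_normed_vector"
  assumes q: "quotient_map (top_of_set S) X f"
    and E: "E \<subseteq> S" "compact E" and sat: "\<And>z w. z \<in> E \<Longrightarrow> w \<in> S \<Longrightarrow> f w = f z \<Longrightarrow> w \<in> E"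
    and H: "continuous_on E H" "H ` E = cball 0 r"
    and inj: "\<And>z w. z \<in> E \<Longrightarrow> w \<in> E \<Longrightarrow> H z = H w \<longleftrightarrow> f z = f w"
    and O: "openin (top_of_set S) {z \<in> E. norm (H z) < r}"
  shows "\<exists>h U. openin X U \<and> U = f ` {z \<in> E. norm (H z) < r} \<and>
    homeomorphic_map (subtopology X U) (top_of_set (ball 0 r)) h \<and> (\<forall>z\<in>E. h (f z) = H z)"
proof -
  define h where "h y = H (SOME z. z \<in> E \<and> f z = y)" for y
  have hf: "h (f z) = H z" if "z \<in> E" for z
  proof -
    have "(SOME w. w \<in> E \<and> f w = f z) \<in> E \<and> f (SOME w. w \<in> E \<and> f w = f z) = f z"
      by (rule someI[of "\<lambda>w. w \<in> E \<and> f w = f z" z]) (use that in simp)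
    then show ?thesis unfolding h_def using inj that by blast
  qed
  define E0 where "E0 = {z \<in> E. norm (H z) < r}"
  define U where "U = f ` E0"
  have surj: "f ` S = topspace X" using quotient_imp_surjective_map[OF q] by simp
  have sat0: "w \<in> E0" if "z \<in> E0" "w \<in> S" "f w = f z" for z w
    using that sat[of z w] inj[of z w] by (auto simp: E0_def)
  have "E0 \<subseteq> S"
    using E by (auto simp: E0_def)
  then have pre: "{x \<in> S. f x \<in> U} = E0"
    using sat0 unfolding U_def by blast
  have UX: "U \<subseteq> topspace X" using surj E by (auto simp: U_def E0_def)
  have U: "openin X U"
    using q UX O pre unfolding quotient_map_def by (auto simp: E0_def)
  have qU: "quotient_map (top_of_set E0) (subtopology X U) f"
  proof -
    have "quotient_map (subtopology (top_of_set S) E0) (subtopology X U) f"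
      by (rule quotient_map_restriction[OF q]) (use U pre in auto)
    moreover have "subtopology (top_of_set S) E0 = top_of_set E0"
      using E by (simp add: subtopology_subtopology E0_def Int_absorb1 subset_iff)
    ultimately show ?thesis by simp
  qed
  have "continuous_on E0 (h \<circ> f)"
    using continuous_on_subset[OF H(1), of E0] hf by (subst continuous_on_cong[of _ E0 _ H]) (auto simp: E0_def)
  moreover have im0: "H ` E0 = ball 0 r"
  proof
    show "ball 0 r \<subseteq> H ` E0"
    proof
      fix w :: 'c assume w: "w \<in> ball 0 r"
      then have "w \<in> H ` E" using H(2) by auto
      then show "w \<in> H ` E0" using w by (auto simp: E0_def)
    qed
  qed (auto simp: E0_def)
  have "(h \<circ> f) ` E0 = H ` E0" using hf by (auto simp: E0_def)
  ultimately have "continuous_map (top_of_set E0) (top_of_set (ball 0 r)) (h \<circ> f)"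
    using im0 unfolding continuous_map_in_subtopology by (auto simp: image_subset_iff)
  then have cont: "continuous_map (subtopology X U) (top_of_set (ball 0 r)) h"
    using continuous_compose_quotient_map[OF qU] by blast
  have inj_h: "inj_on h U"
    using hf inj unfolding U_def E0_def inj_on_def by auto
  have img: "h ` U = ball 0 r"
    unfolding U_def im0[symmetric] image_image using hf by (intro image_cong) (auto simp: E0_def)
  have "open_map (subtopology X U) (top_of_set (ball 0 r)) h"
    unfolding open_map_def
  proof safe
    fix V assume "openin (subtopology X U) V"
    then have V: "openin X V" "V \<subseteq> U"
      using U openin_open_subtopology by blast+
    define W where "W = {x \<in> S. f x \<in> V}"
    have "openin (top_of_set S) W"
      using q V(1) openin_subset[OF V(1)] unfolding quotient_map_def W_def by simp
    then obtain T where T: "open T" "W = S \<inter> T"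
      by (auto simp: openin_open)
    have "compact (E - W)"
    proof -
      have "E - W = E - T" using T E by auto
      then show ?thesis using compact_diff[OF E(2) T(1)] by simp
    qed
    then have "compact (H ` (E - W))"
      using H(1) by (meson compact_continuous_image continuous_on_subset Diff_subset)
    then have "closed (H ` (E - W))" by (rule compact_imp_closed)
    moreover have "h ` V = ball 0 r - H ` (E - W)"
    proof safe
      fix y assume y: "y \<in> V"
      then obtain z where z: "z \<in> E0" "y = f z" using V by (auto simp: U_def)
      then show "h y \<in> ball 0 r" using hf by (auto simp: E0_def)
      fix w assume w: "h y = H w" "w \<in> E" "w \<notin> W"
      then have "f w = y" using z hf inj by (auto simp: E0_def)
      then show False using w y E by (auto simp: W_def)
    next
      fix w :: 'c assume w: "w \<in> ball 0 r" "w \<notin> H ` (E - W)"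
      then obtain z where z: "z \<in> E0" "w = H z" using im0 by blast
      then have "z \<in> W" using w by (auto simp: E0_def)
      then show "w \<in> h ` V" using z hf by (auto simp: W_def E0_def intro!: image_eqI[of _ _ "f z"])
    qed
    ultimately show "openin (top_of_set (ball 0 r)) (h ` V)"
      by (auto simp: openin_open Diff_eq intro!: exI[of _ "- H ` (E - W)"])
  qed
  then have "homeomorphic_map (subtopology X U) (top_of_set (ball 0 r)) h"
    using cont inj_h img UX
    by (intro bijective_open_imp_homeomorphic_map) (auto simp: Int_absorb1)
  then show ?thesis
    using U hf unfolding U_def E0_def by blast
qed

section \<open>Local coordinates away from the corners\<close>

text \<open>Near every representative in the polygon, \<open>d\<close> is a translation of the
  polygon coordinate. The notion makes sense at the corner point too, where \<open>d\<close> is not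
  injective, so regular points and cone points can be treated alike.\<close>

definition development ::
    "complex set \<Rightarrow> (complex \<Rightarrow> 'a) \<Rightarrow> 'a set \<Rightarrow> ('a \<Rightarrow> complex) \<Rightarrow> bool" where
  "development S f U d \<longleftrightarrow>
     (\<forall>x\<in>S. f x \<in> U \<longrightarrow> (\<exists>e>0. \<forall>z\<in>S. dist z x < e \<longrightarrow> d (f z) - d (f x) = z - x))"

text \<open>\<open>A\<close> consists of the representatives of one point of the quotient. By
  \<open>piece\<close>, \<open>H\<close> is a branch of the \<open>k\<close>-th root of
  \<open>(z - a) / c\<close> about each representative \<open>a\<close>, which is why radius
  \<open>r\<close> for \<open>H\<close> corresponds to radius \<open>r ^ k\<close> in the polygon.
  With \<open>k = 1\<close> this covers interior points and sides, with larger \<open>k\<close> the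
  corner point.\<close>

lemma cone_coordinate_from_pieces:
  fixes A :: "complex set" and r :: real
  assumes q: "quotient_map (top_of_set S) X f" and S: "compact S"
    and A: "finite A" "A \<subseteq> S" and r: "r > 0" and k: "k > 0" and c: "norm c = 1"
  defines "E \<equiv> S \<inter> (\<Union>a\<in>A. cball a (r ^ k))"
  assumes H: "continuous_on E H" "cball 0 r \<subseteq> H ` E"
    and piece: "\<And>a z. a \<in> A \<Longrightarrow> z \<in> S \<Longrightarrow> dist z a \<le> r ^ k \<Longrightarrow> c * H z ^ k = z - a"
    and sat: "\<And>z w. z \<in> E \<Longrightarrow> w \<in> S \<Longrightarrow> f w = f z \<Longrightarrow> w \<in> E"
    and inj: "\<And>z w. z \<in> E \<Longrightarrow> w \<in> E \<Longrightarrow> H z = H w \<longleftrightarrow> f z = f w"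
  shows "\<exists>U h. openin X U \<and> f ` A \<subseteq> U \<and> (\<forall>a\<in>A. h (f a) = 0) \<and>
    homeomorphic_map (subtopology X U) (top_of_set (ball 0 r)) h \<and>
    development S f U (\<lambda>y. c * h y ^ k)"
proof -
  have nrm: "norm (H z) ^ k = dist z a" if "a \<in> A" "z \<in> S" "dist z a \<le> r ^ k" for a z
    using arg_cong[OF piece[OF that], of norm] c by (simp add: norm_mult norm_power dist_norm)
  have le: "norm (H z) \<le> r" if "z \<in> E" for z
  proof -
    obtain a where a: "a \<in> A" "z \<in> S" "dist z a \<le> r ^ k"
      using \<open>z \<in> E\<close> by (auto simp: E_def dist_commute)
    then have "norm (H z) ^ k \<le> r ^ k" using nrm by simp
    then show ?thesis using k r by (simp add: power_mono_iff)
  qed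
  have O: "{z \<in> E. norm (H z) < r} = S \<inter> (\<Union>a\<in>A. ball a (r ^ k))"
  proof safe
    fix z assume z: "z \<in> E" "norm (H z) < r"
    then obtain a where a: "a \<in> A" "z \<in> S" "dist z a \<le> r ^ k"
      by (auto simp: E_def dist_commute)
    have "norm (H z) ^ k < r ^ k" using z k by (simp add: power_strict_mono)
    then have "z \<in> ball a (r ^ k)" using nrm[OF a] by (simp add: dist_commute)
    then show "z \<in> (\<Union>a\<in>A. ball a (r ^ k))" using a by blast
  next
    fix z a assume z: "z \<in> S" "a \<in> A" "z \<in> ball a (r ^ k)"
    then show "z \<in> E" unfolding E_def by (auto intro!: bexI[of _ a] less_imp_le)
    have "norm (H z) ^ k < r ^ k"
      using z nrm[of a z] by (simp add: dist_commute)
    then show "norm (H z) < r"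
      using r by (simp add: power_less_imp_less_base)
  qed (auto simp: E_def)
  have cE: "compact E"
    unfolding E_def using S A by (intro compact_Int_closed closed_UN) auto
  have HE: "H ` E = cball 0 r"
    using H(2) le by auto
  have oE: "openin (top_of_set S) {z \<in> E. norm (H z) < r}"
    unfolding O by (intro openin_open_Int open_UN) auto
  have "E \<subseteq> S" by (auto simp: E_def)
  have "\<exists>h U. openin X U \<and> U = f ` {z \<in> E. norm (H z) < r} \<and>
    homeomorphic_map (subtopology X U) (top_of_set (ball 0 r)) h \<and> (\<forall>z\<in>E. h (f z) = H z)"
    using sat inj by (intro quotient_coordinate[OF q \<open>E \<subseteq> S\<close> cE _ H(1) HE _ oE])
  then obtain h U where hU: "openin X U" "U = f ` {z \<in> E. norm (H z) < r}"
    "homeomorphic_map (subtopology X U) (top_of_set (ball 0 r)) h" "\<And>z. z \<in> E \<Longrightarrow> h (f z) = H z"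
    by auto
  have ctr: "a \<in> E" "H a = 0" if "a \<in> A" for a
  proof -
    show "a \<in> E" using that A r unfolding E_def by (auto intro!: bexI[of _ a])
    have "a \<in> S" "dist a a \<le> r ^ k" using that A r by auto
    from nrm[OF that this] show "H a = 0" using k by simp
  qed
  have "development S f U (\<lambda>y. c * h y ^ k)"
    unfolding development_def
  proof (intro ballI impI)
    fix x assume x: "x \<in> S" "f x \<in> U"
    then obtain y where y: "y \<in> E" "norm (H y) < r" "f x = f y"
      unfolding hU(2) by blast
    then have "x \<in> E" using sat x by blast
    moreover have "norm (H x) < r" using y inj[OF \<open>x \<in> E\<close> y(1)] by simp
    ultimately obtain a where a: "a \<in> A" "x \<in> ball a (r ^ k)" using O by blast
    define e where "e = r ^ k - dist x a"
    have "c * h (f z) ^ k - c * h (f x) ^ k = z - x" if z: "z \<in> S" "dist z x < e" for z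
    proof -
      have "dist z a \<le> r ^ k" using z dist_triangle[of z a x] by (simp add: e_def)
      moreover have "dist x a \<le> r ^ k" using a by (simp add: dist_commute)
      moreover have "z \<in> E" using z a \<open>dist z a \<le> r ^ k\<close> by (auto simp: E_def dist_commute)
      ultimately show ?thesis
        using hU(4) \<open>x \<in> E\<close> piece[OF a(1), of z] piece[OF a(1), of x] z x by simp
    qed
    moreover have "e > 0" using a by (simp add: e_def dist_commute)
    ultimately show "\<exists>e>0. \<forall>z\<in>S. dist z x < e \<longrightarrow> c * h (f z) ^ k - c * h (f x) ^ k = z - x"
      by blast
  qed
  moreover have "f ` A \<subseteq> U" using ctr r unfolding hU(2) by auto
  moreover have "\<forall>a\<in>A. h (f a) = 0" using ctr hU(4) by simp
  ultimately show ?thesis using hU by blast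
qed

text \<open>With \<open>2 * k + 2\<close> sides the interior angles add up to
  \<open>2 * pi * k\<close>, so \<open>k\<close> is the multiplicity of the corner point. The map
  \<open>pr\<close> is any map with the right fibres on the polygon, which leaves the type of points
  open.\<close>

locale glued_ngon =
  fixes k :: nat and pr :: "complex \<Rightarrow> 'a"
  assumes odd_k: "odd k" and k_ge: "k \<ge> 3"
    and pr_eq: "\<And>x y. x \<in> ngon (2 * k + 2) \<Longrightarrow> y \<in> ngon (2 * k + 2) \<Longrightarrow>
      pr x = pr y \<longleftrightarrow> glued (2 * k + 2) x y"
begin

definition N where "N = 2 * k + 2"
definition P where "P = ngon N"
definition X where "X = final_topology (top_of_set P) pr"

section \<open>The glued polygon as a topological space\<close>

lemma N: "N > 0" "even N" "N > 2" "N \<ge> 8"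
  using k_ge by (auto simp: N_def)

lemma pr_iff: "x \<in> P \<Longrightarrow> y \<in> P \<Longrightarrow> pr x = pr y \<longleftrightarrow> glued N x y"
  using pr_eq by (simp add: P_def N_def)

lemma compact_P: "compact P"
  using compact_ngon[OF N(3)] by (simp add: P_def)

lemma connected_P: "connected P"
  by (simp add: P_def convex_ngon convex_connected)

lemma corners_P: "corners N \<subseteq> P"
  by (auto simp: corners_def P_def)

lemma topspace_X: "topspace X = pr ` P"
  by (simp add: X_def)

lemma quotient_pr: "quotient_map (top_of_set P) X pr"
  unfolding X_def by (rule quotient_map_final_topology)

text \<open>Saturating a closed set adds at most the finite set of corners and, for each of the
  finitely many sides, a translate of a compact set.\<close>

lemma closed_map_pr: "closed_map (top_of_set P) X pr"
proof (rule closed_map_saturation[OF quotient_pr])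
  fix C assume "closedin (top_of_set P) C"
  then have C: "closed C" "C \<subseteq> P"
    using closedin_closed_trans[OF _ compact_imp_closed[OF compact_P]] closedin_imp_subset by blast+
  have fin: "finite (corners N)"
    using corners_eq[OF N(3)] finite_roots[OF N(1)] by simp
  have eq: "{x \<in> P. pr x \<in> pr ` C} = C \<union> (if C \<inter> corners N = {} then {} else corners N) \<union>
    (\<Union>u\<in>roots N. (\<lambda>z. z - 2 * u) ` (C \<inter> {z. inner u z = 1}))" (is "?L = ?R")
  proof (intro equalityI subsetI)
    fix x assume "x \<in> ?L"
    then obtain y where y: "y \<in> C" "pr y = pr x" "x \<in> P" by auto
    then have "glued N y x" using pr_iff C by blast
    then show "x \<in> ?R" using y unfolding glued_def by auto
  next
    fix x assume "x \<in> ?R"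
    then have "\<exists>y\<in>C. glued N y x"
      unfolding glued_def by (auto split: if_splits)
    then obtain y where y: "y \<in> C" "glued N y x" by blast
    then have "x \<in> P" using glued_ngon[OF N(1,2)] C by (auto simp: P_def)
    moreover have "y \<in> P" using y C by blast
    ultimately have "pr x = pr y" using y pr_iff[of y x] by simp
    then show "x \<in> ?L" using y \<open>x \<in> P\<close> by simp
  qed
  have "closed ?R"
  proof (intro closed_Un closed_UN ballI)
    fix u assume "u \<in> roots N"
    have "compact (C \<inter> {z. inner u z = 1})"
    proof -
      have "C \<inter> {z. inner u z = 1} = P \<inter> (C \<inter> {z. inner u z = 1})" using C by blast
      then show ?thesis
        using compact_Int_closed[OF compact_P closed_Int[OF C(1) closed_hyperplane]] by metis
    qed
    then have "compact ((\<lambda>z. z - 2 * u) ` (C \<inter> {z. inner u z = 1}))"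
      by (intro compact_continuous_image continuous_intros)
    then show "closed ((\<lambda>z. z - 2 * u) ` (C \<inter> {z. inner u z = 1}))"
      by (rule compact_imp_closed)
  qed (use C fin finite_roots[OF N(1)] in \<open>auto intro: finite_imp_closed\<close>)
  then show "closedin (top_of_set P) {x \<in> topspace (top_of_set P). pr x \<in> pr ` C}"
    unfolding eq[symmetric] by (auto simp: closedin_closed Collect_conj_eq)
qed

lemma Hausdorff_X: "Hausdorff_space X"
  using compact_P by (intro Hausdorff_closed_quotient[OF _ _ quotient_pr closed_map_pr])
    (auto simp: Hausdorff_space_subtopology compact_space_subtopology)

lemma second_countable_X: "second_countable X"
proof (rule second_countable_closed_quotient[OF _ _ quotient_pr closed_map_pr])
  obtain B :: "complex set set" where B: "countable B" "\<And>C. C \<in> B \<Longrightarrow> open C"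
    "\<And>S. open S \<Longrightarrow> \<exists>U. U \<subseteq> B \<and> S = \<Union>U"
    by (rule univ_second_countable) blast
  have "\<exists>V\<in>B. x \<in> V \<and> V \<subseteq> U" if "open U" "x \<in> U" for U x
    using B(3)[OF that(1)] that(2) by blast
  then have "second_countable (euclidean :: complex topology)"
    unfolding second_countable_def using B by (intro exI[of _ B]) auto
  then show "second_countable (top_of_set P)"
    by (rule second_countable_subtopology)
qed (use compact_P Hausdorff_X Hausdorff_imp_t1_space in \<open>auto simp: compact_space_subtopology\<close>)

lemma compact_X: "compact_space X"
  using compact_P image_compactin[of "top_of_set P" P X pr] quotient_imp_continuous_map[OF quotient_pr]
  by (simp add: compact_space_def topspace_X compactin_subtopology)

lemma connected_X: "connected_space X"
  using connected_P connectedin_continuous_map_image[OF quotient_imp_continuous_map[OF quotient_pr], of P]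
  by (simp add: topspace_X connectedin_subtopology flip: connectedin_topspace)

section \<open>Coordinates at interior points and at points of sides\<close>

lemma interior_coordinate:
  assumes x: "x \<in> P" "\<And>u. u \<in> roots N \<Longrightarrow> inner u x < 1"
  shows "\<exists>U h r. r > 0 \<and> openin X U \<and> pr x \<in> U \<and> h (pr x) = 0 \<and>
    homeomorphic_map (subtopology X U) (top_of_set (ball 0 r)) h \<and>
    development P pr U h"
proof -
  obtain r where r: "r > 0" "\<And>z u. z \<in> cball x r \<Longrightarrow> u \<in> roots N \<Longrightarrow> inner u z < 1"
    using strict_sides_nbhd[OF N(1), of x] x by blast
  have sub: "cball x r \<subseteq> P"
    using r(2) unfolding P_def ngon_def by fastforce
  have g: "w = z" if "z \<in> cball x r" "glued N z w" for z w
    using that r(2)[OF that(1)] unfolding glued_def corners_def by fastforce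
  have iff: "pr z = pr w \<longleftrightarrow> z = w" if "z \<in> cball x r" "w \<in> P" for z w
    using g[OF that(1), of w] pr_iff[of z w] sub that glued_refl by blast
  have E: "P \<inter> (\<Union>a\<in>{x}. cball a (r ^ 1)) = cball x r" using sub by auto
  have "\<exists>U h. openin X U \<and> pr ` {x} \<subseteq> U \<and> (\<forall>a\<in>{x}. h (pr a) = 0) \<and>
    homeomorphic_map (subtopology X U) (top_of_set (ball 0 r)) h \<and>
    development P pr U (\<lambda>y. 1 * h y ^ 1)"
  proof (rule cone_coordinate_from_pieces[OF quotient_pr compact_P, where H = "\<lambda>z. z - x"], unfold E)
    show "cball 0 r \<subseteq> (\<lambda>z. z - x) ` cball x r"
    proof
      fix w :: complex assume "w \<in> cball 0 r"
      then show "w \<in> (\<lambda>z. z - x) ` cball x r"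
        by (intro image_eqI[of _ _ "x + w"]) (auto simp: dist_norm)
    qed
    show "continuous_on (cball x r) (\<lambda>z. z - x)"
      by (intro continuous_intros)
    show "w \<in> cball x r" if "z \<in> cball x r" "w \<in> P" "pr w = pr z" for z w
      using iff[OF that(1,2)] that by simp
    show "z - x = w - x \<longleftrightarrow> pr z = pr w" if "z \<in> cball x r" "w \<in> cball x r" for z w
      using iff[of z w] that sub by auto
  qed (use x r in auto)
  then show ?thesis using r(1) by auto
qed

text \<open>Half-discs about \<open>x\<close> and about its partner \<open>x'\<close> on the
  opposite side fit together along their diameters to a disc.\<close>

lemma side_coordinate:
  assumes x: "x \<in> P" "x \<notin> corners N" and u: "u \<in> roots N" "inner u x = 1"
  shows "\<exists>U h r. r > 0 \<and> openin X U \<and> pr x \<in> U \<and> h (pr x) = 0 \<and>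
    homeomorphic_map (subtopology X U) (top_of_set (ball 0 r)) h \<and>
    development P pr U h"
proof -
  define x' where "x' = x - 2 * u"
  have u': "- u \<in> roots N" "inner (- u) x' = 1" and x': "x' \<in> P" "x' \<notin> corners N"
  proof -
    show "- u \<in> roots N" using u roots_uminus[OF N(2)] by blast
    show 1: "inner (- u) x' = 1" "x' \<in> P"
      using opposite_side[OF N(1,2) u] x by (auto simp: P_def x'_def)
    have "x' - 2 * (- u) = x" by (simp add: x'_def)
    then show "x' \<notin> corners N"
      using opposite_side(2)[OF N(1,2) \<open>- u \<in> roots N\<close> 1(1)] x(2) by metis
  qed
  have strict: "inner t y < 1" if "y \<in> P" "y \<notin> corners N" "s \<in> roots N" "inner s y = 1" "t \<in> roots N" "t \<noteq> s" for t s y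
    using that unfolding corners_def P_def ngon_def by force
  obtain r0 where r0: "r0 > 0" "\<And>z t. z \<in> cball x r0 \<Longrightarrow> t \<in> roots N \<Longrightarrow> inner t x < 1 \<Longrightarrow> inner t z < 1"
    using strict_sides_nbhd[OF N(1), of x] by blast
  obtain r1 where r1: "r1 > 0" "\<And>z t. z \<in> cball x' r1 \<Longrightarrow> t \<in> roots N \<Longrightarrow> inner t x' < 1 \<Longrightarrow> inner t z < 1"
    using strict_sides_nbhd[OF N(1), of x'] by blast
  \<comment> \<open>The points \<open>x\<close> and \<open>x'\<close> have distance 2, so the bound
    1/2 keeps the two half-discs apart and the case distinction in \<open>H\<close>
    unambiguous.\<close>
  define r where "r = min (min r0 r1) (1/2)"
  have r: "r > 0" using r0 r1 by (simp add: r_def)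
  have s0: "inner t z < 1" if "dist z x \<le> r" "t \<in> roots N" "t \<noteq> u" for t z
    using r0(2)[of z t] that strict[OF x u that(2,3)] by (simp add: r_def dist_commute)
  have s1: "inner t z < 1" if "dist z x' \<le> r" "t \<in> roots N" "t \<noteq> - u" for t z
    using r1(2)[of z t] that strict[OF x' u' that(2,3)] by (simp add: r_def dist_commute)
  have uu: "inner u u = 1" "norm u = 1" using norm_roots[OF N(1) u(1)] by (simp_all add: dot_square_norm)
  have i2u: "inner u (2 * u) = 2"
    using inner_scaleR_right[of u 2 u] uu by (simp add: scaleR_conv_of_real)
  have far: "\<not> (dist z x \<le> r \<and> dist z x' \<le> r)" for z
  proof
    assume "dist z x \<le> r \<and> dist z x' \<le> r"
    then have "dist x x' \<le> 2 * r" using dist_triangle[of x x' z] by (simp add: dist_commute)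
    moreover have "dist x x' = 2" using uu by (simp add: x'_def dist_norm norm_mult)
    ultimately show False by (simp add: r_def)
  qed
  define H where "H z = (if dist z x \<le> r then z - x else z - x')" for z
  define E where "E = P \<inter> (\<Union>a\<in>{x, x'}. cball a (r ^ 1))"
  have E: "z \<in> E \<longleftrightarrow> z \<in> P \<and> (dist z x \<le> r \<or> dist z x' \<le> r)" for z
    by (auto simp: E_def dist_commute)
  have nc: "z \<notin> corners N" if "z \<in> E" for z
  proof
    assume "z \<in> corners N"
    then obtain s t where "s \<in> roots N" "t \<in> roots N" "s \<noteq> t" "inner s z = 1" "inner t z = 1"
      unfolding corners_def by blast
    then show False using that s0[of z s] s0[of z t] s1[of z s] s1[of z t] unfolding E by force
  qed
  have step: "w \<in> E \<and> H z = H w" if zw: "z \<in> E" "glued N z w" for z w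
  proof (cases "z = w")
    case False
    then obtain t where t: "t \<in> roots N" "inner t z = 1" "w = z - 2 * t"
      using zw nc unfolding glued_def by blast
    have wP: "w \<in> P" using zw glued_ngon[OF N(1,2)] unfolding E P_def by blast
    consider "dist z x \<le> r" | "dist z x' \<le> r" using \<open>z \<in> E\<close> unfolding E by blast
    then show ?thesis
    proof cases
      case 1
      then have "t = u" using s0 t by force
      then have "w - x' = z - x" using t by (simp add: x'_def)
      then show ?thesis using 1 far[of w] wP by (auto simp: E H_def dist_norm)
    next
      case 2
      then have "t = - u" using s1 t by force
      then have "w - x = z - x'" using t by (simp add: x'_def)
      then show ?thesis using 2 far[of z] wP by (auto simp: E H_def dist_norm)
    qed
  qed (use zw in simp)
  have conv: "glued N z w" if "z \<in> E" "w \<in> E" "H z = H w" for z w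
  proof -
    \<comment> \<open>Here \<open>w = z - 2 * u\<close>, so the polygon inequalities for
      \<open>u\<close> at \<open>z\<close> and for \<open>- u\<close> at \<open>w\<close> are
      opposite to each other and force \<open>z\<close> onto the side.\<close>
    have *: "glued N z w" if zw: "z \<in> P" "w \<in> P" "dist z x \<le> r" "dist w x' \<le> r" "z - x = w - x'" for z w
    proof -
      have w: "w = z - 2 * u" using zw by (simp add: x'_def algebra_simps)
      have "inner u z \<le> 1" using zw u by (simp add: P_def ngon_def)
      moreover have "inner (- u) w \<le> 1" using zw(2) u'(1) unfolding P_def ngon_def by blast
      ultimately have "inner u z = 1" using i2u by (simp add: w inner_diff_right)
      then show ?thesis using w u unfolding glued_def by blast
    qed
    show ?thesis
      using that *[of z w] *[of w z] glued_sym[OF N(1,2), of w z] unfolding E H_def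
      by (auto simp: glued_refl split: if_splits)
  qed
  have "\<exists>U h. openin X U \<and> pr ` {x, x'} \<subseteq> U \<and> (\<forall>a\<in>{x, x'}. h (pr a) = 0) \<and>
    homeomorphic_map (subtopology X U) (top_of_set (ball 0 r)) h \<and>
    development P pr U (\<lambda>y. 1 * h y ^ 1)"
  proof (rule cone_coordinate_from_pieces[OF quotient_pr compact_P, where H = H], fold E_def)
    have "E = (P \<inter> cball x r) \<union> (P \<inter> cball x' r)" by (auto simp: E_def)
    moreover have "continuous_on ((P \<inter> cball x r) \<union> (P \<inter> cball x' r)) H"
    proof (rule continuous_on_closed_Un)
      have "continuous_on (P \<inter> cball x r) (\<lambda>z. z - x)" by (intro continuous_intros)
      then show "continuous_on (P \<inter> cball x r) H"
        by (rule continuous_on_eq) (auto simp: H_def dist_commute)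
      have "continuous_on (P \<inter> cball x' r) (\<lambda>z. z - x')" by (intro continuous_intros)
      then show "continuous_on (P \<inter> cball x' r) H"
        by (rule continuous_on_eq) (use far in \<open>auto simp: H_def dist_commute\<close>)
    qed (use compact_P compact_imp_closed in auto)
    ultimately show "continuous_on E H" by simp
    show "cball 0 r \<subseteq> H ` E"
    proof
      fix w :: complex assume w: "w \<in> cball 0 r"
      show "w \<in> H ` E"
      proof (cases "inner u w \<le> 0")
        case True
        have d: "dist (x + w) x \<le> r" using w by (simp add: dist_norm)
        have "inner t (x + w) \<le> 1" if "t \<in> roots N" for t
        proof (cases "t = u")
          case True then show ?thesis using \<open>inner u w \<le> 0\<close> u by (simp add: inner_add_right)
        next
          case False then show ?thesis using s0[OF d that] by simp
        qed
        then have "x + w \<in> E" using d by (simp add: E P_def ngon_def)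
        moreover have "H (x + w) = w" using d by (simp add: H_def)
        ultimately show ?thesis by (metis imageI)
      next
        case False
        have d: "dist (x' + w) x' \<le> r" using w by (simp add: dist_norm)
        have "inner t (x' + w) \<le> 1" if "t \<in> roots N" for t
        proof (cases "t = - u")
          case True then show ?thesis using False u' by (simp add: inner_add_right)
        next
          case False then show ?thesis using s1[OF d that] by simp
        qed
        then have "x' + w \<in> E" using d by (simp add: E P_def ngon_def)
        moreover have "H (x' + w) = w" using d far[of "x' + w"] by (simp add: H_def)
        ultimately show ?thesis by (metis imageI)
      qed
    qed
    show "1 * H z ^ 1 = z - a" if "a \<in> {x, x'}" "z \<in> P" "dist z a \<le> r ^ 1" for a z
      using that far[of z] by (auto simp: H_def)
    show "w \<in> E" if "z \<in> E" "w \<in> P" "pr w = pr z" for z w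
      using step[of z w] that pr_iff[of z w] unfolding E by auto
    show "H z = H w \<longleftrightarrow> pr z = pr w" if "z \<in> E" "w \<in> E" for z w
      using step[of z w] conv[of z w] that pr_iff[of z w] unfolding E by auto
  qed (use x x' r in auto)
  then show ?thesis using r by auto
qed

end

section \<open>The cone point at the corners\<close>

lemma cis_Arg_polar: "z = of_real (norm z) * cis (Arg z)"
  using rcis_cmod_Arg[of z] by (simp add: rcis_def)

lemma Re_cis_mult: "Re (cis a * (of_real r * cis b)) = r * cos (a + b)"
  by (simp add: cos_add algebra_simps)

context glued_ngon
begin

text \<open>\<open>\<tau>\<close> is the corner between the sides with normals \<open>1\<close> and
  \<open>\<omega>\<close>; \<open>\<zeta>\<close> is its direction and a square root of
  \<open>\<omega>\<close>.\<close>

definition "\<zeta> = cis (pi / N)"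
definition "\<tau> = corner N"
definition "\<omega> = cis (2 * pi / N)"

lemma N_eq: "N = 2 * (k + 1)" "real N = 2 * (real k + 1)"
  by (simp_all add: N_def)

lemma \<omega>_eq: "\<omega> = \<zeta> * \<zeta>"
  by (simp add: \<omega>_def \<zeta>_def cis_mult)

lemma norm_\<zeta>: "norm \<zeta> = 1" "\<zeta> * cnj \<zeta> = 1"
  by (simp_all add: \<zeta>_def complex_norm_square[symmetric])

lemma \<omega>_roots: "\<omega> \<in> roots N"
  using cis_int_roots[OF N(1), of 1] by (simp add: \<omega>_def)

lemma \<zeta>_power: "\<zeta> ^ (k + 1) = \<i>"
proof -
  have "\<zeta> ^ (k + 1) = cis (real (k + 1) * (pi / N))"
    unfolding \<zeta>_def by (rule Complex.DeMoivre)
  also have "real (k + 1) * (pi / N) = pi / 2"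
    by (simp add: N_eq(2) divide_simps)
  finally show ?thesis by simp
qed

lemma cnj_\<tau>: "\<omega> * cnj \<tau> = \<tau>" "\<tau> + cnj \<tau> = 2"
proof -
  have c: "cos (pi / N) > 0" using cos_pi_div_pos[OF N(3)] .
  have z: "\<zeta> = of_real (cos (pi / N)) * \<tau>"
    unfolding \<zeta>_def \<tau>_def corner_def using c by (intro cis_cos_tan) auto
  have "\<zeta> * (\<zeta> * cnj \<zeta>) = \<zeta>"
    by (simp add: norm_\<zeta>)
  then have "\<zeta> * \<zeta> * (of_real (cos (pi / N)) * cnj \<tau>) = of_real (cos (pi / N)) * \<tau>"
    using z by (metis complex_cnj_complex_of_real complex_cnj_mult mult.assoc)
  then have "of_real (cos (pi / N)) * (\<zeta> * \<zeta> * cnj \<tau>) = of_real (cos (pi / N)) * \<tau>"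
    by (simp add: mult_ac)
  then show "\<omega> * cnj \<tau> = \<tau>"
    using c by (simp add: \<omega>_eq)
  show "\<tau> + cnj \<tau> = 2"
    by (simp add: \<tau>_def corner_def complex_eq_iff)
qed

lemma norm_\<tau>: "norm \<tau> \<ge> 1"
  using complex_Re_le_cmod[of \<tau>] by (simp add: \<tau>_def corner_def)

text \<open>
  As \<open>k\<^sup>2 \<equiv> 1 (mod N)\<close>, the map \<open>v \<mapsto> v ^ k\<close> is an involution of the roots of unity; it
  converts the cyclic order of the sectors around the cone point into the order of the corners.
\<close>

lemma roots_power_k: "v \<in> roots N \<Longrightarrow> (v ^ k) ^ k = v"
proof -
  assume v: "v \<in> roots N"
  obtain m where m: "k = 2 * m + 1" using odd_k oddE by blast
  have "k * k = N * m + 1" unfolding N_def by (subst (1 2 3) m) (simp add: algebra_simps)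
  then have "(v ^ k) ^ k = (v ^ N) ^ m * v"
    by (simp add: power_mult[symmetric] power_add)
  then show ?thesis using v by (simp add: roots_def)
qed

text \<open>
  \<open>cone_map v y\<close>, for \<open>y\<close> in the sector around the positive real axis, is the point near the corner
  \<open>v ^ k * \<tau>\<close> whose coordinate at the cone point is \<open>v * y\<close>.
\<close>

definition cone_map :: "complex \<Rightarrow> complex \<Rightarrow> complex" where
  "cone_map v y = v ^ k * (\<tau> - \<zeta> * y ^ k)"

lemma cone_map_eq: "cone_map v y - v ^ k * \<tau> = - \<zeta> * (v * y) ^ k"
  by (simp add: cone_map_def algebra_simps power_mult_distrib)

lemma dist_cone_map: "v \<in> roots N \<Longrightarrow> dist (cone_map v y) (v ^ k * \<tau>) = norm y ^ k"
  unfolding dist_norm cone_map_eq using norm_\<zeta> norm_roots[OF N(1)]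
  by (simp add: norm_mult norm_power)

lemma \<omega>_power: "\<omega> ^ k * \<omega> = - 1"
proof -
  have "\<omega> ^ k * \<omega> = (\<zeta> ^ (k + 1)) ^ 2"
    by (simp add: \<omega>_eq power2_eq_square power_mult_distrib mult_ac)
  then show ?thesis unfolding \<zeta>_power by simp
qed

text \<open>The boundary ray of sector \<open>v\<close> in direction \<open>\<zeta>\<close> lies on
  the side with normal \<open>v ^ k\<close>, and the gluing of that side leads to the opposite
  boundary ray of sector \<open>v * \<omega>\<close>. The cone coordinate does not change, as
  \<open>\<omega> * cnj \<zeta> = \<zeta>\<close>. So one step around the cone point multiplies
  \<open>v\<close> by \<open>\<omega>\<close> and the corner by \<open>\<omega> ^ k\<close>.\<close>

lemma cone_map_cross:
  assumes v: "v \<in> roots N"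
  shows "inner (v ^ k) (cone_map v (of_real R * \<zeta>)) = 1"
    and "cone_map v (of_real R * \<zeta>) - 2 * v ^ k = cone_map (v * \<omega>) (of_real R * cnj \<zeta>)"
proof -
  have e1: "\<zeta> * (of_real R * \<zeta>) ^ k = \<i> * of_real (R ^ k)"
    using \<zeta>_power by (simp add: power_mult_distrib mult_ac)
  have A: "cone_map v (of_real R * \<zeta>) = v ^ k * (\<tau> - \<i> * of_real (R ^ k))"
    unfolding cone_map_def e1 by simp
  have "norm (v ^ k) = 1" using norm_roots[OF N(1) v] by (simp add: norm_power)
  then have "inner (v ^ k * 1) (v ^ k * (\<tau> - \<i> * of_real (R ^ k))) = inner 1 (\<tau> - \<i> * of_real (R ^ k))"
    by (rule inner_mult_unit)
  then show "inner (v ^ k) (cone_map v (of_real R * \<zeta>)) = 1"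
    unfolding A by (simp add: inner_complex_def \<tau>_def corner_def)
  \<comment> \<open>The corner glued to \<open>\<tau>\<close> across the side with normal
    \<open>1\<close>.\<close>
  have e2: "\<omega> ^ k * \<tau> = \<tau> - 2"
  proof -
    have "\<omega> ^ k * \<tau> = \<omega> ^ k * (\<omega> * cnj \<tau>)" by (simp add: cnj_\<tau>)
    also have "\<dots> = - cnj \<tau>" using \<omega>_power by (simp add: mult.assoc[symmetric])
    also have "\<dots> = \<tau> - 2" using cnj_\<tau>(2) by (simp add: algebra_simps add_eq_0_iff)
    finally show ?thesis .
  qed
  have e3: "\<omega> ^ k * (\<zeta> * (of_real R * cnj \<zeta>) ^ k) = \<i> * of_real (R ^ k)"
  proof -
    have "\<omega> ^ k * (\<zeta> * (of_real R * cnj \<zeta>) ^ k) = \<zeta> ^ (k + 1) * (\<zeta> * cnj \<zeta>) ^ k * of_real R ^ k"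
      unfolding \<omega>_eq power_mult_distrib power_add power_one_right by (simp only: mult_ac)
    then show ?thesis unfolding \<zeta>_power norm_\<zeta> by simp
  qed
  have "cone_map (v * \<omega>) (of_real R * cnj \<zeta>)
      = v ^ k * (\<omega> ^ k * \<tau> - \<omega> ^ k * (\<zeta> * (of_real R * cnj \<zeta>) ^ k))"
    unfolding cone_map_def by (simp add: power_mult_distrib algebra_simps)
  also have "\<dots> = v ^ k * (\<tau> - 2 - \<i> * of_real (R ^ k))"
    unfolding e2 e3 by simp
  finally show "cone_map v (of_real R * \<zeta>) - 2 * v ^ k = cone_map (v * \<omega>) (of_real R * cnj \<zeta>)"
    unfolding A by (simp add: algebra_simps)
qed

section \<open>The sector that models the polygon near a corner\<close>

definition "\<alpha> = pi / N"

lemma \<zeta>_\<alpha>: "\<zeta> = cis \<alpha>"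
  by (simp add: \<zeta>_def \<alpha>_def)

text \<open>The copies of this sector rotated by the \<open>N\<close> roots of unity fill a disc.
  The \<open>k\<close>-th power opens it to the angle
  \<open>2 * k * \<alpha> = pi - 2 * \<alpha>\<close>, which is the interior angle of the
  polygon.\<close>

definition sector :: "real \<Rightarrow> complex set" where
  "sector r = (\<lambda>(R, \<phi>). of_real R * cis \<phi>) ` ({0..r} \<times> {- \<alpha>..\<alpha>})"

lemma compact_sector: "compact (sector r)"
  unfolding sector_def
  by (intro compact_continuous_image compact_Times compact_Icc)
    (auto simp: case_prod_unfold intro!: continuous_intros)

lemma angle_bounds: "real k * \<alpha> = pi / 2 - \<alpha>" "\<alpha> > 0" "\<alpha> \<le> pi / 8"
  using k_ge by (auto simp: \<alpha>_def N_eq(2) field_simps)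

lemma sector_angle:
  assumes "\<bar>\<phi>\<bar> \<le> \<alpha>"
  shows "\<bar>real k * \<phi>\<bar> \<le> pi / 2 - \<alpha>"
proof -
  have "real k * \<bar>\<phi>\<bar> \<le> real k * \<alpha>" using assms by (intro mult_left_mono) auto
  then show ?thesis unfolding angle_bounds(1) by (simp add: abs_mult)
qed

lemma sector_power: "(of_real R * cis \<phi>) ^ k = of_real (R ^ k) * cis (real k * \<phi>)"
  by (simp add: power_mult_distrib Complex.DeMoivre)

text \<open>The arguments of the \<open>k\<close>-th powers stay in the interval from
  \<open>- pi / 2\<close> to \<open>pi / 2\<close>, where the sine is injective.\<close>

lemma sector_power_inj:
  assumes y: "y \<in> sector r" "y' \<in> sector r" and eq: "y ^ k = y' ^ k"
  shows "y = y'"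
proof -
  obtain R \<phi> where 1: "y = of_real R * cis \<phi>" "0 \<le> R" "\<bar>\<phi>\<bar> \<le> \<alpha>"
    using y(1) unfolding sector_def by (auto simp: abs_le_iff)
  obtain R' \<phi>' where 2: "y' = of_real R' * cis \<phi>'" "0 \<le> R'" "\<bar>\<phi>'\<bar> \<le> \<alpha>"
    using y(2) unfolding sector_def by (auto simp: abs_le_iff)
  have k0: "k > 0" using k_ge by simp
  have "norm (y ^ k) = R ^ k" "norm (y' ^ k) = R' ^ k"
    using 1 2 by (simp_all add: norm_mult norm_power)
  then have R: "R = R'"
    using eq 1(2) 2(2) k0 by (metis power_eq_imp_eq_base)
  show ?thesis
  proof (cases "R = 0")
    case False
    have "cis (real k * \<phi>) = cis (real k * \<phi>')"
      using eq False R unfolding 1(1) 2(1) sector_power by simp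
    then have "sin (real k * \<phi>) = sin (real k * \<phi>')"
      by (simp add: complex_eq_iff)
    moreover have le: "pi / 2 - \<alpha> \<le> pi / 2" using angle_bounds(2) by simp
    have "\<bar>real k * \<phi>\<bar> \<le> pi / 2" by (rule order.trans[OF sector_angle[OF 1(3)] le])
    moreover have "\<bar>real k * \<phi>'\<bar> \<le> pi / 2" by (rule order.trans[OF sector_angle[OF 2(3)] le])
    ultimately have "real k * \<phi> = real k * \<phi>'"
      by (rule_tac sin_inj_pi) (simp_all add: abs_le_iff)
    then show ?thesis using R 1 2 k0 by simp
  qed (use R 1 2 in simp)
qed

text \<open>The two half-planes cut out the arguments of modulus at most
  \<open>pi / 2 - \<alpha> = k * \<alpha>\<close>; dividing such an argument by \<open>k\<close>
  leads into the sector.\<close>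

lemma ex_sector_power:
  assumes s: "norm s \<le> r ^ k" "r \<ge> 0" and pos: "Re (\<zeta> * s) \<ge> 0" "Re (cnj \<zeta> * s) \<ge> 0"
  shows "\<exists>y\<in>sector r. s = y ^ k"
proof (cases "s = 0")
  case True
  have "0 \<in> sector r" using s(2) angle_bounds(2) unfolding sector_def
    by (auto intro!: image_eqI[of _ _ "(0, 0)"])
  then show ?thesis using True k_ge by (intro bexI[of _ 0]) auto
next
  case False
  define \<theta> where "\<theta> = Arg s"
  have \<theta>: "- pi < \<theta>" "\<theta> \<le> pi" using Arg_bounded[of s] by (auto simp: \<theta>_def)
  have sp: "s = of_real (norm s) * cis \<theta>" unfolding \<theta>_def by (rule cis_Arg_polar)
  have n0: "norm s > 0" using False by simp
  have "Re (\<zeta> * s) = norm s * cos (\<alpha> + \<theta>)"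
    unfolding \<zeta>_\<alpha> by (subst sp) (rule Re_cis_mult)
  then have c1: "cos (\<alpha> + \<theta>) \<ge> 0" using pos(1) n0 by (simp add: zero_le_mult_iff)
  have "cnj \<zeta> = cis (- \<alpha>)" by (simp add: \<zeta>_\<alpha> cis_cnj)
  then have "Re (cnj \<zeta> * s) = norm s * cos (- \<alpha> + \<theta>)"
    by (subst sp) (simp only: Re_cis_mult)
  then have c2: "cos (- \<alpha> + \<theta>) \<ge> 0" using pos(2) n0 by (simp add: zero_le_mult_iff)
  have neg: "cos x < 0" if "pi / 2 < x" "x < 3 * pi / 2" for x :: real
  proof -
    have "cos (x - pi) > 0" using that by (intro cos_gt_zero_pi) auto
    then show ?thesis by (simp add: cos_diff)
  qed
  have b1: "\<theta> \<le> pi / 2 - \<alpha>"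
  proof (rule ccontr)
    assume "\<not> ?thesis"
    then have "cos (\<alpha> + \<theta>) < 0"
      using \<theta> angle_bounds(2,3) pi_gt_zero by (intro neg) linarith+
    then show False using c1 by simp
  qed
  have b2: "- \<theta> \<le> pi / 2 - \<alpha>"
  proof (rule ccontr)
    assume "\<not> ?thesis"
    then have "cos (\<alpha> + - \<theta>) < 0"
      using \<theta> angle_bounds(2,3) pi_gt_zero by (intro neg) linarith+
    moreover have "\<alpha> + - \<theta> = - (- \<alpha> + \<theta>)" by simp
    ultimately show False using c2 by (metis cos_minus not_le)
  qed
  define R where "R = root k (norm s)"
  define \<phi> where "\<phi> = \<theta> / k"
  have k0: "k > 0" using k_ge by simp
  have R: "R ^ k = norm s" "R \<ge> 0" using k0 by (auto simp: R_def)
  have "R \<le> r" using s R k0 by (metis power_mono_iff)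
  moreover have "\<bar>\<theta>\<bar> \<le> real k * \<alpha>" using b1 b2 unfolding angle_bounds(1) by linarith
  then have "\<bar>\<phi>\<bar> \<le> \<alpha>"
    using k0 by (simp add: \<phi>_def field_simps)
  ultimately have "of_real R * cis \<phi> \<in> sector r"
    using R unfolding sector_def by (intro image_eqI[of _ _ "(R, \<phi>)"]) (auto simp: abs_le_iff)
  moreover have "s = (of_real R * cis \<phi>) ^ k"
    unfolding sector_power R(1) using sp k0 by (simp add: \<phi>_def)
  ultimately show ?thesis by blast
qed

text \<open>The converse of \<open>ex_sector_power\<close>. The equality cases are the two boundary
  rays and tell which side of the polygon a point near a corner lies on.\<close>

lemma sector_halfplanes:
  assumes "y \<in> sector r"
  shows "Re (\<zeta> * y ^ k) \<ge> 0" "Re (cnj \<zeta> * y ^ k) \<ge> 0"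
    and "Re (\<zeta> * y ^ k) = 0 \<Longrightarrow> y = of_real (norm y) * \<zeta>"
    and "Re (cnj \<zeta> * y ^ k) = 0 \<Longrightarrow> y = of_real (norm y) * cnj \<zeta>"
proof -
  obtain R \<phi> where y: "y = of_real R * cis \<phi>" "0 \<le> R" "\<bar>\<phi>\<bar> \<le> \<alpha>"
    using assms unfolding sector_def by (auto simp: abs_le_iff)
  have k0: "k > 0" using k_ge by simp
  have cz: "cnj \<zeta> = cis (- \<alpha>)" by (simp add: \<zeta>_\<alpha> cis_cnj)
  have e1: "Re (\<zeta> * y ^ k) = R ^ k * cos (\<alpha> + real k * \<phi>)"
    unfolding y(1) sector_power \<zeta>_\<alpha> by (rule Re_cis_mult)
  have e2: "Re (cnj \<zeta> * y ^ k) = R ^ k * cos (- \<alpha> + real k * \<phi>)"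
    unfolding y(1) sector_power cz by (rule Re_cis_mult)
  have a: "\<bar>real k * \<phi>\<bar> \<le> pi / 2 - \<alpha>" by (rule sector_angle[OF y(3)])
  have c1: "cos (\<alpha> + real k * \<phi>) \<ge> 0" 
    using a angle_bounds(2,3) pi_gt_zero by (intro cos_ge_zero) linarith+
  have c2: "cos (- \<alpha> + real k * \<phi>) \<ge> 0" 
    using a angle_bounds(2,3) pi_gt_zero by (intro cos_ge_zero) linarith+
  show "Re (\<zeta> * y ^ k) \<ge> 0" "Re (cnj \<zeta> * y ^ k) \<ge> 0"
    unfolding e1 e2 using y(2) c1 c2 by simp_all
  have ny: "norm y = R" using y by (simp add: norm_mult)
  show "y = of_real (norm y) * \<zeta>" if "Re (\<zeta> * y ^ k) = 0"
  proof (cases "R = 0")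
    case False
    then have "cos (\<alpha> + real k * \<phi>) = 0" using that e1 by simp
    then have "\<not> \<alpha> + real k * \<phi> < pi / 2"
      using cos_gt_zero_pi[of "\<alpha> + real k * \<phi>"] a angle_bounds(2,3) pi_gt_zero by linarith
    then have "real k * \<phi> = real k * \<alpha>" using a unfolding angle_bounds(1) by linarith
    then have "\<phi> = \<alpha>" using k0 by (simp only: mult_cancel_left) simp
    then show ?thesis using y ny by (simp add: \<zeta>_\<alpha>)
  qed (use y in simp)
  show "y = of_real (norm y) * cnj \<zeta>" if "Re (cnj \<zeta> * y ^ k) = 0"
  proof (cases "R = 0")
    case False
    then have "cos (- \<alpha> + real k * \<phi>) = 0" using that e2 by simp
    then have "\<not> - (pi / 2) < - \<alpha> + real k * \<phi>"
      using cos_gt_zero_pi[of "- \<alpha> + real k * \<phi>"] a angle_bounds(2,3) pi_gt_zero by linarith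
    then have "real k * \<phi> = real k * (- \<alpha>)" using a angle_bounds(1) by simp
    then have "\<phi> = - \<alpha>" using k0 by (simp only: mult_cancel_left) simp
    then show ?thesis using y ny by (simp add: cz)
  qed (use y in simp)
qed

lemma sector_norm: "y \<in> sector r \<Longrightarrow> norm y \<le> r"
  by (auto simp: sector_def norm_mult)

text \<open>Points near the corner are written as \<open>\<tau> - \<zeta> * s\<close>; in the
  variable \<open>s\<close> the inequalities of the two sides through \<open>\<tau>\<close> become
  the half-plane conditions above.\<close>

lemma inner_one_\<omega>: "inner 1 (\<tau> - \<zeta> * s) = 1 - Re (\<zeta> * s)" "inner \<omega> (\<tau> - \<zeta> * s) = 1 - Re (cnj \<zeta> * s)"
proof -
  show "inner 1 (\<tau> - \<zeta> * s) = 1 - Re (\<zeta> * s)"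
    by (simp add: inner_complex_def \<tau>_def corner_def)
  have "inner \<omega> (\<zeta> * s) = inner \<zeta> s"
    unfolding \<omega>_eq by (rule inner_mult_unit[OF norm_\<zeta>(1)])
  also have "\<dots> = Re (cnj \<zeta> * s)" by (simp add: inner_complex_def)
  finally show "inner \<omega> (\<tau> - \<zeta> * s) = 1 - Re (cnj \<zeta> * s)"
    using corner_in_corners(2)[OF N(3)] by (simp add: inner_diff_right \<omega>_def \<tau>_def)
qed

end

context glued_ngon
begin

lemma \<tau>_corner: "\<tau> \<in> corners N" "\<tau> \<in> P"
  using corner_in_corners(1)[OF N(3)] corners_P by (auto simp: \<tau>_def)

lemma corners_eq_\<tau>: "corners N = (\<lambda>u. u * \<tau>) ` roots N"
  unfolding \<tau>_def by (rule corners_eq[OF N(3)])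

lemma zero_sector: "r \<ge> 0 \<Longrightarrow> 0 \<in> sector r"
  using angle_bounds(2) unfolding sector_def by (auto intro!: image_eqI[of _ _ "(0, 0)"])

lemma sector_\<zeta>:
  assumes "0 \<le> R" "R \<le> r"
  shows "of_real R * \<zeta> \<in> sector r" "of_real R * cnj \<zeta> \<in> sector r"
proof -
  show "of_real R * \<zeta> \<in> sector r"
    using assms angle_bounds(2) unfolding sector_def \<zeta>_\<alpha>
    by (intro image_eqI[of _ _ "(R, \<alpha>)"]) auto
  show "of_real R * cnj \<zeta> \<in> sector r"
    using assms angle_bounds(2) unfolding sector_def \<zeta>_\<alpha> cis_cnj
    by (intro image_eqI[of _ _ "(R, - \<alpha>)"]) auto
qed

lemma \<omega>_cnj_\<zeta>: "\<omega> * cnj \<zeta> = \<zeta>" "cnj \<omega> * \<zeta> = cnj \<zeta>" "\<omega> * cnj \<omega> = 1" "cnj \<omega> ^ k = - \<omega>"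
proof -
  have 1: "\<zeta> * cnj \<zeta> = 1" by (rule norm_\<zeta>)
  then show "\<omega> * cnj \<zeta> = \<zeta>" "cnj \<omega> * \<zeta> = cnj \<zeta>"
    by (simp_all add: \<omega>_eq mult.assoc, simp add: mult.commute)
  have "\<omega> * cnj \<omega> = (\<zeta> * cnj \<zeta>) * (\<zeta> * cnj \<zeta>)"
    unfolding \<omega>_eq complex_cnj_mult by (simp only: mult_ac)
  then show 2: "\<omega> * cnj \<omega> = 1" by (simp add: 1)
  have "cnj \<omega> ^ k = - (\<omega> ^ k * \<omega>) * cnj \<omega> ^ k" by (simp add: \<omega>_power)
  also have "\<dots> = - ((\<omega> * cnj \<omega>) ^ k * \<omega>)" by (simp add: power_mult_distrib)
  finally show "cnj \<omega> ^ k = - \<omega>" by (simp add: 2)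
qed

lemma cone_map_inner:
  assumes v: "v \<in> roots N" and t: "t \<in> roots N"
  shows "inner (v ^ k * t) (cone_map v y) = inner t (\<tau> - \<zeta> * y ^ k)"
  unfolding cone_map_def using norm_roots[OF N(1) v]
  by (intro inner_mult_unit) (simp add: norm_power)

lemma cone_map_adjacent:
  assumes v: "v \<in> roots N" and y: "y = of_real R * \<zeta>" and R: "0 \<le> R" and z: "cone_map v y \<in> P"
  shows "glued N (cone_map v y) (cone_map (v * \<omega>) (of_real R * cnj \<zeta>))"
  using cone_map_cross[OF v, of R] roots_power[OF v, of k] unfolding glued_def y by metis

text \<open>Through \<open>cone_map\<close> the \<open>N\<close> wedges of the polygon at its
  corners become \<open>N\<close> sectors of one disc, neighbouring sectors being glued along a
  common ray. \<open>H\<close> inverts all maps \<open>cone_map v\<close> at once; the main point is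
  that it identifies exactly the glued points (\<open>step\<close> and \<open>conv\<close>).\<close>

lemma corner_coordinate:
  "\<exists>U h r. r > 0 \<and> openin X U \<and> pr \<tau> \<in> U \<and> h (pr \<tau>) = 0 \<and>
    homeomorphic_map (subtopology X U) (top_of_set (ball 0 r)) h \<and>
    development P pr U (\<lambda>y. - \<zeta> * h y ^ k)"
proof -
  have k0: "k > 0" using k_ge by simp
  obtain e where e: "e > 0" "\<And>z t. z \<in> cball \<tau> e \<Longrightarrow> t \<in> roots N \<Longrightarrow> inner t \<tau> < 1 \<Longrightarrow> inner t z < 1"
    using strict_sides_nbhd[OF N(1), of \<tau>] by blast
  obtain d where d: "d > 0" "\<And>u. u \<in> roots N \<Longrightarrow> u \<noteq> 1 \<Longrightarrow> d \<le> dist 1 u"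
    using finite_set_avoid[OF finite_roots[OF N(1)], of 1] by blast
  \<comment> \<open>The radius in the polygon is \<open>r ^ k\<close>, which is at most
    \<open>r\<close> because \<open>r \<le> 1\<close>. The bound by \<open>e\<close> keeps away the
    sides that do not meet at the corner, and since distinct corners are at least \<open>d\<close>
    apart, \<open>d / 3\<close> separates their discs.\<close>
  define r where "r = min 1 (min e (d / 3))"
  have r: "0 < r" "r \<le> 1" "r \<le> e" "r \<le> d / 3" using e(1) d(1) by (auto simp: r_def)
  have "r ^ k \<le> r ^ 1" using r k0 by (intro power_decreasing) auto
  then have rk: "r ^ k \<le> e" "r ^ k \<le> d / 3" "0 < r ^ k" using r by auto
  have strict: "inner t (\<tau> - \<zeta> * s) < 1"
    if t: "t \<in> roots N" "t \<noteq> 1" "t \<noteq> \<omega>" and s: "norm s \<le> r ^ k" for t s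
  proof -
    have "inner t \<tau> \<noteq> 1"
      using corner_in_corners(4)[OF N(3) t(1)] t unfolding \<tau>_def \<omega>_def by blast
    moreover have "inner t \<tau> \<le> 1" using \<tau>_corner(2) t(1) by (simp add: P_def ngon_def)
    moreover have "\<tau> - \<zeta> * s \<in> cball \<tau> e"
      using s rk norm_\<zeta> by (simp add: dist_norm norm_mult)
    ultimately show ?thesis using e(2) t(1) by simp
  qed
  define E where "E = P \<inter> (\<Union>a\<in>corners N. cball a (r ^ k))"
  have sec_norm: "norm (y ^ k) \<le> r ^ k" if "y \<in> sector r" for y
    using sector_norm[OF that] by (simp add: norm_power power_mono)
  \<comment> \<open>After rotating back by \<open>v ^ k\<close>, the sides with normals
    \<open>1\<close> and \<open>\<omega>\<close> are the only ones that could be violated.\<close>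
  have inP: "cone_map v y \<in> P" if v: "v \<in> roots N" and y: "y \<in> sector r" for v y
    unfolding P_def ngon_def
  proof safe
    fix u assume u: "u \<in> roots N"
    define t where "t = inverse (v ^ k) * u"
    have t: "t \<in> roots N"
      unfolding t_def using u v by (intro roots_mult roots_inverse roots_power)
    have "v ^ k \<noteq> 0" using roots_nonzero[OF N(1) v] by simp
    then have "u = v ^ k * t" by (simp add: t_def)
    then have "inner u (cone_map v y) = inner t (\<tau> - \<zeta> * y ^ k)"
      using cone_map_inner[OF v t] by simp
    also have "\<dots> \<le> 1"
      using strict[OF t _ _ sec_norm[OF y]] inner_one_\<omega>[of "y ^ k"] sector_halfplanes(1,2)[OF y]
      by (cases "t = 1"; cases "t = \<omega>") auto
    finally show "inner u (cone_map v y) \<le> 1" .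
  qed
  have inE: "cone_map v y \<in> E" if v: "v \<in> roots N" and y: "y \<in> sector r" for v y
  proof -
    have "v ^ k * \<tau> \<in> corners N" using roots_power[OF v] unfolding corners_eq_\<tau> by blast
    moreover have "cone_map v y \<in> cball (v ^ k * \<tau>) (r ^ k)"
      using dist_cone_map[OF v, of y] sec_norm[OF y] by (simp add: dist_commute norm_power)
    ultimately show ?thesis using inP[OF v y] unfolding E_def by blast
  qed
  \<comment> \<open>The sector parametrises the whole polygon near the corner
    \<open>u * \<tau>\<close>. The index is \<open>u ^ k\<close> since taking \<open>k\<close>-th
    powers is an involution on the roots.\<close>
  have rep: "\<exists>y\<in>sector r. z = cone_map (u ^ k) y" if z: "z \<in> P" and u: "u \<in> roots N" "dist z (u * \<tau>) \<le> r ^ k" for z u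
  proof -
    have uu: "u * cnj u = 1" by (rule roots_mult_cnj[OF N(1) u(1)])
    define s where "s = cnj \<zeta> * (\<tau> - cnj u * z)"
    have "\<zeta> * s = \<tau> - cnj u * z" unfolding s_def by (simp add: mult.assoc[symmetric] norm_\<zeta>)
    then have zs: "cnj u * z = \<tau> - \<zeta> * s" by simp
    have "z = u * cnj u * z" unfolding uu by simp
    then have z_eq: "z = u * (\<tau> - \<zeta> * s)" unfolding zs[symmetric] by (simp add: mult.assoc)
    have "norm (z - u * \<tau>) = norm s"
      unfolding z_eq using norm_roots[OF N(1) u(1)] norm_\<zeta>(1)
      by (simp add: right_diff_distrib norm_mult)
    then have ns: "norm s \<le> r ^ k" using u(2) by (simp add: dist_norm)
    have "inner (u * t) z = inner t (\<tau> - \<zeta> * s)" for t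
      unfolding z_eq by (rule inner_mult_unit[OF norm_roots[OF N(1) u(1)]])
    moreover have "inner (u * t) z \<le> 1" if "t \<in> roots N" for t
      using z that roots_mult[OF u(1)] by (simp add: P_def ngon_def)
    ultimately have "inner 1 (\<tau> - \<zeta> * s) \<le> 1" "inner \<omega> (\<tau> - \<zeta> * s) \<le> 1"
      using roots_1 \<omega>_roots by metis+
    then have "Re (\<zeta> * s) \<ge> 0" "Re (cnj \<zeta> * s) \<ge> 0"
      unfolding inner_one_\<omega> by linarith+
    then obtain y where "y \<in> sector r" "s = y ^ k"
      using ex_sector_power[OF ns] r(1) by auto
    then show ?thesis
      using z_eq roots_power_k[OF u(1)] by (intro bexI[of _ y]) (simp_all add: cone_map_def)
  qed
  have E_iff: "E = (\<Union>v\<in>roots N. cone_map v ` sector r)"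
  proof
    show "E \<subseteq> (\<Union>v\<in>roots N. cone_map v ` sector r)"
    proof
      fix z assume "z \<in> E"
      then obtain u where u: "u \<in> roots N" "z \<in> P" "dist z (u * \<tau>) \<le> r ^ k"
        unfolding E_def corners_eq_\<tau> by (auto simp: dist_commute)
      then show "z \<in> (\<Union>v\<in>roots N. cone_map v ` sector r)"
        using rep[OF u(2,1,3)] roots_power[OF u(1), of k] by blast
    qed
  qed (use inE in blast)
  have sep: "u = u'" if u: "u \<in> roots N" "u' \<in> roots N" and
      z: "dist z (u * \<tau>) \<le> r ^ k" "dist z (u' * \<tau>) \<le> r ^ k" for u u' z
  proof (rule ccontr)
    assume "u \<noteq> u'"
    have u0: "u \<noteq> 0" "norm u = 1" using roots_nonzero[OF N(1) u(1)] norm_roots[OF N(1) u(1)] by auto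
    define t where "t = inverse u * u'"
    have t: "t \<in> roots N" "t \<noteq> 1" "u' = u * t"
      using u u0 \<open>u \<noteq> u'\<close> roots_mult[OF roots_inverse[OF u(1)] u(2)]
      by (auto simp: t_def field_simps)
    have "d \<le> dist 1 t" using d(2) t by blast
    also have "\<dots> = norm (u * (1 - t))" using u0 by (simp add: dist_norm norm_mult)
    also have "\<dots> \<le> norm (u * (1 - t)) * norm \<tau>" using norm_\<tau> by (simp add: mult_le_cancel_left1)
    also have "\<dots> = dist (u * \<tau>) (u' * \<tau>)" unfolding t(3) by (simp add: dist_norm norm_mult[symmetric] algebra_simps)
    also have "\<dots> \<le> 2 * r ^ k" using z dist_triangle[of "u * \<tau>" "u' * \<tau>" z] by (simp add: dist_commute)
    finally show False using rk d(1) by linarith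
  qed
  have inj: "v = v' \<and> y = y'" if v: "v \<in> roots N" "v' \<in> roots N" and y: "y \<in> sector r" "y' \<in> sector r"
    and eq: "cone_map v y = cone_map v' y'" for v v' y y'
  proof -
    have "dist (cone_map v y) (v ^ k * \<tau>) \<le> r ^ k" "dist (cone_map v y) (v' ^ k * \<tau>) \<le> r ^ k"
      using dist_cone_map[OF v(1), of y] dist_cone_map[OF v(2), of y'] sec_norm[OF y(1)] sec_norm[OF y(2)] eq
      by (simp_all add: norm_power)
    then have "v ^ k = v' ^ k" using sep[OF roots_power[OF v(1)] roots_power[OF v(2)]] by blast
    then have "v = v'" using roots_power_k v by metis
    moreover have "v \<noteq> 0" "\<zeta> \<noteq> 0" using roots_nonzero[OF N(1) v(1)] norm_\<zeta> by auto
    ultimately have "y ^ k = y' ^ k" using eq by (simp add: cone_map_def)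
    then show ?thesis using sector_power_inj[OF y] \<open>v = v'\<close> by blast
  qed
  \<comment> \<open>By \<open>inj\<close> the pair \<open>v\<close>, \<open>y\<close> is determined
    by \<open>z\<close>, so the choice is unique on \<open>E\<close>.\<close>
  define H where "H z = (SOME w. \<exists>v\<in>roots N. \<exists>y\<in>sector r. z = cone_map v y \<and> w = v * y)" for z
  have H: "H (cone_map v y) = v * y" if v: "v \<in> roots N" and y: "y \<in> sector r" for v y
    unfolding H_def
  proof (rule some_equality)
    show "\<exists>v'\<in>roots N. \<exists>y'\<in>sector r. cone_map v y = cone_map v' y' \<and> v * y = v' * y'"
      using v y by blast
    fix w assume "\<exists>v'\<in>roots N. \<exists>y'\<in>sector r. cone_map v y = cone_map v' y' \<and> w = v' * y'"
    then show "w = v * y" using inj v y by blast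
  qed
  have corner: "z \<in> E \<and> H z = 0" if z: "z \<in> corners N" for z
  proof -
    obtain u where u: "u \<in> roots N" "z = u * \<tau>" using z unfolding corners_eq_\<tau> by blast
    have "z = cone_map (u ^ k) 0"
      using roots_power_k[OF u(1)] u k0 by (simp add: cone_map_def)
    then show ?thesis
      using inE[of "u ^ k" 0] H[of "u ^ k" 0] zero_sector roots_power[OF u(1)] r by simp
  qed
  have step: "w \<in> E \<and> H z = H w" if z: "z \<in> E" and zw: "glued N z w" for z w
  proof -
    obtain v y where v: "v \<in> roots N" and y: "y \<in> sector r" and zy: "z = cone_map v y"
      using z unfolding E_iff by blast
    consider "z = w" | "z \<in> corners N" "w \<in> corners N" | t where "t \<in> roots N" "inner t z = 1" "w = z - 2 * t"
      using zw unfolding glued_def by blast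
    then show ?thesis
    proof cases
      case (3 t)
      \<comment> \<open>The normal of the crossed side in the frame of the corner. By
        \<open>strict\<close> it is \<open>1\<close> or \<open>\<omega>\<close>, one for each
        boundary ray of the sector.\<close>
      define s where "s = inverse (v ^ k) * t"
      have s: "s \<in> roots N"
        unfolding s_def using 3 v by (intro roots_mult roots_inverse roots_power)
      have "v ^ k \<noteq> 0" using roots_nonzero[OF N(1) v] by simp
      then have t: "t = v ^ k * s" by (simp add: s_def)
      have inn: "inner s (\<tau> - \<zeta> * y ^ k) = 1"
        using cone_map_inner[OF v s, of y] 3 zy t by simp
      have ny: "0 \<le> norm y" "norm y \<le> r" using sector_norm[OF y] by auto
      have "s = 1 \<or> s = \<omega>" using strict[OF s _ _ sec_norm[OF y]] inn by force
      then show ?thesis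
      proof
        assume "s = 1"
        then have "Re (\<zeta> * y ^ k) = 0" using inn inner_one_\<omega>(1)[of "y ^ k"] by simp
        then have y\<zeta>: "y = of_real (norm y) * \<zeta>" by (rule sector_halfplanes(3)[OF y])
        have w: "w = cone_map (v * \<omega>) (of_real (norm y) * cnj \<zeta>)"
          using cone_map_cross(2)[OF v, of "norm y"] y\<zeta> 3(3) zy t \<open>s = 1\<close> by simp
        have "v * y = v * \<omega> * (of_real (norm y) * cnj \<zeta>)"
          using \<omega>_cnj_\<zeta>(1) by (subst y\<zeta>) (simp add: mult_ac)
        then show ?thesis
          unfolding w zy using inE[OF roots_mult[OF v \<omega>_roots] sector_\<zeta>(2)[OF ny]]
            H[OF roots_mult[OF v \<omega>_roots] sector_\<zeta>(2)[OF ny]] H[OF v y] by simp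
      next
        assume "s = \<omega>"
        then have "Re (cnj \<zeta> * y ^ k) = 0" using inn inner_one_\<omega>(2)[of "y ^ k"] by simp
        then have y\<zeta>: "y = of_real (norm y) * cnj \<zeta>" by (rule sector_halfplanes(4)[OF y])
        \<comment> \<open>Crossing this ray leads back to the sector that precedes
          \<open>v\<close>.\<close>
        define v' where "v' = v * cnj \<omega>"
        have v': "v' \<in> roots N" unfolding v'_def using v \<omega>_roots by (intro roots_mult roots_cnj)
        have v'\<omega>: "v' * \<omega> = v" using \<omega>_cnj_\<zeta>(3) by (simp add: v'_def mult_ac)
        have "v' ^ k = - t"
          unfolding v'_def power_mult_distrib \<omega>_cnj_\<zeta>(4) using t \<open>s = \<omega>\<close> by simp
        then have "cone_map v' (of_real (norm y) * \<zeta>) + 2 * t = z"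
          using cone_map_cross(2)[OF v', of "norm y"] y\<zeta> zy v'\<omega> by simp
        then have w: "w = cone_map v' (of_real (norm y) * \<zeta>)"
          using 3(3) by (metis add_diff_cancel)
        have "v * y = v' * (of_real (norm y) * \<zeta>)"
          using \<omega>_cnj_\<zeta>(2) by (subst y\<zeta>) (simp add: v'_def mult_ac)
        then show ?thesis
          unfolding w zy using inE[OF v' sector_\<zeta>(1)[OF ny]] H[OF v' sector_\<zeta>(1)[OF ny]] H[OF v y] by simp
      qed
    qed (use z corner in auto)
  qed
  have conv: "glued N z w" if z: "z \<in> E" and w: "w \<in> E" and eq: "H z = H w" for z w
  proof -
    obtain v y where v: "v \<in> roots N" and y: "y \<in> sector r" and zy: "z = cone_map v y"
      using z unfolding E_iff by blast
    obtain v' y' where v': "v' \<in> roots N" and y': "y' \<in> sector r" and wy: "w = cone_map v' y'"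
      using w unfolding E_iff by blast
    have vy: "v * y = v' * y'" using eq H v y v' y' zy wy by simp
    obtain R \<phi> where y_eq: "y = of_real R * cis \<phi>" "0 \<le> R" "\<bar>\<phi>\<bar> \<le> \<alpha>"
      using y unfolding sector_def by (auto simp: abs_le_iff)
    obtain R' \<phi>' where y'_eq: "y' = of_real R' * cis \<phi>'" "0 \<le> R'" "\<bar>\<phi>'\<bar> \<le> \<alpha>"
      using y' unfolding sector_def by (auto simp: abs_le_iff)
    have nv: "norm v = 1" "norm v' = 1" "v \<noteq> 0" "v' \<noteq> 0"
      using norm_roots[OF N(1)] roots_nonzero[OF N(1)] v v' by auto
    have "norm (v * y) = R" "norm (v' * y') = R'"
      using y_eq y'_eq nv by (simp_all add: norm_mult)
    then have R: "R' = R" using vy by simp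
    have cm: "cone_map u 0 \<in> corners N" if "u \<in> roots N" for u
      using roots_power[OF that, of k] unfolding corners_eq_\<tau> cone_map_def zero_power[OF k0]
        by (simp add: rev_image_eqI)
    show ?thesis
    proof (cases "R = 0")
      case True
      then show ?thesis
        using y_eq y'_eq R zy wy cm v v' by (simp add: glued_def)
    next
      case False
      define t where "t = inverse v * v'"
      have t: "t \<in> roots N" unfolding t_def using v v' by (intro roots_mult roots_inverse)
      have v't: "v' = v * t" using nv by (simp add: t_def)
      have c: "cis \<phi> = t * cis \<phi>'"
        using vy False nv unfolding v't y_eq(1) y'_eq(1) R by (simp add: mult_ac)
      show ?thesis
      proof (cases "t = 1")
        case True
        then have "cis \<phi> = cis \<phi>'" using c by simp
        then show ?thesis using True v't y_eq y'_eq R zy wy by (simp add: glued_refl)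
      next
        case t1: False
        have t0: "t \<noteq> 0" using roots_nonzero[OF N(1) t] .
        have b: "\<bar>\<phi>\<bar> \<le> pi / N" "\<bar>\<phi>'\<bar> \<le> pi / N" using y_eq(3) y'_eq(3) by (simp_all add: \<alpha>_def)
        have "inner t (t * cis \<phi>') = inner (t * 1) (t * cis \<phi>')" by simp
        also have "\<dots> = inner 1 (cis \<phi>')" by (rule inner_mult_unit[OF norm_roots[OF N(1) t]])
        finally have i1: "inner t (cis \<phi>) = cos \<phi>'" unfolding c by (simp add: inner_complex_def)
        have c': "cis \<phi>' = inverse t * cis \<phi>" using c t0 by simp
        have it: "inverse t \<in> roots N" "inverse t \<noteq> 1" using roots_inverse[OF t] t1 by auto
        have "inner (inverse t) (inverse t * cis \<phi>) = inner (inverse t * 1) (inverse t * cis \<phi>)" by simp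
        also have "\<dots> = inner 1 (cis \<phi>)" by (rule inner_mult_unit[OF norm_roots[OF N(1) it(1)]])
        finally have i2: "inner (inverse t) (cis \<phi>') = cos \<phi>" unfolding c' by (simp add: inner_complex_def)
        \<comment> \<open>By \<open>i1\<close> and \<open>i2\<close> the estimates for
          \<open>t\<close> and for its inverse read \<open>cos \<phi>' \<le> cos \<phi>\<close> and
          \<open>cos \<phi> \<le> cos \<phi>'\<close>. So the equality case applies: two different
          sectors meet, away from the apex, only along a common boundary ray.\<close>
        have "inner t (cis \<phi>) = cos \<phi>"
          using root_inner_cis(1)[OF N(1) t t1 b(1)] root_inner_cis(1)[OF N(1) it b(2)] i1 i2 by simp
        then have "\<phi> = pi / N \<and> t = cis (2 * pi / N) \<or> \<phi> = - pi / N \<and> t = cis (- 2 * pi / N)"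
          by (rule root_inner_cis(2)[OF N(1) t t1 b(1)])
        then show ?thesis
        proof
          assume *: "\<phi> = pi / N \<and> t = cis (2 * pi / N)"
          then have t\<omega>: "t = \<omega>" and y2: "y = of_real R * \<zeta>" using y_eq(1) by (simp_all add: \<omega>_def \<zeta>_def)
          have "cis \<phi>' = cnj \<zeta>" using * unfolding c' t\<omega>
            using \<omega>_cnj_\<zeta>(1) \<zeta>_def nonzero_inverse_mult_distrib
            by (metis \<omega>_cnj_\<zeta>(2,3) inverse_unique)
          then have "w = cone_map (v * \<omega>) (of_real R * cnj \<zeta>)"
            using wy v't t\<omega> y'_eq R by simp
          then show ?thesis
            using cone_map_adjacent[OF v y2 y_eq(2)] inP[OF v y] zy by simp
        next
          assume *: "\<phi> = - pi / N \<and> t = cis (- 2 * pi / N)"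
          then have "t = cnj \<omega>" and y2: "y = of_real R * cnj \<zeta>"
            using y_eq(1) by (simp_all add: \<omega>_def \<zeta>_def cis_cnj)
          then have v\<omega>: "v = v' * \<omega>" using v't \<omega>_cnj_\<zeta>(3) by (simp add: mult_ac)
          have "cis \<phi>' = \<omega> * cis \<phi>" unfolding c using \<open>t = cnj \<omega>\<close> \<omega>_cnj_\<zeta>(3) by (simp add: mult.assoc[symmetric])
          moreover have "cis \<phi> = cnj \<zeta>" using * by (simp add: \<zeta>_def cis_cnj)
          ultimately have y'2: "y' = of_real R * \<zeta>" using y'_eq R \<omega>_cnj_\<zeta>(1) by simp
          have "glued N w z"
            using cone_map_adjacent[OF v' y'2 y_eq(2)] inP[OF v' y'] zy wy y2 v\<omega> by simp
          then show ?thesis by (rule glued_sym[OF N(1,2)])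
        qed
      qed
    qed
  qed
  have "\<exists>U h. openin X U \<and> pr ` corners N \<subseteq> U \<and> (\<forall>a\<in>corners N. h (pr a) = 0) \<and>
    homeomorphic_map (subtopology X U) (top_of_set (ball 0 r)) h \<and>
    development P pr U (\<lambda>y. - \<zeta> * h y ^ k)"
  proof (rule cone_coordinate_from_pieces[OF quotient_pr compact_P, where H = H], fold E_def)
    show "continuous_on E H"
      unfolding E_iff
    proof (rule continuous_on_closed_Union)
      fix v assume v: "v \<in> roots N"
      have cont: "continuous_on (sector r) (cone_map v)"
        unfolding cone_map_def by (intro continuous_intros)
      then show "closed (cone_map v ` sector r)"
        by (intro compact_imp_closed compact_continuous_image compact_sector)
      \<comment> \<open>On each piece \<open>cnj v * H\<close> inverts a continuous injection of a
        compact set and is therefore continuous; finitely many closed pieces are then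
        pasted.\<close>
      have "continuous_on (cone_map v ` sector r) (\<lambda>z. cnj v * H z)"
        using roots_mult_cnj[OF N(1) v] H[OF v]
        by (intro continuous_on_inv[OF cont compact_sector]) (simp add: mult_ac)
      then have "continuous_on (cone_map v ` sector r) (\<lambda>z. v * (cnj v * H z))"
        by (rule continuous_on_mult_left)
      moreover have "v * (cnj v * x) = x" for x
        using roots_mult_cnj[OF N(1) v] by (simp add: mult.assoc[symmetric])
      ultimately show "continuous_on (cone_map v ` sector r) H"
        by (simp only:)
    qed (rule finite_roots[OF N(1)])
    show "cball 0 r \<subseteq> H ` E"
    proof
      fix w :: complex assume w: "w \<in> cball 0 r"
      obtain v \<phi> where v: "v \<in> roots N" "\<bar>\<phi>\<bar> \<le> pi / N" "w = of_real (norm w) * v * cis \<phi>"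
        using nearest_root[OF N(1)] by blast
      define y where "y = of_real (norm w) * cis \<phi>"
      have "y \<in> sector r"
        unfolding sector_def y_def using v(2) w
        by (intro image_eqI[of _ _ "(norm w, \<phi>)"]) (auto simp: \<alpha>_def abs_le_iff)
      moreover have "w = v * y" using v(3) by (simp add: y_def mult_ac)
      ultimately show "w \<in> H ` E"
        using H[OF v(1)] inE[OF v(1)] by (metis imageI)
    qed
    show "- \<zeta> * H z ^ k = z - a" if a: "a \<in> corners N" and z: "z \<in> P" "dist z a \<le> r ^ k" for a z
    proof -
      obtain u where u: "u \<in> roots N" "a = u * \<tau>" using a unfolding corners_eq_\<tau> by blast
      obtain y where y: "y \<in> sector r" "z = cone_map (u ^ k) y"
        using rep[OF z(1) u(1)] z(2) u(2) by blast
      then show ?thesis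
        using H[OF roots_power[OF u(1)] y(1)] cone_map_eq[of "u ^ k" y] roots_power_k[OF u(1)] u(2) by simp
    qed
    show "w \<in> E" if "z \<in> E" "w \<in> P" "pr w = pr z" for z w
      using step[of z w] that pr_iff[of z w] unfolding E_def by auto
    show "H z = H w \<longleftrightarrow> pr z = pr w" if "z \<in> E" "w \<in> E" for z w
    proof -
      have "z \<in> P" "w \<in> P" using that by (auto simp: E_def)
      then show ?thesis using pr_iff[of z w] step[OF that(1), of w] conv[OF that] by blast
    qed
    show "finite (corners N)" using finite_roots[OF N(1)] by (simp add: corners_eq_\<tau>)
  qed (use r k0 norm_\<zeta> corners_P in auto)
  then show ?thesis using r(1) \<tau>_corner(1) by (meson image_subset_iff)
qed

section \<open>Charts of one form at all points\<close>

lemma pr_corner: "z \<in> corners N \<Longrightarrow> pr z = pr \<tau>"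
  using pr_iff[of z \<tau>] corners_P \<tau>_corner by (auto simp: glued_def)

text \<open>One form of coordinate for every point, so that later arguments need no case
  distinction: the exponent is \<open>k\<close> at the corner point and \<open>1\<close> elsewhere,
  and the unit \<open>c\<close> absorbs the factor \<open>- \<zeta>\<close> of the corner.\<close>

definition cone_chart ::
    "'a \<Rightarrow> 'a set \<Rightarrow> ('a \<Rightarrow> complex) \<Rightarrow> real \<Rightarrow> complex \<Rightarrow> nat \<Rightarrow> bool" where
  "cone_chart p U h r c m \<longleftrightarrow> r > 0 \<and> m > 0 \<and> norm c = 1 \<and> openin X U \<and> p \<in> U \<and> h p = 0 \<and>
    homeomorphic_map (subtopology X U) (top_of_set (ball 0 r)) h \<and>
    development P pr U (\<lambda>y. c * h y ^ m) \<and> m = (if p = pr \<tau> then k else 1)"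

lemma cone_chartD:
  assumes "cone_chart p U h r c m"
  shows "r > 0" "m > 0" "norm c = 1" "openin X U" "p \<in> U" "h p = 0"
    "homeomorphic_map (subtopology X U) (top_of_set (ball 0 r)) h"
    "development P pr U (\<lambda>y. c * h y ^ m)" "m = (if p = pr \<tau> then k else 1)"
  using assms unfolding cone_chart_def by blast+

lemma cone_chart_bij:
  assumes "cone_chart p U h r c m"
  shows "h ` U = ball 0 r" "inj_on h U"
  using homeomorphic_imp_surjective_map[OF cone_chartD(7)[OF assms]]
    homeomorphic_imp_injective_map[OF cone_chartD(7)[OF assms]] openin_subset[OF cone_chartD(4)[OF assms]]
  by (simp_all add: Int_absorb1)

lemma cone_coordinate:
  assumes "p \<in> topspace X"
  shows "\<exists>U h r c m. cone_chart p U h r c m"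
proof (cases "p = pr \<tau>")
  case True
  have "k > 0" "norm (- \<zeta>) = 1" using k_ge norm_\<zeta> by auto
  then show ?thesis
    using corner_coordinate unfolding True cone_chart_def
    by (elim exE conjE) (intro exI conjI, assumption+, simp)
next
  case False
  obtain x where x: "x \<in> P" "p = pr x" using assms by (auto simp: topspace_X)
  have nc: "x \<notin> corners N" using False x pr_corner by blast
  have "\<exists>U h r. r > 0 \<and> openin X U \<and> pr x \<in> U \<and> h (pr x) = 0 \<and>
    homeomorphic_map (subtopology X U) (top_of_set (ball 0 r)) h \<and> development P pr U h"
  proof (cases "\<exists>u\<in>roots N. inner u x = 1")
    case True
    then show ?thesis using side_coordinate[OF x(1) nc] by blast
  next
    case False
    have "inner u x < 1" if "u \<in> roots N" for u
      using False x(1) that by (force simp: P_def ngon_def less_le)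
    then show ?thesis using interior_coordinate[OF x(1)] by blast
  qed
  then obtain U h r where "r > 0" "openin X U" "p \<in> U" "h p = 0"
    "homeomorphic_map (subtopology X U) (top_of_set (ball 0 r)) h" "development P pr U h"
    unfolding x(2) by blast
  then show ?thesis
    using False unfolding cone_chart_def by (intro exI[of _ U] exI[of _ h] exI[of _ r] exI[of _ 1] exI[of _ "1::nat"]) auto
qed

end

section \<open>Linear maps of the plane\<close>

definition plane :: "complex \<Rightarrow> real^2" where
  "plane z = vector [Re z, Im z]"

definition unplane :: "real^2 \<Rightarrow> complex" where
  "unplane v = Complex (v $ 1) (v $ 2)"

lemma plane_unplane [simp]: "plane (unplane v) = v" "unplane (plane z) = z"
  by (simp_all add: plane_def unplane_def vec_eq_iff forall_2)

lemma linear_plane: "linear plane" "linear unplane"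
  by (auto intro!: linearI simp: plane_def unplane_def vec_eq_iff forall_2 complex_eq_iff)

lemma norm_plane [simp]: "norm (plane z) = norm z"
  by (simp add: norm_vec_def L2_set_def sum_2 plane_def cmod_def)

text \<open>Every real-linear map of the complex plane has this form. Its determinant is
  \<open>(norm a)\<^sup>2 - (norm b)\<^sup>2\<close>, so \<open>norm b < norm a\<close> expresses
  that it is invertible and preserves the orientation.\<close>

definition skew :: "complex \<Rightarrow> complex \<Rightarrow> complex \<Rightarrow> complex" where
  "skew a b w = a * w + b * cnj w"

definition skew_inv :: "complex \<Rightarrow> complex \<Rightarrow> complex \<Rightarrow> complex" where
  "skew_inv a b w = (cnj a * w - b * cnj w) / (a * cnj a - b * cnj b)"

lemma linear_skew: "linear (skew a b)"
  by (rule linearI) (simp_all add: skew_def algebra_simps)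

lemma linear_skew_inv: "linear (skew_inv a b)"
  by (rule linearI)
    (simp_all add: skew_inv_def scaleR_conv_of_real algebra_simps add_divide_distrib diff_divide_distrib)

lemma skew_det:
  assumes "norm b < norm a"
  shows "a * cnj a - b * cnj b \<noteq> 0" "cnj (a * cnj a - b * cnj b) = a * cnj a - b * cnj b"
proof -
  have "(norm b)\<^sup>2 < (norm a)\<^sup>2" using assms by (simp add: power_strict_mono)
  then show "a * cnj a - b * cnj b \<noteq> 0"
    unfolding complex_norm_square[symmetric] by (metis eq_iff_diff_eq_0 less_irrefl of_real_eq_iff)
qed (simp add: mult.commute)

lemma skew_skew_inv:
  assumes "norm b < norm a"
  shows "skew a b (skew_inv a b w) = w" "skew_inv a b (skew a b w) = w"
proof -
  let ?d = "a * cnj a - b * cnj b"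
  note d = skew_det[OF assms]
  have "skew a b (skew_inv a b w) = (a * (cnj a * w - b * cnj w) + b * (a * cnj w - cnj b * w)) / ?d"
    unfolding skew_def skew_inv_def complex_cnj_divide d(2) by (simp add: add_divide_distrib)
  also have "\<dots> = (?d * w) / ?d" by (simp add: algebra_simps)
  finally show "skew a b (skew_inv a b w) = w" using d(1) by simp
  have "skew_inv a b (skew a b w) = (?d * w) / ?d"
    unfolding skew_def skew_inv_def by (simp add: algebra_simps)
  then show "skew_inv a b (skew a b w) = w" using d(1) by simp
qed

lemma skew_mult: "skew a b (c * z) = skew (a * c) (b * cnj c) z"
  by (simp add: skew_def)

text \<open>
  A \<open>k\<close>-th root of \<open>skew a b (w ^ k)\<close> is a homeomorphism of the plane that lifts a linear map to
  the \<open>k\<close>-fold branched covering; it exists globally because \<open>skew a b z / (a * z)\<close> stays in the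
  right half-plane.
\<close>

lemma skew_root:
  fixes a b :: complex and k :: nat
  assumes ab: "norm b < norm a" and k: "k > 0"
  shows "\<exists>\<beta> :: complex \<Rightarrow> complex. continuous_on UNIV \<beta> \<and> inj \<beta> \<and> \<beta> 0 = 0 \<and>
    (\<forall>y z. norm (\<beta> y ^ k - \<beta> z ^ k) = norm (skew a b (y ^ k) - skew a b (z ^ k)))"
proof -
  define e where "e = b / a"
  have a0: "a \<noteq> 0" using ab by auto
  have e: "norm e < 1" using ab a0 by (simp add: e_def norm_divide divide_less_eq_1_pos)
  \<comment> \<open>This is \<open>skew a b (w ^ k) / (a * w ^ k)\<close>. At \<open>w = 0\<close>
    the division by zero gives \<open>q 0 = 1\<close>.\<close>
  define q where "q w = 1 + e * (cnj (w ^ k) / w ^ k)" for w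
  define F where "F w = w * exp (Ln (q w) / of_nat k)" for w
  have nq: "norm (e * (cnj (w ^ k) / w ^ k)) < 1" for w
  proof (cases "w = 0")
    case False
    then have "norm (cnj (w ^ k) / w ^ k) = 1" by (simp add: norm_divide del: complex_cnj_power)
    then show ?thesis unfolding norm_mult using e by (simp del: complex_cnj_power)
  qed (use e k in simp)
  have req: "Re (q w) > 0" for w
    using nq[of w] abs_Re_le_cmod[of "e * (cnj (w ^ k) / w ^ k)"] unfolding q_def
    by (simp del: complex_cnj_power)
  have q0: "q w \<noteq> 0" for w using req[of w] by auto
  have expq: "exp (Ln (q w) / of_nat k) ^ k = q w" for w
    using q0[of w] k by (simp add: exp_of_nat_mult[symmetric])
  have Fk: "F w ^ k = w ^ k + e * cnj (w ^ k)" for w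
  proof -
    have "F w ^ k = w ^ k * q w" unfolding F_def power_mult_distrib expq ..
    also have "\<dots> = w ^ k + e * cnj (w ^ k)"
      using k by (cases "w = 0") (simp_all add: q_def field_simps)
    finally show ?thesis .
  qed
  have aFk: "a * F w ^ k = skew a b (w ^ k)" for w
    using a0 unfolding Fk by (simp add: skew_def e_def field_simps)
  have cont: "isCont F w" for w
  proof (cases "w = 0")
    case False
    have nn: "q w \<notin> \<real>\<^sub>\<le>\<^sub>0" using req[of w] by (auto simp: complex_nonpos_Reals_iff)
    have "isCont q w" unfolding q_def using False by (intro continuous_intros) auto
    then show ?thesis unfolding F_def using k nn by (intro continuous_intros) auto
  next
    \<comment> \<open>At the origin \<open>q\<close> has in general no limit, but it is bounded, so
      \<open>F\<close> still tends to \<open>0\<close>.\<close>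
    case True
    have "norm (F z) \<le> 2 * norm z" for z
    proof -
      have "norm (F z ^ k) \<le> norm (z ^ k) + norm e * norm (z ^ k)"
        unfolding Fk by (rule order.trans[OF norm_triangle_ineq]) (simp add: norm_mult del: complex_cnj_power)
      also have "\<dots> \<le> 2 * norm (z ^ k)"
        using e mult_right_mono[of "norm e" 1 "norm (z ^ k)"] by simp
      also have "\<dots> \<le> 2 ^ k * norm (z ^ k)"
        using k by (intro mult_right_mono) (auto simp: self_le_power)
      finally have "norm (F z) ^ k \<le> (2 * norm z) ^ k"
        by (simp add: norm_power power_mult_distrib)
      then show ?thesis using k power_mono_iff[of "norm (F z)" "2 * norm z" k] by simp
    qed
    then have ev: "\<forall>\<^sub>F z in at 0. norm (F z) \<le> 2 * norm z"
      by (intro always_eventually) blast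
    have "((\<lambda>z::complex. 2 * norm z) \<longlongrightarrow> 2 * norm (0::complex)) (at 0)"
      by (intro tendsto_mult_left tendsto_norm tendsto_ident_at)
    then have "((\<lambda>z::complex. 2 * norm z) \<longlongrightarrow> 0) (at 0)"
      by simp
    then have "(F \<longlongrightarrow> 0) (at 0)"
      by (rule Lim_null_comparison[OF ev])
    then show ?thesis using True by (simp add: isCont_def F_def)
  qed
  have inj: "inj F"
  proof (rule injI)
    fix w w' assume eq: "F w = F w'"
    then have "skew a b (w ^ k) = skew a b (w' ^ k)" using aFk by metis
    then have wk: "w ^ k = w' ^ k" using skew_skew_inv(2)[OF ab] by metis
    then have "q w = q w'" by (simp add: q_def del: complex_cnj_power)
    then show "w = w'" using eq by (simp add: F_def)
  qed
  \<comment> \<open>Only the modulus of \<open>a\<close> is needed: its unit factor disappears in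
    the norms that are compared.\<close>
  define \<beta> where "\<beta> w = of_real (root k (norm a)) * F w" for w
  have r0: "root k (norm a) \<noteq> 0" using a0 k by simp
  have "norm (\<beta> y ^ k - \<beta> z ^ k) = norm (skew a b (y ^ k) - skew a b (z ^ k))" for y z
  proof -
    have "\<beta> y ^ k - \<beta> z ^ k = of_real (root k (norm a) ^ k) * (F y ^ k - F z ^ k)"
      by (simp add: \<beta>_def power_mult_distrib algebra_simps)
    also have "root k (norm a) ^ k = norm a" using k by simp
    finally show ?thesis unfolding aFk[symmetric] by (simp add: norm_mult flip: right_diff_distrib)
  qed
  moreover have "continuous_on UNIV \<beta>"
    unfolding \<beta>_def using cont by (intro continuous_intros continuous_at_imp_continuous_on) auto
  moreover have "inj \<beta>"
    using inj r0 by (auto simp: \<beta>_def inj_def)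
  moreover have "\<beta> 0 = 0"
    by (simp add: \<beta>_def F_def)
  ultimately show ?thesis
    by (intro exI[of _ \<beta>]) blast
qed

section \<open>The translation surface\<close>

lemma homeomorphic_map_shrink:
  assumes h: "homeomorphic_map (subtopology X U) (top_of_set V) h" and U: "openin X U"
    and B: "open B" "B \<subseteq> V"
  shows "openin X {y \<in> U. h y \<in> B}"
    and "homeomorphic_map (subtopology X {y \<in> U. h y \<in> B}) (top_of_set B) h"
proof -
  have UX: "U \<subseteq> topspace X" using U by (rule openin_subset)
  have "openin (top_of_set V) B" using B by (simp add: open_subset)
  then have "openin (subtopology X U) {y \<in> topspace (subtopology X U). h y \<in> B}"
    using homeomorphic_imp_continuous_map[OF h] by (rule openin_continuous_map_preimage[rotated])
  moreover have eq: "{y \<in> topspace (subtopology X U). h y \<in> B} = {y \<in> U. h y \<in> B}"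
    using UX by auto
  ultimately show "openin X {y \<in> U. h y \<in> B}"
    using U by (simp add: openin_open_subtopology)
  have "homeomorphic_map (subtopology (subtopology X U) {y \<in> U. h y \<in> B})
      (subtopology (top_of_set V) B) h"
  proof (rule homeomorphic_map_subtopologies[OF h])
    have "h ` U = V" using homeomorphic_imp_surjective_map[OF h] UX by (simp add: Int_absorb1)
    then show "h ` (topspace (subtopology X U) \<inter> {y \<in> U. h y \<in> B}) = topspace (top_of_set V) \<inter> B"
      using UX B by auto
  qed
  moreover have "U \<inter> {y \<in> U. h y \<in> B} = {y \<in> U. h y \<in> B}" "V \<inter> B = B" using B by auto
  ultimately show "homeomorphic_map (subtopology X {y \<in> U. h y \<in> B}) (top_of_set B) h"
    by (simp add: subtopology_subtopology)
qed

lemma homeomorphic_map_compose_embedding: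
  fixes \<beta> :: "complex \<Rightarrow> complex"
  assumes h: "homeomorphic_map (subtopology X U) (top_of_set V) h" and V: "open V"
    and \<beta>: "continuous_on UNIV \<beta>" "inj \<beta>"
  shows "homeomorphic_map (subtopology X U) (top_of_set (\<beta> ` V)) (\<beta> \<circ> h)" "open (\<beta> ` V)"
proof -
  have c: "continuous_on V \<beta>" and i: "inj_on \<beta> V"
    using \<beta> continuous_on_subset inj_on_subset by blast+
  then obtain g where g: "homeomorphism V (\<beta> ` V) \<beta> g"
    using invariance_of_domain_homeomorphism[OF V c _ i] by auto
  have "homeomorphic_map (top_of_set V) (top_of_set (\<beta> ` V)) \<beta>"
    using g by (auto simp: homeomorphic_map_maps homeomorphic_maps_def homeomorphism_def)
  then show "homeomorphic_map (subtopology X U) (top_of_set (\<beta> ` V)) (\<beta> \<circ> h)"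
    using h by (rule homeomorphic_map_compose[rotated])
  show "open (\<beta> ` V)"
    by (rule invariance_of_domain_gen[OF V c i]) simp
qed

section \<open>Comparison of developments\<close>

context glued_ngon
begin

text \<open>The tube property of the closed map \<open>pr\<close>: however small the discs about the
  representatives of \<open>p\<close> are, together they contain all representatives of the points
  in some neighbourhood of \<open>p\<close>. This turns estimates at single representatives into
  statements about the quotient.\<close>

lemma saturated_neighbourhood:
  assumes p: "p \<in> topspace X" and e: "\<And>x. x \<in> P \<Longrightarrow> pr x = p \<Longrightarrow> e x > (0::real)"
  shows "\<exists>W. openin X W \<and> p \<in> W \<and> (\<forall>z\<in>P. pr z \<in> W \<longrightarrow> (\<exists>x\<in>P. pr x = p \<and> dist z x < e x))"
proof -
  define O' where "O' = (\<Union>x\<in>{x\<in>P. pr x = p}. ball x (e x))"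
  have "closedin (top_of_set P) (P - O')"
    unfolding O'_def by (simp add: closedin_diff openin_open_Int open_UN Diff_eq closedin_closed_Int closed_INT flip: Compl_UN)
      (auto intro!: closedin_closed_Int open_UN)
  then have "closedin X (pr ` (P - O'))"
    using closed_map_pr by (simp add: closed_map_def)
  then have "openin X (topspace X - pr ` (P - O'))" by blast
  moreover have "p \<in> topspace X - pr ` (P - O')"
    using p e by (auto simp: O'_def)
  moreover have "\<exists>x\<in>P. pr x = p \<and> dist z x < e x" if "z \<in> P" "pr z \<in> topspace X - pr ` (P - O')" for z
    using that by (auto simp: O'_def dist_commute)
  ultimately show ?thesis by blast
qed

text \<open>Near each representative of \<open>p\<close> both increments equal the increment of the
  polygon coordinate. This includes the corner point.\<close>

lemma developments_differ_by_constant: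
  assumes d: "development P pr U d" "p \<in> U" and d': "development P pr U' d'" "p \<in> U'"
    and p: "p \<in> topspace X"
  shows "\<exists>W. openin X W \<and> p \<in> W \<and> (\<forall>y\<in>W. d y - d p = d' y - d' p)"
proof -
  have "\<exists>e>0. \<forall>z\<in>P. dist z x < e \<longrightarrow> d (pr z) - d p = z - x \<and> d' (pr z) - d' p = z - x"
    if x: "x \<in> P" "pr x = p" for x
  proof -
    obtain e where "e > 0" "\<And>z. z \<in> P \<Longrightarrow> dist z x < e \<Longrightarrow> d (pr z) - d (pr x) = z - x"
      using d x unfolding development_def by blast
    moreover obtain e' where "e' > 0" "\<And>z. z \<in> P \<Longrightarrow> dist z x < e' \<Longrightarrow> d' (pr z) - d' (pr x) = z - x"
      using d' x unfolding development_def by blast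
    ultimately show ?thesis using x by (intro exI[of _ "min e e'"]) auto
  qed
  then obtain e where e: "\<And>x. x \<in> P \<Longrightarrow> pr x = p \<Longrightarrow> e x > 0 \<and>
      (\<forall>z\<in>P. dist z x < e x \<longrightarrow> d (pr z) - d p = z - x \<and> d' (pr z) - d' p = z - x)"
    by metis
  then obtain W where W: "openin X W" "p \<in> W"
    "\<forall>z\<in>P. pr z \<in> W \<longrightarrow> (\<exists>x\<in>P. pr x = p \<and> dist z x < e x)"
    using saturated_neighbourhood[OF p, of e] by blast
  have "d y - d p = d' y - d' p" if y: "y \<in> W" for y
  proof -
    obtain z where z: "z \<in> P" "y = pr z"
      using y openin_subset[OF W(1)] unfolding topspace_X by blast
    then obtain x where "x \<in> P" "pr x = p" "dist z x < e x" using W(3) y by blast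
    then show ?thesis using e z by metis
  qed
  then show ?thesis using W by blast
qed

lemma development_subset: "development P pr U d \<Longrightarrow> V \<subseteq> U \<Longrightarrow> development P pr V d"
  unfolding development_def by blast

lemma development_local:
  assumes "\<And>p. p \<in> U \<Longrightarrow> \<exists>W V d'. openin X W \<and> p \<in> W \<and> p \<in> V \<and> development P pr V d' \<and>
    (\<forall>y\<in>W. d y - d p = d' y - d' p)"
  shows "development P pr U d"
  unfolding development_def
proof (intro ballI impI)
  fix x assume x: "x \<in> P" "pr x \<in> U"
  obtain W V d' where W: "openin X W" "pr x \<in> W" "pr x \<in> V" "development P pr V d'"
    "\<And>y. y \<in> W \<Longrightarrow> d y - d (pr x) = d' y - d' (pr x)"
    using assms[OF x(2)] by blast
  obtain e where e: "e > 0" "\<And>z. z \<in> P \<Longrightarrow> dist z x < e \<Longrightarrow> d' (pr z) - d' (pr x) = z - x"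
    using W x unfolding development_def by blast
  have "openin (top_of_set P) {z \<in> P. pr z \<in> W}"
    using openin_continuous_map_preimage[OF quotient_imp_continuous_map[OF quotient_pr] W(1)] by simp
  then obtain e' where e': "e' > 0" "\<And>z. z \<in> P \<Longrightarrow> dist z x < e' \<Longrightarrow> pr z \<in> W"
    using x W(2) unfolding openin_euclidean_subtopology_iff by blast
  show "\<exists>e>0. \<forall>z\<in>P. dist z x < e \<longrightarrow> d (pr z) - d (pr x) = z - x"
    using e e' W(5) by (intro exI[of _ "min e e'"]) auto
qed

lemma cone_chart_ball:
  assumes h: "cone_chart p U h r c m" and W: "openin X W" "p \<in> W"
  shows "\<exists>s>0. ball 0 s \<subseteq> h ` (U \<inter> W)"
proof -
  note h = cone_chartD[OF h]
  have "openin (subtopology X U) (U \<inter> W)"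
    using h(4) W by (simp add: openin_subtopology_Int2 openin_subtopology_Int)
  then have "openin (top_of_set (ball 0 r)) (h ` (U \<inter> W))"
    using homeomorphic_imp_open_map[OF h(7)] by (simp add: open_map_def)
  then have "open (h ` (U \<inter> W))" by (simp add: openin_open_eq)
  moreover have "0 \<in> h ` (U \<inter> W)" using h(5,6) W(2) by (metis IntI imageI)
  ultimately show ?thesis by (meson openE)
qed

lemma cone_coordinate_in:
  assumes p: "p \<in> topspace X" and W: "openin X W" "p \<in> W"
  shows "\<exists>U h r c m. cone_chart p U h r c m \<and> U \<subseteq> W"
proof -
  obtain U h r c m where h_chart: "cone_chart p U h r c m"
    using cone_coordinate[OF p] by blast
  note h = cone_chartD[OF h_chart]
  obtain s where s: "s > 0" "ball 0 s \<subseteq> h ` (U \<inter> W)"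
    using cone_chart_ball[OF h_chart W] by blast
  have sub: "ball (0::complex) s \<subseteq> ball 0 r"
    using s(2) cone_chart_bij(1)[OF h_chart] by blast
  define U' where "U' = {y \<in> U. h y \<in> ball 0 s}"
  have "U' \<subseteq> W"
    using s(2) cone_chart_bij(2)[OF h_chart] unfolding U'_def inj_on_def by blast
  moreover note homeomorphic_map_shrink[OF h(7,4) open_ball sub, folded U'_def]
  moreover have "p \<in> U'" using h s by (simp add: U'_def)
  moreover have "development P pr U' (\<lambda>y. c * h y ^ m)"
    by (rule development_subset[OF h(8)]) (auto simp: U'_def)
  ultimately show ?thesis using h s(1) unfolding cone_chart_def by blast
qed

end

text \<open>The coefficients \<open>a\<close>, \<open>b\<close> give the conjugating linear map.
  Apart from the corner point, the elements of \<open>C\<close> are points with a flat neighbourhood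
  that are merely declared to be cone points.\<close>

locale marked_ngon = glued_ngon +
  fixes a b :: complex and C :: "'a set"
  assumes ab: "norm b < norm a" and finite_C: "finite C" and C_sub: "C \<subseteq> topspace X" and \<tau>_C: "pr \<tau> \<in> C"
begin

definition L where "L w = plane (skew a b w)"
definition Linv where "Linv v = skew_inv a b (unplane v)"

lemma L_Linv [simp]: "L (Linv v) = v" "Linv (L w) = w"
  by (simp_all add: L_def Linv_def skew_skew_inv[OF ab])

lemma linear_L: "linear L" "linear Linv"
  using linear_compose[OF linear_skew linear_plane(1), of a b]
    linear_compose[OF linear_plane(2) linear_skew_inv, of a b]
  by (simp_all add: L_def[abs_def] Linv_def[abs_def] o_def)

definition Reg where "Reg = topspace X - C"

text \<open>The atlas takes in every chart that becomes a development once \<open>L\<close> is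
  undone. Being a development is a local condition, so any chart compatible with the atlas meets it,
  and maximality follows.\<close>

definition T :: "'a flat_surface" where
  "T = \<lparr>underlying = X, cone_points = C,
    atlas = {(U, \<phi>). is_chart (subtopology X Reg) (U, \<phi>) \<and> development P pr U (\<lambda>y. Linv (\<phi> y))}\<rparr>"

lemma T_simps [simp]: "underlying T = X" "cone_points T = C" "regular_points T = Reg"
    "regular_part T = subtopology X Reg"
  by (simp_all add: T_def regular_part_def regular_points_def Reg_def)

lemma atlas_T: "(U, \<phi>) \<in> atlas T \<longleftrightarrow>
    is_chart (subtopology X Reg) (U, \<phi>) \<and> development P pr U (\<lambda>y. Linv (\<phi> y))"
  by (simp add: T_def)

lemma openin_Reg: "openin X Reg"
proof -
  have "closedin X C"
    using finite_C C_sub Hausdorff_imp_t1_space[OF Hausdorff_X] by (simp add: t1_space_closedin_finite)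
  then show ?thesis unfolding Reg_def by blast
qed

lemma openin_regular: "openin (subtopology X Reg) W \<longleftrightarrow> openin X W \<and> W \<subseteq> Reg"
  by (rule openin_open_subtopology[OF openin_Reg])

lemma chart_openin: "(U, \<phi>) \<in> atlas T \<Longrightarrow> openin X U \<and> U \<subseteq> Reg"
  by (simp add: atlas_T is_chart_def openin_regular)

lemma L_homeomorphic:
  fixes S :: "complex set"
  shows "homeomorphic_map (top_of_set S) (top_of_set (L ` S)) L" "open S \<Longrightarrow> open (L ` S)"
proof -
  have "continuous_on S L" "continuous_on (L ` S) Linv"
    using linear_L by (simp_all add: linear_continuous_on linear_conv_bounded_linear)
  then show "homeomorphic_map (top_of_set S) (top_of_set (L ` S)) L"
    by (auto simp: homeomorphic_map_maps homeomorphic_maps_def intro!: exI[of _ Linv])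
  have "L ` S = Linv -` S" by (force intro!: image_eqI[of _ _ "Linv _"])
  then show "open (L ` S)" if "open S"
    using that linear_L by (simp add: continuous_open_vimage linear_continuous_at linear_conv_bounded_linear)
qed

text \<open>The image of this chart is the linear image of a ball, hence convex; this lets
  \<open>affine_regular\<close> infer constancy from a vanishing derivative.\<close>

lemma atlas_around:
  assumes "p \<in> Reg" "openin X W" "p \<in> W"
  shows "\<exists>U \<phi> h r. (U, \<phi>) \<in> atlas T \<and> p \<in> U \<and> U \<subseteq> W \<and> r > 0 \<and>
    \<phi> = (\<lambda>y. L (h y)) \<and> h p = 0 \<and> h ` U = ball 0 r \<and> development P pr U h"
proof -
  have p: "p \<in> topspace X" "p \<noteq> pr \<tau>" using assms \<tau>_C by (auto simp: Reg_def)
  have "openin X (W \<inter> Reg)" using assms openin_Reg by blast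
  then obtain U h r c m where h_chart: "cone_chart p U h r c m" and h_sub: "U \<subseteq> W \<inter> Reg"
    using cone_coordinate_in[OF p(1), of "W \<inter> Reg"] assms by blast
  note h = cone_chartD(1-5)[OF h_chart] h_sub cone_chartD(6-9)[OF h_chart]
  have m: "m = 1" using h(10) p by simp
  define h' where "h' = (\<lambda>y. c * h y)"
  have dev: "development P pr U h'" using h(9) unfolding m h'_def by simp
  have c: "c \<noteq> 0" using h(3) by auto
  have im: "h ` U = ball 0 r"
    by (rule cone_chart_bij(1)[OF h_chart])
  have inj: "inj (\<lambda>w. c * w)" using c by (auto simp: inj_def)
  have "(\<lambda>w. c * w) ` ball 0 r = ball 0 r"
  proof safe
    fix w :: complex assume w: "w \<in> ball 0 r"
    then show "c * w \<in> ball 0 r" using h(3) by (simp add: norm_mult)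
    show "w \<in> (\<lambda>w. c * w) ` ball 0 r"
      using w h(3) c by (intro image_eqI[of _ _ "w / c"]) (simp_all add: norm_divide)
  qed
  then have h': "homeomorphic_map (subtopology X U) (top_of_set (ball 0 r)) h'"
    using homeomorphic_map_compose_embedding(1)[OF h(8) open_ball _ inj]
    by (simp add: h'_def o_def continuous_intros)
  have im': "h' ` U = ball 0 r"
    using homeomorphic_imp_surjective_map[OF h'] openin_subset[OF h(4)] by (simp add: Int_absorb1)
  have "is_chart (subtopology X Reg) (U, \<lambda>y. L (h' y))"
  proof -
    have "(\<lambda>y. L (h' y)) ` U = L ` ball 0 r" using im' by (metis image_image)
    moreover have "homeomorphic_map (subtopology X U) (top_of_set (L ` ball 0 r)) (L \<circ> h')"
      using L_homeomorphic(1) h' by (rule homeomorphic_map_compose[rotated])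
    moreover have "Reg \<inter> U = U" using h(6) by blast
    ultimately show ?thesis
      using L_homeomorphic(2)[of "ball 0 r"] h(4,6)
      by (simp add: is_chart_def openin_regular subtopology_subtopology o_def)
  qed
  then have "(U, \<lambda>y. L (h' y)) \<in> atlas T"
    using dev by (simp add: atlas_T)
  moreover have "h' p = 0" using h by (simp add: h'_def)
  ultimately show ?thesis
    using h im' dev by (intro exI[of _ U] exI[of _ "\<lambda>y. L (h' y)"] exI[of _ h'] exI[of _ r]) auto
qed

lemma charts_translation:
  assumes "(U, \<phi>) \<in> atlas T" "development P pr V d" "x \<in> U \<inter> V"
  shows "\<exists>W. openin X W \<and> x \<in> W \<and> W \<subseteq> U \<and> (\<forall>y\<in>W. \<phi> y - \<phi> x = L (d y - d x))"
proof -
  have U: "openin X U" using chart_openin assms by blast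
  then have x: "x \<in> topspace X" using assms(3) openin_subset by blast
  obtain W where W: "openin X W" "x \<in> W" "\<And>y. y \<in> W \<Longrightarrow> Linv (\<phi> y) - Linv (\<phi> x) = d y - d x"
    using developments_differ_by_constant[of U "\<lambda>y. Linv (\<phi> y)" x V d] assms x by (auto simp: atlas_T)
  have "\<phi> y - \<phi> x = L (d y - d x)" if "y \<in> W" for y
    using W(3)[OF that, symmetric] linear_L(1) by (simp add: linear_diff)
  then show ?thesis
    using W U assms(3) by (intro exI[of _ "W \<inter> U"]) auto
qed

lemma maximal_atlas_T: "maximal_translation_atlas (subtopology X Reg) (atlas T)"
  unfolding maximal_translation_atlas_def
proof safe
  have "fst ` atlas T \<subseteq> Pow Reg" using chart_openin by fastforce
  moreover have "p \<in> \<Union> (fst ` atlas T)" if "p \<in> Reg" for p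
    using atlas_around[OF that openin_Reg that] by force
  ultimately have cover: "\<Union> (fst ` atlas T) = topspace (subtopology X Reg)"
    using openin_subset[OF openin_Reg] by (auto simp: Int_absorb1)
  have comp: "translation_compatible (subtopology X Reg) (U, \<phi>) (V, \<psi>)"
    if UV: "(U, \<phi>) \<in> atlas T" "(V, \<psi>) \<in> atlas T" for U \<phi> V \<psi>
    unfolding translation_compatible_def
  proof clarify
    fix x assume x: "x \<in> U" "x \<in> V"
    have dev: "development P pr V (\<lambda>y. Linv (\<psi> y))" using UV by (simp add: atlas_T)
    obtain W where W: "openin X W" "x \<in> W" "W \<subseteq> U" "\<And>y. y \<in> W \<Longrightarrow> \<phi> y - \<phi> x = L (Linv (\<psi> y) - Linv (\<psi> x))"
      using charts_translation[OF UV(1) dev IntI[OF x]] by blast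
    have "\<forall>y\<in>W \<inter> V. \<psi> y = \<phi> y + (\<psi> x - \<phi> x)"
    proof
      fix y assume "y \<in> W \<inter> V"
      then have "\<phi> y - \<phi> x = \<psi> y - \<psi> x"
        using W(4)[of y] linear_L(1) by (simp add: linear_diff)
      then show "\<psi> y = \<phi> y + (\<psi> x - \<phi> x)" by (simp add: algebra_simps)
    qed
    moreover have "openin (subtopology X Reg) (W \<inter> V)"
      unfolding openin_regular using W(1) chart_openin[OF UV(2)] by blast
    moreover have "x \<in> W \<inter> V" "W \<inter> V \<subseteq> U \<inter> V" using W x by auto
    ultimately show "\<exists>W c. openin (subtopology X Reg) W \<and> x \<in> W \<and> W \<subseteq> U \<inter> V \<and> (\<forall>y\<in>W. \<psi> y = \<phi> y + c)"
      by blast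
  qed
  show "translation_atlas (subtopology X Reg) (atlas T)"
    unfolding translation_atlas_def using cover comp by (auto simp: atlas_T)
next
  fix B U \<phi> assume B: "translation_atlas (subtopology X Reg) B" "atlas T \<subseteq> B" "(U, \<phi>) \<in> B"
  have ch: "is_chart (subtopology X Reg) (U, \<phi>)" using B unfolding translation_atlas_def by blast
  then have U: "openin X U" "U \<subseteq> Reg" by (auto simp: is_chart_def openin_regular)
  have "development P pr U (\<lambda>y. Linv (\<phi> y))"
  proof (rule development_local)
    fix p assume p: "p \<in> U"
    then obtain V \<psi> h where V: "(V, \<psi>) \<in> atlas T" "p \<in> V" "\<psi> = (\<lambda>y. L (h y))" "development P pr V h"
      using atlas_around[OF _ U(1), of p] U by blast
    have "translation_compatible (subtopology X Reg) (V, \<psi>) (U, \<phi>)"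
      using B V(1) unfolding translation_atlas_def by blast
    then have "\<exists>W c. openin (subtopology X Reg) W \<and> p \<in> W \<and> W \<subseteq> V \<inter> U \<and> (\<forall>y\<in>W. \<phi> y = \<psi> y + c)"
      using p V(2) unfolding translation_compatible_def prod.case by blast
    then obtain W c where W: "openin (subtopology X Reg) W" "p \<in> W" "\<And>y. y \<in> W \<Longrightarrow> \<phi> y = \<psi> y + c"
      by auto
    have "Linv (\<phi> y) - Linv (\<phi> p) = h y - h p" if "y \<in> W" for y
      using W(2) W(3)[OF that] W(3)[OF W(2)] linear_L(2) V(3) by (simp add: linear_add)
    then show "\<exists>W V d'. openin X W \<and> p \<in> W \<and> p \<in> V \<and> development P pr V d' \<and>
        (\<forall>y\<in>W. Linv (\<phi> y) - Linv (\<phi> p) = d' y - d' p)"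
      using W(1,2) V(2,4) unfolding openin_regular by blast
  qed
  then show "(U, \<phi>) \<in> atlas T" using ch by (simp add: atlas_T)
qed

lemma isolated_neighbourhood:
  assumes "p \<in> topspace X"
  shows "\<exists>W. openin X W \<and> p \<in> W \<and> W - {p} \<subseteq> Reg"
proof (intro exI conjI)
  have "closedin X (C - {p})"
    using finite_C C_sub Hausdorff_imp_t1_space[OF Hausdorff_X] by (auto simp: t1_space_closedin_finite)
  then show "openin X (topspace X - (C - {p}))" by blast
qed (use assms in \<open>auto simp: Reg_def\<close>)

text \<open>Distances in charts are distorted by \<open>L\<close>, so the power \<open>h ^ m\<close>
  is in general no local isometry. Composing \<open>h\<close> with the map \<open>\<beta>\<close> of
  \<open>skew_root\<close> repairs this: after it, \<open>m\<close>-th powers have the distances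
  that \<open>L\<close> gives to \<open>c * h ^ m\<close>.\<close>

lemma cone_multiplicity:
  assumes p: "p \<in> C"
  shows "\<exists>m\<ge>1. cone_point_of_multiplicity T p m"
proof -
  have pX: "p \<in> topspace X" using p C_sub by blast
  obtain W where W: "openin X W" "p \<in> W" "W - {p} \<subseteq> Reg" using isolated_neighbourhood[OF pX] by blast
  obtain U h r c m where h_chart: "cone_chart p U h r c m" and h_sub: "U \<subseteq> W"
    using cone_coordinate_in[OF pX W(1,2)] by blast
  note h = cone_chartD(1-5)[OF h_chart] h_sub cone_chartD(6-9)[OF h_chart]
  \<comment> \<open>The unit \<open>c\<close> is moved into the coefficients by
    \<open>skew_mult\<close>.\<close>
  have "norm (b * cnj c) < norm (a * c)" using ab h(3) by (simp add: norm_mult)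
  then obtain \<beta> :: "complex \<Rightarrow> complex" where \<beta>: "continuous_on UNIV \<beta>" "inj \<beta>" "\<beta> 0 = 0"
    "\<And>y z. norm (\<beta> y ^ m - \<beta> z ^ m) = norm (skew (a * c) (b * cnj c) (y ^ m) - skew (a * c) (b * cnj c) (z ^ m))"
    using skew_root[OF _ h(2)] by blast
  have \<beta>_dist: "dist (\<beta> y ^ m) (\<beta> z ^ m) = norm (L (c * y ^ m - c * z ^ m))" for y z
    using \<beta>(4)[of y z] linear_skew[of a b] unfolding L_def norm_plane dist_norm
    by (simp add: linear_diff skew_mult)
  note h2 = homeomorphic_map_compose_embedding[OF h(8) open_ball \<beta>(1,2)]
  have "0 \<in> \<beta> ` ball 0 r" using \<beta>(3) h(1) by (metis centre_in_ball imageI)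
  then obtain s where s: "s > 0" "ball 0 s \<subseteq> \<beta> ` ball 0 r"
    using h2(2) by (meson openE)
  define U' where "U' = {y \<in> U. (\<beta> \<circ> h) y \<in> ball 0 s}"
  have U': "openin X U'" "homeomorphic_map (subtopology X U') (top_of_set (ball 0 s)) (\<beta> \<circ> h)"
    unfolding U'_def using homeomorphic_map_shrink[OF h2(1) h(4) open_ball s(2)] by auto
  have pU': "p \<in> U'" using h \<beta>(3) s by (simp add: U'_def)
  have sub: "U' \<subseteq> U" by (auto simp: U'_def)
  have reg: "U' - {p} \<subseteq> Reg" using sub h(6) W(3) by blast
  then have UC: "U' \<inter> C = {p}" using pU' p by (auto simp: Reg_def)
  have "flat_local_isometry T (U' - {p}) (\<lambda>x. (\<beta> \<circ> h) x ^ m)"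
    unfolding flat_local_isometry_def
  proof
    fix x assume x: "x \<in> U' - {p}"
    have o: "openin X (U' - {p})"
      using U'(1) Hausdorff_X pX Hausdorff_imp_t1_space t1_space_closedin_singleton by (metis openin_diff)
    obtain V \<phi> where V: "(V, \<phi>) \<in> atlas T" "x \<in> V"
      using atlas_around[OF _ o x] reg x by blast
    obtain W where W: "openin X W" "x \<in> W" "W \<subseteq> V"
      "\<And>y. y \<in> W \<Longrightarrow> \<phi> y - \<phi> x = L (c * h y ^ m - c * h x ^ m)"
      using charts_translation[OF V(1) h(9), of x] V x sub by blast
    have "dist ((\<beta> \<circ> h) y ^ m) ((\<beta> \<circ> h) z ^ m) = dist (\<phi> y) (\<phi> z)" if "y \<in> W" "z \<in> W" for y z
    proof -
      have "\<phi> y - \<phi> z = (\<phi> y - \<phi> x) - (\<phi> z - \<phi> x)" by simp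
      also have "\<dots> = L (c * h y ^ m - c * h z ^ m)"
        using W(4) that linear_L(1) by (simp flip: linear_diff)
      finally show ?thesis by (simp add: \<beta>_dist dist_norm[of "\<phi> y"])
    qed
    then have "\<exists>W. openin (regular_part T) W \<and> x \<in> W \<and> W \<subseteq> (U' - {p}) \<inter> V \<and>
        (\<forall>y\<in>W. \<forall>z\<in>W. dist ((\<beta> \<circ> h) y ^ m) ((\<beta> \<circ> h) z ^ m) = dist (\<phi> y) (\<phi> z))"
      using W o x reg by (intro exI[of _ "W \<inter> (U' - {p})"]) (auto simp: openin_regular)
    then show "\<exists>(V, \<phi>)\<in>atlas T. \<exists>W. openin (regular_part T) W \<and> x \<in> W \<and> W \<subseteq> (U' - {p}) \<inter> V \<and>
        (\<forall>y\<in>W. \<forall>z\<in>W. dist ((\<beta> \<circ> h) y ^ m) ((\<beta> \<circ> h) z ^ m) = dist (\<phi> y) (\<phi> z))"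
      using V by blast
  qed
  then have "cone_point_of_multiplicity T p m"
    unfolding cone_point_of_multiplicity_def using U' UC s \<beta>(3) h(7)
    by (intro exI[of _ U'] exI[of _ "\<beta> \<circ> h"] exI[of _ s]) auto
  then show ?thesis using h(2) by (intro exI[of _ m]) auto
qed

lemma surface_X: "surface_2d X"
  unfolding surface_2d_def
proof (intro conjI ballI)
  fix p assume p: "p \<in> topspace X"
  obtain U h r c m where "cone_chart p U h r c m"
    using cone_coordinate[OF p] by blast
  note h = cone_chartD(4,5)[OF this] and h' = cone_chartD(7)[OF this]
  have "homeomorphic_map (subtopology X U) (top_of_set (L ` ball 0 r)) (L \<circ> h)"
    using L_homeomorphic(1) h' by (rule homeomorphic_map_compose[rotated])
  then have "subtopology X U homeomorphic_space top_of_set (L ` ball 0 r)"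
    by (rule homeomorphic_map_imp_homeomorphic_space)
  then show "\<exists>U V. openin X U \<and> p \<in> U \<and> open (V :: (real^2) set) \<and> subtopology X U homeomorphic_space top_of_set V"
    using h(1,2) L_homeomorphic(2)[OF open_ball] by (intro exI conjI)
qed (rule Hausdorff_X second_countable_X)+

lemma translation_surface_T: "translation_surface T"
  unfolding translation_surface_def
proof (intro conjI)
  show "topspace (underlying T) \<noteq> {}" using \<tau>_C C_sub by auto
  show "subtopology (underlying T) (cone_points T) = discrete_topology (cone_points T)"
    using subtopology_eq_discrete_topology_gen_finite[OF Hausdorff_imp_t1_space[OF Hausdorff_X] finite_C] C_sub
    by (simp add: Int_absorb1)
qed (use surface_X compact_X connected_X C_sub maximal_atlas_T cone_multiplicity in auto)

end

section \<open>Affine maps\<close>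

lemma linear_real_complex:
  assumes "linear (B :: complex \<Rightarrow> complex)"
  shows "B w = (B 1 - \<i> * B \<i>) / 2 * w + (B 1 + \<i> * B \<i>) / 2 * cnj w"
proof -
  have "w = Re w *\<^sub>R 1 + Im w *\<^sub>R \<i>"
    by (simp add: complex_eq_iff)
  then have "B w = Re w *\<^sub>R B 1 + Im w *\<^sub>R B \<i>"
    using linear_add[OF assms] linear_scale[OF assms] by metis
  then show ?thesis
    by (simp add: complex_eq_iff field_simps)
qed

context marked_ngon
begin

text \<open>The derivative \<open>A\<close> is given in charts; this is the same map in the polygon
  coordinate.\<close>

definition pull :: "real^2^2 \<Rightarrow> complex \<Rightarrow> complex" where
  "pull A w = Linv (A *v L w)"

lemma linear_pull: "linear (pull A)"
  using linear_compose[OF linear_compose[OF linear_L(1) matrix_vector_mul_linear[of A]] linear_L(2)]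
  by (simp add: pull_def[abs_def] o_def)

lemma continuous_pull: "continuous_on S (pull A)"
  using linear_pull by (simp add: linear_continuous_on linear_conv_bounded_linear)

lemma L_pull: "L (pull A w) = A *v L w"
  by (simp add: pull_def)

lemma preimage_open:
  assumes "continuous_map X X f" "openin X V" "openin X U"
  shows "openin X {y \<in> U. f y \<in> V}"
proof -
  have "{y \<in> U. f y \<in> V} = U \<inter> {y \<in> topspace X. f y \<in> V}"
    using openin_subset[OF assms(3)] by blast
  then show ?thesis
    using openin_continuous_map_preimage[OF assms(1,2)] assms(3) by (simp add: openin_Int)
qed

text \<open>In charts with convex image, the map minus \<open>A\<close> has derivative zero and is
  constant. As developments differ by constants, the result carries over to all of them.\<close>

lemma affine_regular:
  assumes f: "continuous_map X X f" "f ` Reg \<subseteq> Reg"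
    and A: "\<And>y. y \<in> Reg \<Longrightarrow> has_flat_derivative T f A y"
    and x: "x \<in> Reg" and d: "development P pr V d" "f x \<in> V" and d': "development P pr V' d'" "x \<in> V'"
  shows "\<exists>W. openin X W \<and> x \<in> W \<and> (\<forall>y\<in>W. d (f y) - d (f x) = pull A (d' y - d' x))"
proof -
  have xX: "x \<in> topspace X" "f x \<in> topspace X" "f x \<in> Reg" using x f by (auto simp: Reg_def)
  obtain V2 \<psi> h2 r2 where V2: "(V2, \<psi>) \<in> atlas T" "f x \<in> V2" "V2 \<subseteq> Reg" "r2 > 0" "\<psi> = (\<lambda>y. L (h2 y))"
    "h2 (f x) = 0" "h2 ` V2 = ball 0 r2" "development P pr V2 h2"
    using atlas_around[OF xX(3) openin_Reg xX(3)] by blast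
  have oV2: "openin X V2" using chart_openin[OF V2(1)] by blast
  have o: "openin X {y \<in> Reg. f y \<in> V2}" by (rule preimage_open[OF f(1) oV2 openin_Reg])
  have xo: "x \<in> {y \<in> Reg. f y \<in> V2}" using x V2(2) by simp
  obtain U \<phi> h r where U: "(U, \<phi>) \<in> atlas T" "x \<in> U" "U \<subseteq> {y \<in> Reg. f y \<in> V2}" "r > 0"
    "\<phi> = (\<lambda>y. L (h y))" "h x = 0" "h ` U = ball 0 r" "development P pr U h"
    using atlas_around[OF x o xo] by blast
  have oU: "openin X U" using chart_openin[OF U(1)] by blast
  have inj: "inj_on \<phi> U"
  proof -
    have "homeomorphic_map (subtopology (subtopology X Reg) U) (top_of_set (\<phi> ` U)) \<phi>"
      using U(1) by (simp add: atlas_T is_chart_def)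
    moreover have "topspace (subtopology (subtopology X Reg) U) = U"
      using openin_subset[OF oU] U(3) by auto
    ultimately show ?thesis using homeomorphic_imp_injective_map by metis
  qed
  define S where "S = L ` ball 0 r"
  have \<phi>U: "\<phi> ` U = S" unfolding S_def U(7)[symmetric] U(5) by (simp add: image_image)
  have "convex S" unfolding S_def using linear_L(1) by (intro convex_linear_image) auto
  define F where "F u = (\<psi> \<circ> f \<circ> inv_into U \<phi>) u - A *v u" for u
  have "\<exists>c. \<forall>u\<in>S. F u = c"
  proof (rule has_derivative_zero_constant[OF \<open>convex S\<close>])
    fix u assume "u \<in> S"
    then obtain y where y: "y \<in> U" "u = \<phi> y" using \<phi>U by blast
    then have "y \<in> Reg" "f y \<in> V2" using U(3) by auto
    then have D: "((\<psi> \<circ> f \<circ> inv_into U \<phi>) has_derivative (\<lambda>v. A *v v)) (at (\<phi> y))"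
      using A[of y] U(1) V2(1) y(1) unfolding has_flat_derivative_def by blast
    have "(F has_derivative (\<lambda>v. A *v v - A *v v)) (at (\<phi> y))"
      unfolding F_def[abs_def] by (intro has_derivative_diff D bounded_linear_imp_has_derivative
          matrix_vector_mul_bounded_linear)
    then show "(F has_derivative (\<lambda>h. 0)) (at u within S)"
      using y(2) has_derivative_at_withinI by simp
  qed
  then obtain c where c: "\<And>u. u \<in> S \<Longrightarrow> F u = c" by blast
  have Fy: "L (h2 (f y)) - A *v L (h y) = c" if "y \<in> U" for y
  proof -
    have "inv_into U \<phi> (\<phi> y) = y" using inv_into_f_f[OF inj that] .
    moreover have "\<phi> y \<in> S" using that \<phi>U by blast
    ultimately show ?thesis using c[of "\<phi> y"] by (simp add: F_def V2(5) U(5))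
  qed
  have hh: "h2 (f y) - h2 (f x) = pull A (h y - h x)" if "y \<in> U" for y
  proof -
    have "L (h2 (f y) - h2 (f x)) = A *v L (h y - h x)"
      using Fy[OF that] Fy[OF U(2)] linear_L(1)
      by (simp add: linear_diff matrix_vector_mult_diff_distrib algebra_simps)
    then show ?thesis by (metis L_Linv(2) pull_def)
  qed
  obtain W1 where W1: "openin X W1" "x \<in> W1" "\<forall>y\<in>W1. d' y - d' x = h y - h x"
    using developments_differ_by_constant[OF d' U(8,2) xX(1)] by blast
  obtain W2 where W2: "openin X W2" "f x \<in> W2" "\<forall>y\<in>W2. d y - d (f x) = h2 y - h2 (f x)"
    using developments_differ_by_constant[OF d V2(8,2) xX(2)] by blast
  define W where "W = {y \<in> U \<inter> W1. f y \<in> W2}"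
  have "openin X W" unfolding W_def using oU W1(1) by (intro preimage_open[OF f(1) W2(1)]) auto
  moreover have "x \<in> W" using U W1 W2 by (simp add: W_def)
  moreover have "d (f y) - d (f x) = pull A (d' y - d' x)" if "y \<in> W" for y
    using that W1(3) W2(3) hh by (auto simp: W_def)
  ultimately show ?thesis by blast
qed

text \<open>No derivative is available at a cone point. But the deviation \<open>G\<close> from the
  linear map is locally constant on the punctured disc, which is connected, and it is continuous at
  the centre, so it is constant there as well.\<close>

lemma affine_everywhere:
  assumes f: "homeomorphic_map X X f" "f ` C = C"
    and A: "\<And>y. y \<in> Reg \<Longrightarrow> has_flat_derivative T f A y"
    and p: "p \<in> topspace X" and d: "development P pr V d" "f p \<in> V" and d': "development P pr V' d'" "p \<in> V'"
  shows "\<exists>W. openin X W \<and> p \<in> W \<and> (\<forall>y\<in>W. d (f y) - d (f p) = pull A (d' y - d' p))"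
proof -
  have fc: "continuous_map X X f" using f(1) by (rule homeomorphic_imp_continuous_map)
  have fim: "f ` topspace X = topspace X" "inj_on f (topspace X)"
    using f(1) homeomorphic_imp_surjective_map homeomorphic_imp_injective_map by blast+
  have fR: "f ` Reg \<subseteq> Reg"
  proof
    fix z assume "z \<in> f ` Reg"
    then obtain y where y: "y \<in> topspace X" "y \<notin> C" "z = f y" by (auto simp: Reg_def)
    have "z \<notin> C"
    proof
      assume "z \<in> C"
      then have "z \<in> f ` C" by (simp only: f(2))
      then obtain y' where y': "y' \<in> C" "f y' = f y" using y(3) by auto
      then have "y' = y" using inj_onD[OF fim(2) y'(2)] C_sub y(1) by blast
      then show False using y'(1) y(2) by simp
    qed
    then show "z \<in> Reg" using y fim by (auto simp: Reg_def)
  qed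
  have fp: "f p \<in> topspace X" using fim p by blast
  obtain U2 h2 r2 c2 m2 where h2_chart: "cone_chart (f p) U2 h2 r2 c2 m2"
    using cone_coordinate[OF fp] by blast
  note h2 = cone_chartD[OF h2_chart]
  obtain W0 where W0: "openin X W0" "p \<in> W0" "W0 - {p} \<subseteq> Reg" using isolated_neighbourhood[OF p] by blast
  have o: "openin X {y \<in> W0. f y \<in> U2}" by (rule preimage_open[OF fc h2(4) W0(1)])
  have po: "p \<in> {y \<in> W0. f y \<in> U2}" using W0 h2 by simp
  obtain U h r c m where h_chart: "cone_chart p U h r c m" and h_sub: "U \<subseteq> {y \<in> W0. f y \<in> U2}"
    using cone_coordinate_in[OF p o po] by blast
  note h = cone_chartD(1-5)[OF h_chart] h_sub cone_chartD(6-9)[OF h_chart]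
  have UX: "U \<subseteq> topspace X" using openin_subset[OF h(4)] .
  obtain e where e: "homeomorphic_maps (subtopology X U) (top_of_set (ball 0 r)) h e"
    using h(8) unfolding homeomorphic_map_maps by blast
  have ec: "continuous_map (top_of_set (ball 0 r)) (subtopology X U) e"
    and he: "\<And>w. w \<in> ball 0 r \<Longrightarrow> h (e w) = w" and eh: "\<And>y. y \<in> U \<Longrightarrow> e (h y) = y"
    using e UX by (auto simp: homeomorphic_maps_def)
  have eU: "e w \<in> U" if "w \<in> ball 0 r" for w
    using continuous_map_image_subset_topspace[OF ec] that UX by auto
  have hU: "h ` U = ball 0 r"
    by (rule cone_chart_bij(1)[OF h_chart])
  define G where "G w = c2 * h2 (f (e w)) ^ m2 - pull A (c * w ^ m)" for w
  have cont: "continuous_on (ball 0 r) G"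
  proof -
    have 1: "continuous_map (top_of_set (ball 0 r)) X e"
      using ec by (simp add: continuous_map_in_subtopology)
    have "f (e w) \<in> U2" if "w \<in> ball 0 r" for w using eU[OF that] h(6) by blast
    then have 2: "continuous_map (top_of_set (ball 0 r)) (subtopology X U2) (f \<circ> e)"
      using continuous_map_compose[OF 1 fc] by (auto simp: continuous_map_in_subtopology)
    have "continuous_map (top_of_set (ball 0 r)) (top_of_set (ball 0 r2)) (h2 \<circ> (f \<circ> e))"
      by (rule continuous_map_compose[OF 2 homeomorphic_imp_continuous_map[OF h2(7)]])
    then have 3: "continuous_on (ball 0 r) (\<lambda>w. h2 (f (e w)))"
      by (simp add: continuous_map_in_subtopology o_def)
    have 4: "continuous_on (ball 0 r) (\<lambda>w. pull A (c * w ^ m))"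
      by (rule continuous_on_compose2[OF continuous_pull[of UNIV A]]) (auto intro!: continuous_intros)
    show ?thesis unfolding G_def[abs_def]
      by (intro continuous_on_diff continuous_on_mult continuous_on_power continuous_on_const 3 4)
  qed
  define S :: "complex set" where "S = ball 0 r - {0}"
  have "connected S"
    unfolding S_def using h(1) by (intro connected_punctured_convex) (auto simp: aff_dim_open)
  have "G constant_on S"
  proof (rule locally_constant_imp_constant[OF \<open>connected S\<close>])
    fix w assume w: "w \<in> S"
    define y where "y = e w"
    have y: "y \<in> U" "h y = w" "y \<noteq> p" using w eU he h(7) by (auto simp: S_def y_def)
    then have yR: "y \<in> Reg" using h(6) W0(3) by blast
    have fy: "f y \<in> U2" using y(1) h(6) by blast
    obtain W where W: "openin X W" "y \<in> W"
      "\<forall>z\<in>W. c2 * h2 (f z) ^ m2 - c2 * h2 (f y) ^ m2 = pull A (c * h z ^ m - c * h y ^ m)"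
      using affine_regular[OF fc fR A yR h2(8) fy h(9) y(1)] by blast
    define Q where "Q = {v \<in> ball 0 r. e v \<in> W}"
    have "openin (top_of_set (ball 0 r)) {v \<in> topspace (top_of_set (ball 0 r)). e v \<in> W \<inter> U}"
      using W(1) by (intro openin_continuous_map_preimage[OF ec]) (simp add: openin_subtopology_Int)
    moreover have "{v \<in> topspace (top_of_set (ball 0 r)). e v \<in> W \<inter> U} = Q"
      using eU by (auto simp: Q_def)
    ultimately have "open Q" by (simp add: openin_open_eq)
    have "openin (top_of_set S) (S \<inter> Q)" using \<open>open Q\<close> by (rule openin_open_Int)
    moreover have "w \<in> S \<inter> Q" using w W(2) by (auto simp: Q_def y_def S_def)
    moreover have "G v = G w" if "v \<in> S \<inter> Q" for v
    proof -
      have v: "v \<in> ball 0 r" "e v \<in> W" using that by (auto simp: Q_def)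
      have "c2 * h2 (f (e v)) ^ m2 - c2 * h2 (f y) ^ m2 = pull A (c * v ^ m) - pull A (c * w ^ m)"
        using W(3) v he[OF v(1)] y(2) linear_pull by (simp flip: linear_diff)
      then show ?thesis by (simp add: G_def y_def algebra_simps)
    qed
    ultimately show "\<exists>T. openin (top_of_set S) T \<and> w \<in> T \<and> (\<forall>x\<in>T. G x = G w)" by blast
  qed
  then obtain g where g: "\<And>w. w \<in> S \<Longrightarrow> G w = g" unfolding constant_on_def by blast
  have ball0: "(0::complex) \<in> ball 0 r" using h(1) by simp
  have "(G \<longlongrightarrow> G 0) (at 0)"
    using cont ball0 by (simp add: continuous_on_eq_continuous_at isCont_def)
  moreover have "\<forall>\<^sub>F w in at 0. G w = g"
    unfolding eventually_at using g h(1) by (intro exI[of _ r]) (auto simp: S_def)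
  then have "(G \<longlongrightarrow> g) (at 0)" by (rule tendsto_eventually)
  ultimately have "G 0 = g" using tendsto_unique trivial_limit_at by metis
  then have Gall: "G w = G 0" if "w \<in> ball 0 r" for w using g that by (cases "w = 0") (auto simp: S_def)
  have e0: "e 0 = p" using eh[OF h(5)] h(7) by simp
  have main: "c2 * h2 (f y) ^ m2 - c2 * h2 (f p) ^ m2 = pull A (c * h y ^ m - c * h p ^ m)" if "y \<in> U" for y
  proof -
    have hy: "h y \<in> ball 0 r" using that hU by blast
    show ?thesis
      using Gall[OF hy] eh[OF that] e0 h(7) linear_0[OF linear_pull[of A]]
      by (simp add: G_def zero_power[OF h(2)] algebra_simps)
  qed
  obtain W1 where W1: "openin X W1" "p \<in> W1" "\<forall>y\<in>W1. d' y - d' p = c * h y ^ m - c * h p ^ m"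
    using developments_differ_by_constant[OF d' h(9,5) p] by blast
  obtain W2 where W2: "openin X W2" "f p \<in> W2" "\<forall>y\<in>W2. d y - d (f p) = c2 * h2 y ^ m2 - c2 * h2 (f p) ^ m2"
    using developments_differ_by_constant[OF d h2(8,5) fp] by blast
  define W where "W = {y \<in> U \<inter> W1. f y \<in> W2}"
  have "openin X W" unfolding W_def using h(4) W1(1) by (intro preimage_open[OF fc W2(1)]) auto
  moreover have "p \<in> W" using h W1 W2 by (simp add: W_def)
  moreover have "d (f y) - d (f p) = pull A (d' y - d' p)" if "y \<in> W" for y
  proof -
    have y: "y \<in> U" "y \<in> W1" "f y \<in> W2" using that by (auto simp: W_def)
    show ?thesis using W1(3) W2(3) main[OF y(1)] y(2,3) by metis
  qed
  ultimately show ?thesis by blast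
qed

lemma corner_fixed:
  assumes f: "homeomorphic_map X X f" "f ` C = C"
    and A: "\<And>y. y \<in> Reg \<Longrightarrow> has_flat_derivative T f A y"
  shows "f (pr \<tau>) = pr \<tau>"
proof (rule ccontr)
  assume ne: "f (pr \<tau>) \<noteq> pr \<tau>"
  have p: "pr \<tau> \<in> topspace X" using \<tau>_C C_sub by blast
  have fc: "continuous_map X X f" using f(1) by (rule homeomorphic_imp_continuous_map)
  have fim: "f ` topspace X = topspace X" "inj_on f (topspace X)"
    using f(1) homeomorphic_imp_surjective_map homeomorphic_imp_injective_map by blast+
  have fp: "f (pr \<tau>) \<in> topspace X" using fim p by blast
  obtain U2 h2 r2 c2 m2 where h2_chart: "cone_chart (f (pr \<tau>)) U2 h2 r2 c2 m2"
    using cone_coordinate[OF fp] by blast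
  note h2 = cone_chartD[OF h2_chart]
  have m2: "m2 = 1" using h2(9) ne by simp
  obtain U1 h1 r1 c1 m1 where h1_chart: "cone_chart (pr \<tau>) U1 h1 r1 c1 m1"
    using cone_coordinate[OF p] by blast
  note h1 = cone_chartD[OF h1_chart]
  obtain W where W: "openin X W" "pr \<tau> \<in> W"
    "\<forall>y\<in>W. c2 * h2 (f y) ^ m2 - c2 * h2 (f (pr \<tau>)) ^ m2 = pull A (c1 * h1 y ^ m1 - c1 * h1 (pr \<tau>) ^ m1)"
    using affine_everywhere[OF f A p h2(8,5) h1(8,5)] by blast
  have o: "openin X {y \<in> W. f y \<in> U2}" by (rule preimage_open[OF fc h2(4) W(1)])
  have "pr \<tau> \<in> {y \<in> W. f y \<in> U2}" using W(2) h2(5) by simp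
  then obtain s where s: "s > 0" "ball 0 s \<subseteq> h1 ` (U1 \<inter> {y \<in> W. f y \<in> U2})"
    using cone_chart_ball[OF h1_chart o] by blast
  define w :: complex where "w = of_real (s / 2)"
  \<comment> \<open>Multiplying the coordinate at the corner point by a nontrivial
    \<open>k\<close>-th root of unity gives a second point with the same development, and both would
    have the same image under \<open>f\<close>.\<close>
  define \<eta> where "\<eta> = cis (2 * pi / k)"
  have k: "real k \<ge> 3" using k_ge by simp
  have \<eta>: "\<eta> ^ k = 1" "norm \<eta> = 1" "\<eta> \<noteq> 1"
  proof -
    show "\<eta> ^ k = 1" using k by (simp add: \<eta>_def Complex.DeMoivre)
    have "sin (2 * pi / k) > 0" using k by (intro sin_gt_zero) (auto simp: field_simps)
    then show "\<eta> \<noteq> 1" by (auto simp: \<eta>_def complex_eq_iff)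
  qed (simp add: \<eta>_def)
  have nw: "norm w = s / 2" "w \<noteq> 0" using s(1) by (auto simp: w_def)
  then have "w \<in> ball 0 s" "\<eta> * w \<in> ball 0 s" using s(1) \<eta>(2) by (auto simp: norm_mult)
  then have "w \<in> h1 ` (U1 \<inter> {y \<in> W. f y \<in> U2})" "\<eta> * w \<in> h1 ` (U1 \<inter> {y \<in> W. f y \<in> U2})"
    using subsetD[OF s(2)] by blast+
  then obtain y y' where y: "y \<in> U1" "y \<in> W" "f y \<in> U2" "h1 y = w"
    and y': "y' \<in> U1" "y' \<in> W" "f y' \<in> U2" "h1 y' = \<eta> * w"
    by (elim imageE) auto
  have "h1 y ^ m1 = h1 y' ^ m1" using h1(9) y(4) y'(4) \<eta>(1) by (simp add: power_mult_distrib)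
  then have "c2 * h2 (f y) ^ m2 - c2 * h2 (f (pr \<tau>)) ^ m2 = c2 * h2 (f y') ^ m2 - c2 * h2 (f (pr \<tau>)) ^ m2"
    using W(3) y(2) y'(2) by metis
  moreover have "c2 \<noteq> 0" using h2(3) by auto
  ultimately have "h2 (f y) = h2 (f y')" by (simp add: m2)
  moreover have "inj_on h2 U2"
    by (rule cone_chart_bij(2)[OF h2_chart])
  ultimately have "f y = f y'" using y(3) y'(3) by (meson inj_onD)
  then have "y = y'" using fim(2) openin_subset[OF h1(4)] y(1) y'(1) by (meson inj_onD subsetD)
  then have "w = \<eta> * w" using y(4) y'(4) by simp
  then show False using \<eta>(3) nw(2) by simp
qed

text \<open>The section \<open>\<rho>\<close> jumps between representatives, and the jumps lie in
  the additive group \<open>K\<close>. Modulo \<open>K\<close> neither the choice of representatives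
  nor the crossing of a side is visible.\<close>

lemma affine_displacement:
  assumes f: "homeomorphic_map X X f" "f ` C = C"
    and A: "\<And>y. y \<in> Reg \<Longrightarrow> has_flat_derivative T f A y"
    and K: "0 \<in> K" "\<And>x y. x \<in> K \<Longrightarrow> y \<in> K \<Longrightarrow> x + y \<in> K" "\<And>x. x \<in> K \<Longrightarrow> - x \<in> K"
      "\<And>x y. x \<in> P \<Longrightarrow> y \<in> P \<Longrightarrow> glued N x y \<Longrightarrow> x - y \<in> K"
    and xy: "x \<in> P" "y \<in> P" "x' \<in> P" "y' \<in> P" "pr x' = f (pr x)" "pr y' = f (pr y)"
  shows "(x' - y') - pull A (x - y) \<in> K"
proof -
  define \<rho> where "\<rho> = inv_into P pr"
  have \<rho>: "\<rho> p \<in> P" "pr (\<rho> p) = p" if "p \<in> topspace X" for p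
    using that by (auto simp: \<rho>_def topspace_X inv_into_into f_inv_into_f)
  have fX: "f p \<in> topspace X" if "p \<in> topspace X" for p
    using homeomorphic_imp_surjective_map[OF f(1)] that by blast
  have prX: "pr x \<in> topspace X" if "x \<in> P" for x using that by (simp add: topspace_X)
  define F where "F x = \<rho> (f (pr x)) - pull A x" for x
  have Kd: "x - y \<in> K" if "x \<in> K" "y \<in> K" for x y using K(2)[OF that(1) K(3)[OF that(2)]] by simp
  have FK: "F x - F y \<in> K"
  proof (rule connected_equivalence_relation[OF connected_P xy(1,2)])
    show "F y - F x \<in> K" if "F x - F y \<in> K" for x y using K(3)[OF that] by simp
    show "F x - F z \<in> K" if "F x - F y \<in> K" "F y - F z \<in> K" for x y z using K(2)[OF that] by simp
    fix x assume x: "x \<in> P"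
    define p where "p = pr x"
    have p: "p \<in> topspace X" "f p \<in> topspace X" using x prX fX by (auto simp: p_def)
    obtain U2 h2 r2 c2 m2 where h2_chart: "cone_chart (f p) U2 h2 r2 c2 m2"
      using cone_coordinate[OF p(2)] by blast
    note h2 = cone_chartD[OF h2_chart]
    define d2 where "d2 = (\<lambda>y. c2 * h2 y ^ m2)"
    have d2: "development P pr U2 d2" using h2(8) by (simp add: d2_def)
    obtain U1 h1 r1 c1 m1 where h1_chart: "cone_chart p U1 h1 r1 c1 m1"
      using cone_coordinate[OF p(1)] by blast
    note h1 = cone_chartD[OF h1_chart]
    define d1 where "d1 = (\<lambda>y. c1 * h1 y ^ m1)"
    have d1: "development P pr U1 d1" using h1(8) by (simp add: d1_def)
    obtain W where W: "openin X W" "p \<in> W" "\<forall>y\<in>W. d2 (f y) - d2 (f p) = pull A (d1 y - d1 p)"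
      using affine_everywhere[OF f A p(1) d2 h2(5) d1 h1(5)] by blast
    obtain e1 where e1: "e1 > 0" "\<And>z. z \<in> P \<Longrightarrow> dist z x < e1 \<Longrightarrow> d1 (pr z) - d1 p = z - x"
      using d1 x h1(5) unfolding development_def p_def by blast
    have "\<exists>e>0. \<forall>z\<in>P. dist z v < e \<longrightarrow> d2 (pr z) - d2 (f p) = z - v" if v: "v \<in> P" "pr v = f p" for v
      using d2 v h2(5) unfolding development_def by metis
    then obtain e2 where e2: "\<And>v. v \<in> P \<Longrightarrow> pr v = f p \<Longrightarrow>
        e2 v > 0 \<and> (\<forall>z\<in>P. dist z v < e2 v \<longrightarrow> d2 (pr z) - d2 (f p) = z - v)"
      by metis
    then obtain W2 where W2: "openin X W2" "f p \<in> W2"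
      "\<forall>z\<in>P. pr z \<in> W2 \<longrightarrow> (\<exists>v\<in>P. pr v = f p \<and> dist z v < e2 v)"
      using saturated_neighbourhood[OF p(2), of e2] by blast
    define W' where "W' = {y \<in> W. f y \<in> W2}"
    have "openin X W'"
      unfolding W'_def using homeomorphic_imp_continuous_map[OF f(1)] W2(1) W(1) by (rule preimage_open)
    then have "openin (top_of_set P) {z \<in> P. pr z \<in> W'}"
      using openin_continuous_map_preimage[OF quotient_imp_continuous_map[OF quotient_pr]] by simp
    then have "openin (top_of_set P) ({z \<in> P. pr z \<in> W'} \<inter> (P \<inter> ball x e1))"
      by (intro openin_Int openin_open_Int) auto
    moreover have "x \<in> {z \<in> P. pr z \<in> W'} \<inter> (P \<inter> ball x e1)"
      using x W(2) W2(2) e1(1) by (auto simp: W'_def p_def)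
    moreover have "F x - F z \<in> K" if "z \<in> {z \<in> P. pr z \<in> W'} \<inter> (P \<inter> ball x e1)" for z
    proof -
      have z: "z \<in> P" "pr z \<in> W" "f (pr z) \<in> W2" "dist z x < e1"
        using that by (auto simp: W'_def dist_commute)
      define z2 where "z2 = \<rho> (f (pr z))"
      have z2: "z2 \<in> P" "pr z2 = f (pr z)" using \<rho>[OF fX[OF prX[OF z(1)]]] by (auto simp: z2_def)
      \<comment> \<open>\<open>v\<close> is the representative of \<open>f p\<close> next to
        \<open>z2\<close>: from \<open>v\<close> to \<open>z2\<close> the displacement is exact, and
        \<open>v\<close> differs from the chosen representative of \<open>f p\<close> by an element
        of \<open>K\<close>.\<close>
      then obtain v where v: "v \<in> P" "pr v = f p" "dist z2 v < e2 v" using W2(3) z(3) by metis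
      then have "d2 (f (pr z)) - d2 (f p) = z2 - v" using e2[OF v(1,2)] z2 by metis
      moreover have "d2 (f (pr z)) - d2 (f p) = pull A (z - x)" using W(3) z(2) e1(2)[OF z(1,4)] by metis
      ultimately have "z2 - v = pull A z - pull A x" using linear_diff[OF linear_pull] by metis
      moreover have "\<rho> (f p) - v \<in> K"
        using K(4)[of "\<rho> (f p)" v] \<rho>[OF p(2)] v pr_iff by metis
      ultimately show ?thesis
        unfolding F_def p_def[symmetric] z2_def[symmetric] by (simp add: algebra_simps)
    qed
    ultimately show "\<exists>T. openin (top_of_set P) T \<and> x \<in> T \<and> (\<forall>z\<in>T. F x - F z \<in> K)"
      by blast
  qed
  have "x' - \<rho> (f (pr x)) \<in> K" "y' - \<rho> (f (pr y)) \<in> K"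
    using K(4) \<rho>[OF fX[OF prX]] xy pr_iff by metis+
  then have "(x' - \<rho> (f (pr x))) + (F x - F y) - (y' - \<rho> (f (pr y))) \<in> K"
    using FK K(2) Kd by blast
  moreover have "(x' - \<rho> (f (pr x))) + (F x - F y) - (y' - \<rho> (f (pr y))) = (x' - y') - pull A (x - y)"
    unfolding F_def linear_diff[OF linear_pull] by (simp add: algebra_simps)
  ultimately show ?thesis by simp
qed

end

section \<open>Symmetries of the polygon as affine maps\<close>

context marked_ngon
begin

text \<open>The restriction is there because \<open>affine_group\<close> consists of extensional
  functions.\<close>

definition descend :: "(complex \<Rightarrow> complex) \<Rightarrow> 'a \<Rightarrow> 'a" where
  "descend g = restrict (\<lambda>y. pr (g (inv_into P pr y))) (topspace X)"

definition symmetry :: "(complex \<Rightarrow> complex) \<Rightarrow> bool" where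
  "symmetry g \<longleftrightarrow> linear g \<and> g ` P = P \<and>
     (\<forall>x y. glued N x y \<longrightarrow> glued N (g x) (g y)) \<and> descend g ` C = C"

lemma descend_pr_if:
  assumes P: "\<And>z. z \<in> P \<Longrightarrow> g z \<in> P" and gl: "\<And>x y. glued N x y \<Longrightarrow> glued N (g x) (g y)" and x: "x \<in> P"
  shows "descend g (pr x) = pr (g x)"
proof -
  define y where "y = inv_into P pr (pr x)"
  have y: "y \<in> P" "pr y = pr x"
    using x by (auto simp: y_def inv_into_into f_inv_into_f)
  then have "glued N y x" using pr_iff x by blast
  then have "pr (g y) = pr (g x)" using pr_iff P gl y(1) x by blast
  then show ?thesis using x by (simp add: descend_def topspace_X y_def)
qed

lemma descend_pr: "symmetry g \<Longrightarrow> x \<in> P \<Longrightarrow> descend g (pr x) = pr (g x)"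
  by (rule descend_pr_if) (auto simp: symmetry_def)

lemma descend_inverse:
  assumes g: "symmetry g" and g': "symmetry g'" and inv: "\<And>x. g' (g x) = x" and y: "y \<in> topspace X"
  shows "descend g' (descend g y) = y"
proof -
  obtain x where x: "x \<in> P" "y = pr x" using y by (auto simp: topspace_X)
  then have "g x \<in> P" using g unfolding symmetry_def by blast
  then show ?thesis using x descend_pr[OF g] descend_pr[OF g'] inv by simp
qed

lemma continuous_descend:
  assumes g: "symmetry g"
  shows "continuous_map X X (descend g)"
proof -
  have lin: "linear g" "g ` P = P" using g by (auto simp: symmetry_def)
  have "continuous_map (top_of_set P) (top_of_set P) g"
    using lin by (simp add: continuous_map_in_subtopology linear_continuous_on linear_conv_bounded_linear Pi_iff image_subset_iff[symmetric])
  then have "continuous_map (top_of_set P) X (pr \<circ> g)"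
    by (rule continuous_map_compose) (rule quotient_imp_continuous_map[OF quotient_pr])
  moreover have "(pr \<circ> g) x = (descend g \<circ> pr) x" if "x \<in> topspace (top_of_set P)" for x
    using descend_pr[OF g] that by simp
  ultimately have "continuous_map (top_of_set P) X (descend g \<circ> pr)"
    using continuous_map_eq by metis
  then show ?thesis using continuous_compose_quotient_map[OF quotient_pr] by blast
qed

lemma homeomorphic_descend:
  assumes "symmetry g" "symmetry g'" "\<And>x. g' (g x) = x" "\<And>x. g (g' x) = x"
  shows "homeomorphic_maps X X (descend g) (descend g')"
  using assms by (simp add: homeomorphic_maps_def continuous_descend descend_inverse)

text \<open>At every representative \<open>g\<close> transforms the increment of the polygon
  coordinate linearly, hence also that of any development; the hypothesis on \<open>L\<close> turns
  this into an affine formula with matrix \<open>A\<close> in arbitrary charts.\<close>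

lemma descend_derivative:
  assumes g: "symmetry g" and x: "x \<in> Reg" and A: "\<And>w. L (g w) = A *v L w"
  shows "has_flat_derivative T (descend g) A x"
  unfolding has_flat_derivative_def
proof clarify
  fix U \<phi> V \<psi> assume U: "(U, \<phi>) \<in> atlas T" "x \<in> U" and V: "(V, \<psi>) \<in> atlas T" "descend g x \<in> V"
  have o: "openin X U" "openin X V" using chart_openin U V by blast+
  have UX: "U \<subseteq> topspace X" using o(1) openin_subset by blast
  have xX: "x \<in> topspace X" using U UX by blast
  define d where "d y = Linv (\<phi> y)" for y
  define d' where "d' y = Linv (\<psi> y)" for y
  have dev: "development P pr U d" "development P pr V d'"
    using U V by (simp_all add: atlas_T d_def[abs_def] d'_def[abs_def])
  have lin: "linear g" "g ` P = P" using g by (auto simp: symmetry_def)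
  obtain M where M: "M > 0" "\<And>w. norm (g w) \<le> M * norm w"
    using linear_bounded_pos[OF lin(1)] by (auto simp: mult.commute)
  have "\<exists>e>0. \<forall>z\<in>P. dist z v < e \<longrightarrow> d' (descend g (pr z)) - d' (descend g x) = g (d (pr z) - d x)"
    if v: "v \<in> P" "pr v = x" for v
  proof -
    obtain e1 where e1: "e1 > 0" "\<And>z. z \<in> P \<Longrightarrow> dist z v < e1 \<Longrightarrow> d (pr z) - d x = z - v"
      using dev(1) v U(2) unfolding development_def by metis
    have gv: "g v \<in> P" "pr (g v) = descend g x" using lin(2) v descend_pr[OF g v(1)] by auto
    then obtain e2 where e2: "e2 > 0" "\<And>z. z \<in> P \<Longrightarrow> dist z (g v) < e2 \<Longrightarrow> d' (pr z) - d' (descend g x) = z - g v"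
      using dev(2) V(2) unfolding development_def by metis
    have "d' (descend g (pr z)) - d' (descend g x) = g (d (pr z) - d x)"
      if z: "z \<in> P" "dist z v < min e1 (e2 / M)" for z
    proof -
      have "dist (g z) (g v) \<le> M * dist z v"
        using M(2)[of "z - v"] linear_diff[OF lin(1)] by (simp add: dist_norm)
      also have "\<dots> < e2" using z(2) M(1) by (simp add: field_simps)
      finally have "d' (pr (g z)) - d' (descend g x) = g z - g v" using e2(2) lin(2) z(1) by blast
      moreover have "d (pr z) - d x = z - v" using e1(2) z by simp
      ultimately show ?thesis using descend_pr[OF g z(1)] linear_diff[OF lin(1)] by simp
    qed
    then show ?thesis using e1(1) e2(1) M(1) by (intro exI[of _ "min e1 (e2 / M)"]) auto
  qed
  then obtain e where e: "\<And>v. v \<in> P \<Longrightarrow> pr v = x \<Longrightarrow> e v > 0 \<and>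
      (\<forall>z\<in>P. dist z v < e v \<longrightarrow> d' (descend g (pr z)) - d' (descend g x) = g (d (pr z) - d x))"
    by metis
  then obtain W where W: "openin X W" "x \<in> W" "\<forall>z\<in>P. pr z \<in> W \<longrightarrow> (\<exists>v\<in>P. pr v = x \<and> dist z v < e v)"
    using saturated_neighbourhood[OF xX, of e] by blast
  have loc: "d' (descend g y) - d' (descend g x) = g (d y - d x)" if y: "y \<in> W" for y
  proof -
    have "y \<in> pr ` P" using y openin_subset[OF W(1)] by (auto simp: topspace_X)
    then obtain z where "z \<in> P" "y = pr z" by blast
    moreover then obtain v where "v \<in> P" "pr v = x" "dist z v < e v" using W(3) y by blast
    ultimately show ?thesis using e by metis
  qed
  have loc': "\<psi> (descend g y) = \<psi> (descend g x) + A *v (\<phi> y - \<phi> x)" if "y \<in> W" for y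
  proof -
    have "\<psi> (descend g y) - \<psi> (descend g x) = L (d' (descend g y) - d' (descend g x))"
      using linear_L(1) by (simp add: d'_def linear_diff)
    also have "\<dots> = A *v (L (d y - d x))" unfolding loc[OF that] by (rule A)
    also have "\<dots> = A *v (\<phi> y - \<phi> x)" using linear_L(1) by (simp add: d_def linear_diff)
    finally show ?thesis by (simp add: algebra_simps)
  qed
  have ch: "homeomorphic_map (subtopology (subtopology X Reg) U) (top_of_set (\<phi> ` U)) \<phi>" "open (\<phi> ` U)"
    using U(1) by (auto simp: atlas_T is_chart_def)
  have sub: "subtopology (subtopology X Reg) U = subtopology X U"
    using chart_openin[OF U(1)] by (simp add: subtopology_subtopology Int_absorb1)
  have inj: "inj_on \<phi> U"
    using homeomorphic_imp_injective_map[OF ch(1)] UX unfolding sub by (simp add: Int_absorb1)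
  have "openin (subtopology X U) (U \<inter> W)" using o W by (auto simp: openin_open_subtopology)
  then have "openin (top_of_set (\<phi> ` U)) (\<phi> ` (U \<inter> W))"
    using homeomorphic_imp_open_map[OF ch(1)] unfolding sub by (simp add: open_map_def)
  then have op: "open (\<phi> ` (U \<inter> W))" using ch(2) by (simp add: openin_open_eq)
  have "((\<lambda>u. \<psi> (descend g x) + A *v (u - \<phi> x)) has_derivative (\<lambda>v. A *v v)) (at (\<phi> x))"
  proof -
    have "((\<lambda>u. A *v u + (\<psi> (descend g x) - A *v \<phi> x)) has_derivative (\<lambda>v. A *v v)) (at (\<phi> x))"
      by (intro has_derivative_add_const bounded_linear_imp_has_derivative matrix_vector_mul_bounded_linear)
    then show ?thesis by (simp add: matrix_vector_mult_diff_distrib algebra_simps)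
  qed
  then show "((\<psi> \<circ> descend g \<circ> inv_into U \<phi>) has_derivative (\<lambda>v. A *v v)) (at (\<phi> x))"
  proof (rule has_derivative_transform_within_open[OF _ op])
    show "\<phi> x \<in> \<phi> ` (U \<inter> W)" using U(2) W(2) by blast
    fix u assume "u \<in> \<phi> ` (U \<inter> W)"
    then obtain y where "y \<in> U" "y \<in> W" "u = \<phi> y" by blast
    then show "\<psi> (descend g x) + A *v (u - \<phi> x) = (\<psi> \<circ> descend g \<circ> inv_into U \<phi>) u"
      using loc'[of y] inv_into_f_f[OF inj] by simp
  qed
qed

text \<open>Without a regular point every matrix would count as a constant derivative, and
  \<open>constant_derivative\<close> would have no definite value. The set \<open>C\<close> is
  finite, whereas a chart contains a disc.\<close>

lemma Reg_nonempty: "Reg \<noteq> {}"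
proof
  assume "Reg = {}"
  then have "topspace X = C" using C_sub by (auto simp: Reg_def)
  then have fin: "finite (topspace X)" using finite_C by simp
  have p: "pr \<tau> \<in> topspace X" using \<tau>_C C_sub by blast
  obtain U h r c m where h_chart: "cone_chart (pr \<tau>) U h r c m"
    using cone_coordinate[OF p] by blast
  note h = cone_chartD[OF h_chart]
  have "h ` U = ball 0 r"
    by (rule cone_chart_bij(1)[OF h_chart])
  moreover have "finite U" using fin openin_subset[OF h(4)] finite_subset by blast
  ultimately have "finite (ball (0::complex) r)" by (metis finite_imageI)
  then show False using uncountable_ball[OF h(1)] countable_finite by blast
qed

text \<open>The point \<open>f x\<close> has to be regular as well: otherwise no chart surrounds it
  and \<open>has_flat_derivative\<close> holds vacuously.\<close>

lemma has_flat_derivative_unique: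
  assumes "x \<in> Reg" "f x \<in> Reg" "has_flat_derivative T f A x" "has_flat_derivative T f B x"
  shows "A = B"
proof -
  obtain U \<phi> where U: "(U, \<phi>) \<in> atlas T" "x \<in> U"
    using atlas_around[OF assms(1) openin_Reg assms(1)] by blast
  obtain V \<psi> where V: "(V, \<psi>) \<in> atlas T" "f x \<in> V"
    using atlas_around[OF assms(2) openin_Reg assms(2)] by blast
  have "((\<psi> \<circ> f \<circ> inv_into U \<phi>) has_derivative (\<lambda>v. A *v v)) (at (\<phi> x))"
    "((\<psi> \<circ> f \<circ> inv_into U \<phi>) has_derivative (\<lambda>v. B *v v)) (at (\<phi> x))"
    using assms(3,4) U V unfolding has_flat_derivative_def by blast+
  then have "(\<lambda>v. A *v v) = (\<lambda>v. B *v v)" by (rule has_derivative_unique)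
  then show ?thesis by (metis matrix_eq)
qed

lemma constant_derivative_eq:
  assumes "f ` topspace X \<subseteq> topspace X" "inj_on f (topspace X)" "f ` C = C"
    and A: "\<And>x. x \<in> Reg \<Longrightarrow> has_flat_derivative T f A x"
  shows "constant_derivative T f = A"
proof -
  obtain x where x: "x \<in> Reg" using Reg_nonempty by blast
  have "f x \<notin> C"
  proof
    assume "f x \<in> C"
    then have "f x \<in> f ` C" by (simp only: assms(3))
    then obtain y where y: "y \<in> C" "f x = f y" by blast
    then have "x = y" using inj_onD[OF assms(2)] x C_sub unfolding Reg_def by blast
    then show False using y x by (simp add: Reg_def)
  qed
  then have "f x \<in> Reg" using x assms(1) by (auto simp: Reg_def)
  then show ?thesis
    unfolding constant_derivative_def using x A has_flat_derivative_unique
    by (intro the_equality) auto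
qed

lemma symmetry_in_veech_group:
  assumes g: "symmetry g" and g': "symmetry g'" and inv: "\<And>x. g' (g x) = x" "\<And>x. g (g' x) = x"
    and A: "\<And>w. L (g w) = A *v L w" and A': "\<And>w. L (g' w) = A' *v L w"
  shows "A \<in> veech_group T"
proof -
  have hm: "homeomorphic_maps X X (descend g) (descend g')" by (rule homeomorphic_descend[OF g g' inv])
  then have h: "homeomorphic_map X X (descend g)" by (auto simp: homeomorphic_map_maps)
  have C: "descend g ` C = C" using g by (simp add: symmetry_def)
  have inj: "inj_on (descend g) (topspace X)" "descend g ` topspace X = topspace X"
    using homeomorphic_imp_injective_map[OF h] homeomorphic_imp_surjective_map[OF h] by auto
  \<comment> \<open>The two functions are compared on the surface only, so derivatives have to be
    transferred within the image of a chart.\<close>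
  have inv_eq: "inv_into (topspace X) (descend g) y = descend g' y" if "y \<in> topspace X" for y
    using hm that inj unfolding homeomorphic_maps_def
    by (intro inv_into_f_eq) (auto simp: continuous_map_def)
  have hinv: "has_flat_derivative T (inv_into (topspace X) (descend g)) A' y" if y: "y \<in> Reg" for y
  proof -
    have "((\<psi> \<circ> inv_into (topspace X) (descend g) \<circ> inv_into U \<phi>) has_derivative (\<lambda>v. A' *v v)) (at (\<phi> y))"
      if U: "(U, \<phi>) \<in> atlas T" "y \<in> U" and V: "(V, \<psi>) \<in> atlas T" "inv_into (topspace X) (descend g) y \<in> V"
      for U \<phi> V \<psi>
    proof -
      have yX: "y \<in> topspace X" using y by (simp add: Reg_def)
      have UX: "U \<subseteq> topspace X" using chart_openin[OF U(1)] openin_subset by blast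
      have D: "((\<psi> \<circ> descend g' \<circ> inv_into U \<phi>) has_derivative (\<lambda>v. A' *v v)) (at (\<phi> y))"
        using descend_derivative[OF g' y A'] U V inv_eq[OF yX] unfolding has_flat_derivative_def by fastforce
      have op: "open (\<phi> ` U)" using U(1) by (auto simp: atlas_T is_chart_def)
      show ?thesis
      proof (rule has_derivative_transform_within_open[OF D op])
        show "\<phi> y \<in> \<phi> ` U" using U(2) by blast
        fix u assume "u \<in> \<phi> ` U"
        then have "inv_into U \<phi> u \<in> topspace X" using UX inv_into_into[of u \<phi> U] by blast
        then show "(\<psi> \<circ> descend g' \<circ> inv_into U \<phi>) u = (\<psi> \<circ> inv_into (topspace X) (descend g) \<circ> inv_into U \<phi>) u"
          using inv_eq by simp
      qed
    qed
    then show ?thesis unfolding has_flat_derivative_def by blast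
  qed
  have ext: "descend g \<in> extensional (topspace X)" by (simp add: descend_def)
  have der: "\<exists>A. \<forall>x\<in>Reg. has_flat_derivative T (descend g) A x"
    using descend_derivative[OF g _ A] by blast
  have der': "\<forall>y\<in>Reg. \<exists>B. has_flat_derivative T (inv_into (topspace X) (descend g)) B y"
    using hinv by blast
  have "descend g \<in> affine_group T"
    unfolding affine_group_def T_simps by (intro CollectI conjI) (fact ext h C der der')+
  moreover have "constant_derivative T (descend g) = A"
    using inj C descend_derivative[OF g _ A] by (intro constant_derivative_eq) auto
  ultimately show ?thesis unfolding veech_group_def by blast
qed

end

text \<open>Everything is read off from three displacements of \<open>f\<close>: those between two
  pairs of corners put the coefficients of \<open>B\<close> into \<open>K\<close>, and the one from
  a corner to \<open>q\<close> identifies \<open>B\<close>.\<close>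

lemma veech_group_subset:
  fixes a b :: complex and C :: "'a set"
  assumes "marked_ngon k pr a b C"
  defines "N \<equiv> glued_ngon.N k" and "P \<equiv> glued_ngon.P k" and "\<tau> \<equiv> glued_ngon.\<tau> k"
    and "L \<equiv> marked_ngon.L a b" and "T \<equiv> marked_ngon.T k pr a b C"
  assumes K: "\<And>x y. x \<in> K \<Longrightarrow> y \<in> K \<Longrightarrow> x + y \<in> K" "\<And>x. x \<in> K \<Longrightarrow> - x \<in> K"
      "\<And>x y. x \<in> K \<Longrightarrow> y \<in> K \<Longrightarrow> x * y \<in> K" "\<And>x. x \<in> K \<Longrightarrow> inverse x \<in> K"
      "\<tau> \<in> K" "cnj \<tau> \<in> K" "roots N \<subseteq> K"
    and G: "\<And>g. g \<in> G \<Longrightarrow> g q \<in> P \<and> (\<exists>\<gamma>\<in>K. g = (\<lambda>z. \<gamma> * z) \<or> g = (\<lambda>z. \<gamma> * cnj z))" "id \<in> G"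
    and q: "q \<in> P" "\<And>u. u \<in> roots N \<Longrightarrow> inner u q < 1"
      "\<And>\<alpha> \<beta> \<gamma>. \<alpha> \<in> K \<Longrightarrow> \<beta> \<in> K \<Longrightarrow> \<gamma> \<in> K \<Longrightarrow> \<alpha> * q + \<beta> * cnj q = \<gamma> \<Longrightarrow> \<alpha> = 0 \<and> \<beta> = 0"
    and C: "C = insert (pr \<tau>) ((\<lambda>g. pr (g q)) ` G)"
    and A: "A \<in> veech_group T"
  shows "\<exists>g\<in>G. \<forall>w. L (g w) = A *v L w"
proof -
  interpret M: marked_ngon k pr a b C by fact
  obtain f where f: "f \<in> affine_group M.T" "A = constant_derivative M.T f"
    using A unfolding veech_group_def T_def by blast
  then obtain A0 where A0: "\<And>x. x \<in> M.Reg \<Longrightarrow> has_flat_derivative M.T f A0 x"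
    unfolding affine_group_def M.T_simps by blast
  have hf: "homeomorphic_map M.X M.X f" "f ` C = C"
    using f(1) unfolding affine_group_def M.T_simps by blast+
  have fX: "f ` topspace M.X = topspace M.X" "inj_on f (topspace M.X)"
    using homeomorphic_imp_surjective_map[OF hf(1)] homeomorphic_imp_injective_map[OF hf(1)] by auto
  have "A0 = A"
    unfolding f(2) by (rule M.constant_derivative_eq[OF _ fX(2) hf(2) A0, symmetric]) (use fX in auto)
  note D = A0[unfolded \<open>A0 = A\<close>]
  have Kd: "x - y \<in> K" if "x \<in> K" "y \<in> K" for x y
    using K(1)[OF that(1) K(2)[OF that(2)]] by simp
  have K0: "0 \<in> K" using Kd[OF K(5,5)] by simp
  have K1: "1 \<in> K" using roots_1 K(7) by blast
  have K2: "2 \<in> K" using K(1)[OF K1 K1] by simp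
  have halve: "x \<in> K" if "2 * x \<in> K" for x
  proof -
    have "inverse 2 * (2 * x) \<in> K" by (rule K(3)[OF K(4)[OF K2] that])
    moreover have "inverse 2 * (2 * x) = x" by simp
    ultimately show ?thesis by (simp only:)
  qed
  have Kglued: "x - y \<in> K" if "glued N x y" for x y
    using that unfolding glued_def
  proof (elim disjE)
    assume "x \<in> corners N \<and> y \<in> corners N"
    then obtain u v where "u \<in> roots N" "v \<in> roots N" "x = u * \<tau>" "y = v * \<tau>"
      unfolding N_def M.corners_eq_\<tau> \<tau>_def by blast
    then show ?thesis using Kd[OF K(3)[OF _ K(5)] K(3)[OF _ K(5)]] K(7) by blast
  next
    assume "\<exists>u\<in>roots N. inner u x = 1 \<and> y = x - 2 * u"
    then obtain u where "u \<in> roots N" "y = x - 2 * u" by blast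
    then show ?thesis using K(3)[OF K2] K(7) by auto
  qed (use K0 in simp)
  have fix_\<tau>: "f (pr M.\<tau>) = pr M.\<tau>" by (rule M.corner_fixed[OF hf D])
  have \<tau>P: "M.\<tau> \<in> M.P" by (rule M.\<tau>_corner)
  have "- 1 \<in> roots M.N" using roots_uminus[OF M.N(2) roots_1] by simp
  then have cs: "- M.\<tau> \<in> corners M.N" "cnj M.\<tau> \<in> corners M.N"
    using corners_mult[OF M.N(1) _ M.\<tau>_corner(1)] corners_cnj[OF M.\<tau>_corner(1)] by force+
  note disp = M.affine_displacement[OF hf D K0 K(1,2) Kglued[unfolded N_def]]
  define B where "B = M.pull A"
  have lin: "linear B" unfolding B_def by (rule M.linear_pull)
  define \<alpha> where "\<alpha> = (B 1 - \<i> * B \<i>) / 2"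
  define \<beta> where "\<beta> = (B 1 + \<i> * B \<i>) / 2"
  have B: "B w = \<alpha> * w + \<beta> * cnj w" for w
    unfolding \<alpha>_def \<beta>_def by (rule linear_real_complex[OF lin])
  have \<tau>t: "\<tau> + cnj \<tau> = 2" unfolding \<tau>_def by (rule M.cnj_\<tau>)
  have \<tau>ne: "\<tau> - cnj \<tau> \<noteq> 0"
  proof -
    have "tan (pi / real M.N) > 0"
      using M.N by (intro tan_gt_zero) (auto simp: field_simps)
    then show ?thesis unfolding \<tau>_def M.\<tau>_def corner_def by (simp add: complex_eq_iff)
  qed
  \<comment> \<open>All corners represent the same fixed point, so \<open>\<tau>\<close> may serve
    as representative of the image of each of them. The difference
    \<open>\<tau> - cnj \<tau>\<close> is imaginary, so \<open>B\<close> multiplies it by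
    \<open>\<alpha> - \<beta>\<close>.\<close>
  have "(M.\<tau> - M.\<tau>) - B (M.\<tau> - cnj M.\<tau>) \<in> K"
    unfolding B_def using cs(2) M.corners_P M.pr_corner fix_\<tau> \<tau>P by (intro disp) auto
  then have "- B (\<tau> - cnj \<tau>) \<in> K" by (simp add: \<tau>_def)
  then have "B (\<tau> - cnj \<tau>) \<in> K" using K(2) by fastforce
  moreover have "B (\<tau> - cnj \<tau>) = (\<alpha> - \<beta>) * (\<tau> - cnj \<tau>)" unfolding B by (simp add: algebra_simps)
  ultimately have "(\<alpha> - \<beta>) * (\<tau> - cnj \<tau>) * inverse (\<tau> - cnj \<tau>) \<in> K"
    using K(3) K(4)[OF Kd[OF K(5,6)]] by metis
  then have ab_K: "\<alpha> - \<beta> \<in> K" by (simp only: mult.assoc right_inverse[OF \<tau>ne] mult_1_right)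
  \<comment> \<open>The same with the corner opposite to \<open>\<tau>\<close>. Since
    \<open>\<tau> + cnj \<tau> = 2\<close>, knowing \<open>\<alpha> - \<beta>\<close> in
    \<open>K\<close> then isolates \<open>\<alpha>\<close>.\<close>
  have "(M.\<tau> - M.\<tau>) - B (M.\<tau> - (- M.\<tau>)) \<in> K"
    unfolding B_def using cs(1) M.corners_P M.pr_corner fix_\<tau> \<tau>P by (intro disp) auto
  then have "- B (\<tau> + \<tau>) \<in> K" by (simp add: \<tau>_def)
  then have "B (\<tau> + \<tau>) \<in> K" using K(2) by fastforce
  moreover have "B (\<tau> + \<tau>) = 2 * (\<alpha> * (\<tau> + cnj \<tau>) - (\<alpha> - \<beta>) * cnj \<tau>)"
    unfolding B by (simp add: algebra_simps)
  ultimately have "2 * (2 * \<alpha> - (\<alpha> - \<beta>) * cnj \<tau>) \<in> K" unfolding \<tau>t by (simp add: mult.commute)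
  then have "2 * \<alpha> - (\<alpha> - \<beta>) * cnj \<tau> \<in> K" by (rule halve)
  then have "(2 * \<alpha> - (\<alpha> - \<beta>) * cnj \<tau>) + (\<alpha> - \<beta>) * cnj \<tau> \<in> K"
    using K(1) K(3)[OF ab_K K(6)] by blast
  then have "2 * \<alpha> \<in> K" by simp
  then have \<alpha>K: "\<alpha> \<in> K" by (rule halve)
  have \<beta>K: "\<beta> \<in> K" using Kd[OF \<alpha>K ab_K] by simp
  have qne: "pr q \<noteq> pr M.\<tau>"
  proof
    assume "pr q = pr M.\<tau>"
    then have "glued M.N M.\<tau> q" using M.pr_iff[of M.\<tau> q] q(1) \<tau>P unfolding P_def by simp
    then have "q \<in> corners M.N" by (rule glued_corner[OF M.N(1,2) _ M.\<tau>_corner(1)])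
    then show False using q(2) unfolding corners_def N_def by force
  qed
  have qX: "pr q \<in> topspace M.X" "pr M.\<tau> \<in> topspace M.X"
    using q(1) \<tau>P by (auto simp: M.topspace_X P_def)
  have "pr q \<in> C" unfolding C using G(2) by (force simp: image_iff)
  then have "f (pr q) \<in> C" using hf(2) by blast
  \<comment> \<open>\<open>f\<close> is injective and already fixes the corner point, so
    \<open>pr q\<close> has to go to a point of the marked orbit.\<close>
  moreover have "f (pr q) \<noteq> pr M.\<tau>"
    using fix_\<tau> inj_onD[OF fX(2) _ qX] qne by metis
  ultimately obtain g where g: "g \<in> G" "f (pr q) = pr (g q)"
    unfolding C \<tau>_def by blast
  have "(g q - M.\<tau>) - B (q - M.\<tau>) \<in> K"
    unfolding B_def using q(1) g G(1)[OF g(1)] \<tau>P fix_\<tau> by (intro disp) (auto simp: P_def)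
  then have "(g q - \<tau>) - B (q - \<tau>) \<in> K" by (simp add: \<tau>_def)
  then have "((g q - \<tau>) - B (q - \<tau>)) + \<tau> - (\<alpha> * \<tau> + \<beta> * cnj \<tau>) \<in> K"
    by (rule Kd[OF K(1)[OF _ K(5)] K(1)[OF K(3)[OF \<alpha>K K(5)] K(3)[OF \<beta>K K(6)]]])
  moreover have "((g q - \<tau>) - B (q - \<tau>)) + \<tau> - (\<alpha> * \<tau> + \<beta> * cnj \<tau>) = g q - (\<alpha> * q + \<beta> * cnj q)"
    unfolding B by (simp add: algebra_simps)
  ultimately have *: "g q - (\<alpha> * q + \<beta> * cnj q) \<in> K" by (simp only:)
  obtain \<gamma> where \<gamma>: "\<gamma> \<in> K" "g = (\<lambda>z. \<gamma> * z) \<or> g = (\<lambda>z. \<gamma> * cnj z)"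
    using G(1)[OF g(1)] by blast
  from \<gamma>(2) have "B = g"
  proof
    assume g': "g = (\<lambda>z. \<gamma> * z)"
    have "(\<gamma> - \<alpha>) * q + (- \<beta>) * cnj q = g q - (\<alpha> * q + \<beta> * cnj q)" by (simp add: g' algebra_simps)
    then have "\<gamma> - \<alpha> = 0 \<and> - \<beta> = 0" using q(3)[OF Kd[OF \<gamma>(1) \<alpha>K] K(2)[OF \<beta>K] *] by blast
    then show ?thesis using g' by (auto simp: B)
  next
    assume g': "g = (\<lambda>z. \<gamma> * cnj z)"
    have "(- \<alpha>) * q + (\<gamma> - \<beta>) * cnj q = g q - (\<alpha> * q + \<beta> * cnj q)" by (simp add: g' algebra_simps)
    then have "- \<alpha> = 0 \<and> \<gamma> - \<beta> = 0" using q(3)[OF K(2)[OF \<alpha>K] Kd[OF \<gamma>(1) \<beta>K] *] by blast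
    then show ?thesis using g' by (auto simp: B)
  qed
  then have "L (g w) = A *v L w" for w
    unfolding L_def B_def[symmetric] using M.L_pull[of A w] by (simp add: B_def)
  then show ?thesis using g(1) by blast
qed

section \<open>Generic points\<close>

text \<open>Terms in the field operations over countably many generators. There are only countably
  many of them, and their values are closed under these operations.\<close>

datatype field_term =
    Gen nat
  | Add field_term field_term
  | Neg field_term
  | Mul field_term field_term
  | Inv field_term

instance field_term :: countable
  by countable_datatype

primrec field_value :: "(nat \<Rightarrow> complex) \<Rightarrow> field_term \<Rightarrow> complex" where
  "field_value c (Gen n) = c n"
| "field_value c (Add s t) = field_value c s + field_value c t"
| "field_value c (Neg s) = - field_value c s"
| "field_value c (Mul s t) = field_value c s * field_value c t"
| "field_value c (Inv s) = inverse (field_value c s)"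

lemma countable_subfield:
  fixes S :: "complex set"
  assumes "countable S" "S \<noteq> {}"
  obtains K where "countable K" "S \<subseteq> K" "\<And>x y. x \<in> K \<Longrightarrow> y \<in> K \<Longrightarrow> x + y \<in> K"
    "\<And>x. x \<in> K \<Longrightarrow> - x \<in> K" "\<And>x y. x \<in> K \<Longrightarrow> y \<in> K \<Longrightarrow> x * y \<in> K" "\<And>x. x \<in> K \<Longrightarrow> inverse x \<in> K"
proof (rule that[of "range (field_value (from_nat_into S))"])
  let ?v = "field_value (from_nat_into S)"
  show "S \<subseteq> range ?v"
  proof
    fix x assume "x \<in> S"
    then obtain n where "from_nat_into S n = x" using from_nat_into_surj[OF assms(1)] by blast
    then have "?v (Gen n) = x" by simp
    then show "x \<in> range ?v" by blast
  qed
  show "x + y \<in> range ?v" if "x \<in> range ?v" "y \<in> range ?v" for x y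
    using that field_value.simps(2)[symmetric] by blast
  show "- x \<in> range ?v" if "x \<in> range ?v" for x
    using that field_value.simps(3)[symmetric] by blast
  show "x * y \<in> range ?v" if "x \<in> range ?v" "y \<in> range ?v" for x y
    using that field_value.simps(4)[symmetric] by blast
  show "inverse x \<in> range ?v" if "x \<in> range ?v" for x
    using that field_value.simps(5)[symmetric] by blast
qed auto

text \<open>As \<open>K\<close> contains \<open>\<i>\<close>, the relation reads \<open>(\<alpha> +
  \<beta>) * x + \<i> * (\<alpha> - \<beta>) * y = \<gamma>\<close> in the real coordinates of
  \<open>q\<close>. First \<open>x\<close> is chosen outside \<open>K\<close>, then \<open>y\<close>
  outside the countable set of solutions for this \<open>x\<close>; so the coefficient of
  \<open>y\<close> vanishes, and after it that of \<open>x\<close>. The bound 1/2 keeps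
  \<open>q\<close> in the unit disc, hence inside the polygon.\<close>

lemma generic_point:
  fixes K :: "complex set"
  assumes cK: "countable K" and K: "\<i> \<in> K" "\<And>x y. x \<in> K \<Longrightarrow> y \<in> K \<Longrightarrow> x + y \<in> K"
    "\<And>x. x \<in> K \<Longrightarrow> - x \<in> K" "\<And>x y. x \<in> K \<Longrightarrow> y \<in> K \<Longrightarrow> x * y \<in> K" "\<And>x. x \<in> K \<Longrightarrow> inverse x \<in> K"
  obtains q where "norm q < 1"
    "\<And>\<alpha> \<beta> \<gamma>. \<alpha> \<in> K \<Longrightarrow> \<beta> \<in> K \<Longrightarrow> \<gamma> \<in> K \<Longrightarrow> \<alpha> * q + \<beta> * cnj q = \<gamma> \<Longrightarrow> \<alpha> = 0 \<and> \<beta> = 0"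
proof -
  have pick: "\<exists>x::real. 0 < x \<and> x < 1 / 2 \<and> of_real x \<notin> S" if "countable S" for S :: "complex set"
  proof (rule ccontr)
    assume "\<not> ?thesis"
    then have "{0<..<1/2} \<subseteq> Re ` S" by (force simp: image_iff)
    then have "countable {0<..<1/2::real}" using that by (meson countable_image countable_subset)
    then show False using uncountable_open_interval[of 0 "1/2::real"] by simp
  qed
  obtain x :: real where x: "0 < x" "x < 1 / 2" "of_real x \<notin> K" using pick[OF cK] by blast
  define S where "S = (\<lambda>(a, b, c). (c - a * of_real x) * inverse b) ` (K \<times> K \<times> K)"
  have "countable S" unfolding S_def using cK by auto
  then obtain y :: real where y: "0 < y" "y < 1 / 2" "of_real y \<notin> S" using pick by blast
  define q where "q = Complex x y"
  have q: "q = of_real x + \<i> * of_real y" by (simp add: q_def complex_eq_iff)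
  show thesis
  proof (rule that[of q])
    have "norm q \<le> \<bar>x\<bar> + \<bar>y\<bar>" using cmod_le[of q] by (simp add: q_def)
    then show "norm q < 1" using x y by simp
  next
    fix \<alpha> \<beta> \<gamma> assume h: "\<alpha> \<in> K" "\<beta> \<in> K" "\<gamma> \<in> K" "\<alpha> * q + \<beta> * cnj q = \<gamma>"
    define d where "d = \<i> * (\<alpha> + - \<beta>)"
    have e: "(\<alpha> + \<beta>) * of_real x + d * of_real y = \<gamma>"
      unfolding d_def h(4)[symmetric] q by (simp add: algebra_simps)
    have dK: "d \<in> K" "\<alpha> + \<beta> \<in> K"
      unfolding d_def by (rule K(4)[OF K(1) K(2)[OF h(1) K(3)[OF h(2)]]] K(2)[OF h(1,2)])+
    have "d = 0"
    proof (rule ccontr)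
      assume "d \<noteq> 0"
      then have "of_real y = (\<gamma> - (\<alpha> + \<beta>) * of_real x) * inverse d"
        using e by (simp add: field_simps)
      then show False using y(3) dK h(3) unfolding S_def by force
    qed
    then have e': "(\<alpha> + \<beta>) * of_real x = \<gamma>" using e by simp
    have "\<alpha> + \<beta> = 0"
    proof (rule ccontr)
      assume "\<alpha> + \<beta> \<noteq> 0"
      then have "of_real x = \<gamma> * inverse (\<alpha> + \<beta>)" using e' by (simp add: field_simps)
      then show False using x(3) K(4)[OF h(3) K(5)[OF dK(2)]] by simp
    qed
    moreover have "\<alpha> = \<beta>" using \<open>d = 0\<close> by (simp add: d_def)
    ultimately show "\<alpha> = 0 \<and> \<beta> = 0" by simp
  qed
qed

text \<open>Each point goes to a chosen element of its class. Equivalent points have equal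
  predicates \<open>glued N x\<close>, so the choice is the same for both; \<open>\<iota>\<close>
  carries it into the type of points.\<close>

lemma glued_quotient_map:
  fixes \<iota> :: "complex \<Rightarrow> 'a"
  assumes N: "N > 0" "even N" and \<iota>: "inj \<iota>"
  obtains pr :: "complex \<Rightarrow> 'a" where "\<And>x y. x \<in> ngon N \<Longrightarrow> y \<in> ngon N \<Longrightarrow> pr x = pr y \<longleftrightarrow> glued N x y"
proof (rule that[of "\<lambda>x. \<iota> (SOME w. glued N x w)"])
  fix x y assume x: "x \<in> ngon N" and y: "y \<in> ngon N"
  define r where "r x = (SOME w. glued N x w)" for x
  have r: "glued N x (r x)" for x
    unfolding r_def by (rule someI[of _ x]) (rule glued_refl)
  have "r x = r y \<longleftrightarrow> glued N x y"
  proof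
    assume e: "r x = r y"
    have "r x \<in> ngon N" using glued_ngon[OF N r x] .
    then show "glued N x y" using glued_trans[OF N r[of x]] glued_sym[OF N r[of y]] e by metis
  next
    assume g: "glued N x y"
    have "glued N x = glued N y"
      using glued_trans[OF N g _ y] glued_trans[OF N glued_sym[OF N g] _ x] by blast
    then show "r x = r y" by (simp add: r_def)
  qed
  then show "(\<iota> (SOME w. glued N x w) = \<iota> (SOME w. glued N y w)) = glued N x y"
    using \<iota> by (simp add: r_def inj_eq)
qed

section \<open>Finite groups of linear maps\<close>

text \<open>The images of \<open>1\<close> and \<open>\<i>\<close> are orthonormal, so the second is
  \<open>\<i>\<close> or \<open>- \<i>\<close> times the first.\<close>

lemma complex_isometry_cases:
  fixes R :: "complex \<Rightarrow> complex"
  assumes lin: "linear R" and norm: "\<And>w. norm (R w) = norm w"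
  shows "\<exists>\<gamma>. norm \<gamma> = 1 \<and> ((\<forall>w. R w = \<gamma> * w) \<or> (\<forall>w. R w = \<gamma> * cnj w))"
proof -
  define u v where "u = R 1" and "v = R \<i>"
  have nu: "norm u = 1" "norm v = 1" by (simp_all add: u_def v_def norm)
  \<comment> \<open>The norm of \<open>u + v\<close> yields the inner product of \<open>u\<close>
    and \<open>v\<close> by polarization.\<close>
  have "(norm (u + v))\<^sup>2 = (norm (1 + \<i>))\<^sup>2"
    using norm[of "1 + \<i>"] linear_add[OF lin] by (simp add: u_def v_def)
  also have "(norm (1 + \<i>))\<^sup>2 = 2" by (simp add: cmod_power2)
  finally have "inner u v = 0"
    using nu by (simp add: power2_norm_eq_inner inner_add_left inner_add_right inner_commute
        flip: norm_eq_1) (simp add: norm_eq_1)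
  then have re: "Re (v * cnj u) = 0" by (simp add: inner_complex_def mult.commute)
  have "norm (v * cnj u) = 1" using nu by (simp add: norm_mult)
  then have "\<bar>Im (v * cnj u)\<bar> = 1" using re by (simp add: cmod_def abs_square_eq_1)
  then have "v * cnj u = \<i> \<or> v * cnj u = - \<i>"
    using re by (auto simp: complex_eq_iff abs_if split: if_splits)
  moreover have uu: "cnj u * u = 1" using nu by (simp add: mult.commute[of "cnj u"] complex_norm_square[symmetric])
  have "v = (v * cnj u) * u" using uu by (simp add: mult.assoc)
  ultimately have v: "v = \<i> * u \<or> v = - \<i> * u" by metis
  have Rw: "R w = Re w *\<^sub>R u + Im w *\<^sub>R v" for w
  proof -
    have "w = Re w *\<^sub>R 1 + Im w *\<^sub>R \<i>" by (simp add: complex_eq_iff)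
    then show ?thesis
      using linear_add[OF lin] linear_scale[OF lin] unfolding u_def v_def by metis
  qed
  from v have "(\<forall>w. R w = u * w) \<or> (\<forall>w. R w = u * cnj w)"
    by (auto simp: Rw complex_eq_iff algebra_simps)
  then show ?thesis using nu by blast
qed

text \<open>Multiplication by \<open>\<gamma>\<close> permutes the set, so it leaves the product of
  all elements unchanged; cancelling this product gives the claim.\<close>

lemma finite_rotations_root_of_unity:
  fixes \<Gamma> :: "complex set"
  assumes "finite \<Gamma>" "0 \<notin> \<Gamma>" "\<And>x y. x \<in> \<Gamma> \<Longrightarrow> y \<in> \<Gamma> \<Longrightarrow> x * y \<in> \<Gamma>" "\<gamma> \<in> \<Gamma>"
  shows "\<gamma> ^ card \<Gamma> = 1"
proof -
  have \<gamma>: "\<gamma> \<noteq> 0" using assms by auto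
  have inj: "inj_on ((*) \<gamma>) \<Gamma>" using \<gamma> by (auto simp: inj_on_def)
  have "(*) \<gamma> ` \<Gamma> = \<Gamma>" by (rule endo_inj_surj[OF assms(1) _ inj]) (use assms in auto)
  then have "prod id \<Gamma> = prod id ((*) \<gamma> ` \<Gamma>)" by simp
  also have "\<dots> = prod ((*) \<gamma>) \<Gamma>" using prod.reindex[OF inj, of id] by (simp add: o_def)
  also have "\<dots> = \<gamma> ^ card \<Gamma> * prod id \<Gamma>" by (simp add: prod.distrib)
  finally have "\<gamma> ^ card \<Gamma> * prod id \<Gamma> = 1 * prod id \<Gamma>" by simp
  moreover have "prod id \<Gamma> \<noteq> 0" using assms(1,2) by auto
  ultimately show ?thesis by (metis mult_right_cancel)
qed

text \<open>The sum \<open>Q\<close> of the squared norm over the group is an invariant positive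
  definite form. A linear change of coordinates makes it the standard form, so that the group acts
  by rotations and reflections; a final rotation of the coordinate aligns the reflections with the
  complex conjugation.\<close>

lemma finite_subgroup_normal_form:
  assumes G: "subgroup G GL2" and fin: "finite G"
  obtains a b n where "n > (0::nat)" "norm b < norm (a::complex)"
    "\<And>A. A \<in> G \<Longrightarrow> \<exists>\<gamma>. \<gamma> ^ n = 1 \<and>
      ((\<forall>w. plane (skew a b (\<gamma> * w)) = A *v plane (skew a b w)) \<or>
       (\<forall>w. plane (skew a b (\<gamma> * cnj w)) = A *v plane (skew a b w)))"
proof -
  have inv: "invertible A" if "A \<in> G" for A
    using subgroup.subset[OF G] that by (auto simp: GL2_def)
  have mult: "A ** B \<in> G" if "A \<in> G" "B \<in> G" for A B
    using subgroup.m_closed[OF G that] by (simp add: GL2_def)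
  have one: "mat 1 \<in> G" using subgroup.one_closed[OF G] by (simp add: GL2_def)
  define act where "act A z = unplane (A *v plane z)" for A z
  have lin_act: "linear (act A)" for A
    using linear_compose[OF linear_compose[OF linear_plane(1) matrix_vector_mul_linear[of A]] linear_plane(2)]
    by (simp add: act_def[abs_def] o_def)
  have act_mult: "act (A ** B) z = act A (act B z)" for A B z
    by (simp add: act_def matrix_vector_mul_assoc)
  have act_1: "act (mat 1) z = z" for z by (simp add: act_def)
  define Q where "Q z = (\<Sum>A\<in>G. (norm (act A z))\<^sup>2)" for z
  have Q_act: "Q (act B z) = Q z" if B: "B \<in> G" for B z
  proof -
    obtain B' where B': "B ** B' = mat 1" using inv[OF B] unfolding invertible_def by blast
    have inj: "inj_on (\<lambda>A. A ** B) G"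
    proof (rule inj_onI)
      fix A A' assume "A ** B = A' ** B"
      then have "A ** B ** B' = A' ** B ** B'" by simp
      then show "A = A'" by (simp add: matrix_mul_assoc[symmetric] B')
    qed
    have im: "(\<lambda>A. A ** B) ` G = G" by (rule endo_inj_surj[OF fin _ inj]) (use mult B in auto)
    have "Q (act B z) = (\<Sum>A\<in>G. (norm (act (A ** B) z))\<^sup>2)" by (simp add: Q_def act_mult)
    also have "\<dots> = (\<Sum>A\<in>(\<lambda>A. A ** B) ` G. (norm (act A z))\<^sup>2)"
      using sum.reindex[OF inj, of "\<lambda>A. (norm (act A z))\<^sup>2"] by (simp add: o_def)
    finally show ?thesis unfolding im Q_def .
  qed
  have Q_ge: "Q z \<ge> (norm z)\<^sup>2" for z
  proof -
    have "(norm (act (mat 1) z))\<^sup>2 \<le> Q z"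
      unfolding Q_def by (rule member_le_sum[OF one _ fin]) simp
    then show ?thesis by (simp add: act_1)
  qed
  define p s f where "p = Q 1" and "s = Q \<i>" and "f = (\<Sum>A\<in>G. inner (act A 1) (act A \<i>))"
  have Q_eq: "Q z = (Re z)\<^sup>2 * p + 2 * Re z * Im z * f + (Im z)\<^sup>2 * s" for z
  proof -
    have "act A z = Re z *\<^sub>R act A 1 + Im z *\<^sub>R act A \<i>" for A
    proof -
      have "z = Re z *\<^sub>R 1 + Im z *\<^sub>R \<i>" by (simp add: complex_eq_iff)
      then show ?thesis using linear_add[OF lin_act] linear_scale[OF lin_act] by metis
    qed
    then have "(norm (act A z))\<^sup>2 = (Re z)\<^sup>2 * (norm (act A 1))\<^sup>2 +
        2 * Re z * Im z * inner (act A 1) (act A \<i>) + (Im z)\<^sup>2 * (norm (act A \<i>))\<^sup>2" for A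
      unfolding power2_norm_eq_inner
      by (simp add: inner_add_left inner_add_right inner_commute power2_eq_square algebra_simps)
    then show ?thesis
      unfolding Q_def p_def s_def f_def by (simp add: sum.distrib sum_distrib_left)
  qed
  have p: "p \<ge> 1" using Q_ge[of 1] by (simp add: p_def)
  \<comment> \<open>At \<open>Complex (- f) p\<close> the form takes the value \<open>p\<close>
    times its determinant, so positivity of the form makes the determinant positive.\<close>
  have disc: "s - f\<^sup>2 / p > 0"
  proof -
    have "Q (Complex (- f) p) = p * (p * s - f\<^sup>2)"
      unfolding Q_eq by (simp add: power2_eq_square algebra_simps)
    moreover have "Q (Complex (- f) p) > 0"
    proof -
      have "(norm (Complex (- f) p))\<^sup>2 > 0" using p by (simp add: complex_eq_iff)
      then show ?thesis using Q_ge[of "Complex (- f) p"] by linarith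
    qed
    ultimately have "p * s - f\<^sup>2 > 0" using p by (simp add: zero_less_mult_iff)
    then show ?thesis using p by (simp add: field_simps)
  qed
  define e t where "e = sqrt p" and "t = sqrt (s - f\<^sup>2 / p)"
  have et: "e > 0" "t > 0" "e\<^sup>2 = p" "t\<^sup>2 = s - f\<^sup>2 / p" using p disc by (auto simp: e_def t_def)
  \<comment> \<open>The Cholesky factor of the form, that is the matrix with rows
    \<open>(e, f / e)\<close> and \<open>(0, t)\<close>, written as a skew map. Its determinant
    \<open>e * t\<close> is positive, whence \<open>norm \<beta> < norm \<alpha>\<close>.\<close>
  define \<alpha> \<beta> where "\<alpha> = Complex ((e + t) / 2) (- f / e / 2)" and "\<beta> = Complex ((e - t) / 2) (f / e / 2)"
  have M_eq: "skew \<alpha> \<beta> z = Complex (e * Re z + f / e * Im z) (t * Im z)" for z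
    by (simp add: skew_def \<alpha>_def \<beta>_def complex_eq_iff field_simps)
  have norm_M: "(norm (skew \<alpha> \<beta> z))\<^sup>2 = Q z" for z
  proof -
    have "(norm (skew \<alpha> \<beta> z))\<^sup>2 = (e * Re z + f / e * Im z)\<^sup>2 + (t * Im z)\<^sup>2"
      unfolding M_eq by (simp add: cmod_power2)
    also have "\<dots> = (Re z)\<^sup>2 * e\<^sup>2 + 2 * Re z * Im z * f + (Im z)\<^sup>2 * (f\<^sup>2 / e\<^sup>2 + t\<^sup>2)"
      using et(1) by (simp add: power2_eq_square field_simps)
    finally show ?thesis unfolding Q_eq et(3,4) by simp
  qed
  have ab: "norm \<beta> < norm \<alpha>"
  proof -
    have "(norm \<beta>)\<^sup>2 < (norm \<alpha>)\<^sup>2"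
      using mult_pos_pos[OF et(1,2)] unfolding \<alpha>_def \<beta>_def cmod_power2
      by (simp add: power2_eq_square field_simps)
    then show ?thesis by (simp add: power2_less_imp_less)
  qed
  define R where "R A w = skew \<alpha> \<beta> (act A (skew_inv \<alpha> \<beta> w))" for A w
  have R_mult: "R (A ** B) w = R A (R B w)" for A B w
    by (simp add: R_def act_mult skew_skew_inv[OF ab])
  have R_1: "R (mat 1) w = w" for w
    by (simp add: R_def act_1 skew_skew_inv[OF ab])
  have act_R: "act A (skew_inv \<alpha> \<beta> w) = skew_inv \<alpha> \<beta> (R A w)" for A w
    by (simp add: R_def skew_skew_inv[OF ab])
  have R: "\<exists>\<gamma>. norm \<gamma> = 1 \<and> ((\<forall>w. R A w = \<gamma> * w) \<or> (\<forall>w. R A w = \<gamma> * cnj w))" if A: "A \<in> G" for A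
  proof (rule complex_isometry_cases)
    show "linear (R A)"
      using linear_compose[OF linear_compose[OF linear_skew_inv lin_act] linear_skew]
      by (simp add: R_def[abs_def] o_def)
    show "norm (R A w) = norm w" for w
    proof -
      have "(norm (R A w))\<^sup>2 = (norm (skew \<alpha> \<beta> (skew_inv \<alpha> \<beta> w)))\<^sup>2"
        unfolding R_def norm_M Q_act[OF A] ..
      then show ?thesis by (simp add: skew_skew_inv[OF ab])
    qed
  qed
  define \<Gamma> where "\<Gamma> = {\<gamma>. \<exists>A\<in>G. \<forall>w. R A w = \<gamma> * w}"
  have "\<Gamma> \<subseteq> (\<lambda>A. R A 1) ` G"
  proof
    fix \<gamma> assume "\<gamma> \<in> \<Gamma>"
    then obtain A where "A \<in> G" "\<forall>w. R A w = \<gamma> * w" unfolding \<Gamma>_def by blast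
    then show "\<gamma> \<in> (\<lambda>A. R A 1) ` G" by (intro image_eqI[of _ _ A]) simp_all
  qed
  then have fin\<Gamma>: "finite \<Gamma>" using fin finite_surj by blast
  have mult\<Gamma>: "x * y \<in> \<Gamma>" if xy: "x \<in> \<Gamma>" "y \<in> \<Gamma>" for x y
  proof -
    obtain A B where "A \<in> G" "B \<in> G" "\<forall>w. R A w = x * w" "\<forall>w. R B w = y * w"
      using xy by (auto simp: \<Gamma>_def)
    then have "A ** B \<in> G" "\<forall>w. R (A ** B) w = x * y * w" using mult by (auto simp: R_mult)
    then show ?thesis by (auto simp: \<Gamma>_def)
  qed
  have one\<Gamma>: "1 \<in> \<Gamma>" using one R_1 by (auto simp: \<Gamma>_def)
  have "0 \<notin> \<Gamma>"
  proof
    assume "0 \<in> \<Gamma>"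
    then obtain A where "A \<in> G" "\<forall>w. R A w = 0" by (auto simp: \<Gamma>_def)
    then show False using R[of A] by (metis mult_eq_0_iff norm_zero zero_neq_one complex_cnj_one)
  qed
  note pow = finite_rotations_root_of_unity[OF fin\<Gamma> this mult\<Gamma>]
  have n0: "card \<Gamma> > 0" using fin\<Gamma> one\<Gamma> by (auto simp: card_gt_0_iff)
  text \<open>Rotating the coordinate makes one of the reflections, if there is any, the complex conjugation.\<close>
  obtain \<sigma> where \<sigma>: "norm \<sigma> = 1" "\<And>A c. A \<in> G \<Longrightarrow> \<forall>w. R A w = c * cnj w \<Longrightarrow> c * cnj \<sigma> * cnj \<sigma> \<in> \<Gamma>"
  proof (cases "\<exists>A\<in>G. \<exists>c. \<forall>w. R A w = c * cnj w")
    case True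
    then obtain B c where B: "B \<in> G" "\<forall>w. R B w = c * cnj w" by blast
    have "norm c = 1" using R[OF B(1)] B(2) by (metis complex_cnj_one mult.right_neutral)
    show thesis
    \<comment> \<open>A square root of \<open>c\<close> as new unit turns the reflection
      \<open>B\<close> into the conjugation. For any reflection \<open>A\<close> with factor
      \<open>c'\<close>, the product \<open>A ** B\<close> is the rotation by
      \<open>c' * cnj c\<close>, which gives membership in \<open>\<Gamma>\<close>.\<close>
    proof (rule that[of "csqrt c"])
      have "norm (csqrt c) ^ 2 = 1" using \<open>norm c = 1\<close> by (simp flip: norm_power)
      then show "norm (csqrt c) = 1" by (simp add: power2_eq_1_iff)
      fix A c' assume A: "A \<in> G" "\<forall>w. R A w = c' * cnj w"
      have "cnj (csqrt c) * cnj (csqrt c) = cnj c"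
        by (metis complex_cnj_mult power2_csqrt power2_eq_square)
      then have "R (A ** B) w = c' * cnj (csqrt c) * cnj (csqrt c) * w" for w
        using A B by (simp add: R_mult mult.assoc)
      then show "c' * cnj (csqrt c) * cnj (csqrt c) \<in> \<Gamma>"
        using mult[OF A(1) B(1)] by (auto simp: \<Gamma>_def)
    qed
  next
    case False
    then show thesis by (intro that[of 1]) auto
  qed
  have \<sigma>\<sigma>: "\<sigma> * cnj \<sigma> = 1" using \<sigma>(1) by (simp add: complex_norm_square[symmetric])
  define D where "D = \<alpha> * cnj \<alpha> - \<beta> * cnj \<beta>"
  have D: "D \<noteq> 0" unfolding D_def by (rule skew_det[OF ab])
  \<comment> \<open>These are the coefficients of the inverse of
    \<open>skew \<alpha> \<beta>\<close> after multiplication by \<open>\<sigma>\<close>.\<close>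
  define a b where "a = cnj \<alpha> * \<sigma> / D" and "b = - (\<beta> * cnj \<sigma>) / D"
  have skew_ab: "skew a b w = skew_inv \<alpha> \<beta> (\<sigma> * w)" for w
    by (simp add: skew_def skew_inv_def a_def b_def D_def[symmetric] diff_divide_distrib mult.assoc)
  have act_eq: "A *v plane (skew a b w) = plane (skew_inv \<alpha> \<beta> (R A (\<sigma> * w)))" for A w
    unfolding skew_ab act_R[symmetric] by (simp add: act_def)
  show thesis
  proof (rule that[of "card \<Gamma>" b a, OF n0])
    show "norm b < norm a"
      using ab \<sigma>(1) D by (simp add: a_def b_def norm_divide norm_mult divide_strict_right_mono)
    fix A assume A: "A \<in> G"
    obtain \<gamma> where "(\<forall>w. R A w = \<gamma> * w) \<or> (\<forall>w. R A w = \<gamma> * cnj w)" using R[OF A] by blast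
    then show "\<exists>\<gamma>. \<gamma> ^ card \<Gamma> = 1 \<and>
      ((\<forall>w. plane (skew a b (\<gamma> * w)) = A *v plane (skew a b w)) \<or>
       (\<forall>w. plane (skew a b (\<gamma> * cnj w)) = A *v plane (skew a b w)))"
    proof
      assume 1: "\<forall>w. R A w = \<gamma> * w"
      then have "\<gamma> \<in> \<Gamma>" using A by (auto simp: \<Gamma>_def)
      moreover have "\<forall>w. plane (skew a b (\<gamma> * w)) = A *v plane (skew a b w)"
        unfolding act_eq unfolding skew_ab using 1 by (simp add: mult_ac)
      ultimately show ?thesis using pow by blast
    next
      assume 2: "\<forall>w. R A w = \<gamma> * cnj w"
      define \<delta> where "\<delta> = \<gamma> * cnj \<sigma> * cnj \<sigma>"
      have "\<delta> \<in> \<Gamma>" unfolding \<delta>_def by (rule \<sigma>(2)[OF A 2])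
      moreover have "\<forall>w. plane (skew a b (\<delta> * cnj w)) = A *v plane (skew a b w)"
      proof
        fix w
        have "\<sigma> * (\<delta> * cnj w) = (\<sigma> * cnj \<sigma>) * (\<gamma> * cnj (\<sigma> * w))" by (simp add: \<delta>_def mult_ac)
        then have "\<sigma> * (\<delta> * cnj w) = R A (\<sigma> * w)" using 2 by (simp only: \<sigma>\<sigma> mult_1)
        then show "plane (skew a b (\<delta> * cnj w)) = A *v plane (skew a b w)"
          unfolding act_eq unfolding skew_ab by (simp only:)
      qed
      ultimately show ?thesis using pow by blast
    qed
  qed
qed

section \<open>The theorem\<close>

theorem theorem1:
  fixes G :: "(real^2^2) set"
  assumes "subgroup G GL2" and "finite G"
  shows "\<exists>T :: (nat \<times> (real^2)) flat_surface. translation_surface T \<and> veech_group T = G"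
proof -
  obtain a b :: complex and n :: nat where n: "n > 0" and ab: "norm b < norm a"
    and nf: "\<And>A. A \<in> G \<Longrightarrow> \<exists>\<gamma>. \<gamma> ^ n = 1 \<and>
      ((\<forall>w. plane (skew a b (\<gamma> * w)) = A *v plane (skew a b w)) \<or>
       (\<forall>w. plane (skew a b (\<gamma> * cnj w)) = A *v plane (skew a b w)))"
    by (rule finite_subgroup_normal_form[OF assms]) (rule that)
  define k where "k = 4 * n - 1"
  have k: "odd k" "k \<ge> 3" "2 * k + 2 = 8 * n" using n by (auto simp: k_def)
  have "inj (\<lambda>z. (0::nat, plane z))" by (rule injI) (metis plane_unplane(2) prod.inject)
  then obtain pr :: "complex \<Rightarrow> nat \<times> (real^2)" where pr:
    "\<And>x y. x \<in> ngon (2 * k + 2) \<Longrightarrow> y \<in> ngon (2 * k + 2) \<Longrightarrow> pr x = pr y \<longleftrightarrow> glued (2 * k + 2) x y"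
    using glued_quotient_map[of "2 * k + 2" "\<lambda>z. (0::nat, plane z)"] by auto
  interpret S: glued_ngon k pr by unfold_locales (use k pr in auto)
  have roots_n: "\<gamma> \<in> roots S.N" if "\<gamma> ^ n = 1" for \<gamma>
    unfolding roots_def S.N_def k(3) using that by (simp add: mult.commute[of 8] power_mult)
  obtain K where K: "countable K" "insert \<i> (insert S.\<tau> (insert (cnj S.\<tau>) (roots S.N))) \<subseteq> K"
    "\<And>x y. x \<in> K \<Longrightarrow> y \<in> K \<Longrightarrow> x + y \<in> K" "\<And>x. x \<in> K \<Longrightarrow> - x \<in> K"
    "\<And>x y. x \<in> K \<Longrightarrow> y \<in> K \<Longrightarrow> x * y \<in> K" "\<And>x. x \<in> K \<Longrightarrow> inverse x \<in> K"
    using countable_subfield[of "insert \<i> (insert S.\<tau> (insert (cnj S.\<tau>) (roots S.N)))"]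
      finite_roots[OF S.N(1)] by (auto simp: countable_finite)
  have "\<i> \<in> K" using K(2) by simp
  then obtain q where q: "norm q < 1"
    "\<And>\<alpha> \<beta> \<gamma>. \<alpha> \<in> K \<Longrightarrow> \<beta> \<in> K \<Longrightarrow> \<gamma> \<in> K \<Longrightarrow> \<alpha> * q + \<beta> * cnj q = \<gamma> \<Longrightarrow> \<alpha> = 0 \<and> \<beta> = 0"
    using generic_point[OF K(1) _ K(3-6)] by blast
  have q_strict: "inner u q < 1" if "u \<in> roots S.N" for u
    using Cauchy_Schwarz_ineq2[of u q] norm_roots[OF S.N(1) that] q(1) by simp
  then have qP: "q \<in> S.P" unfolding S.P_def ngon_def by (simp add: less_imp_le)
  define lin where "lin w = plane (skew a b w)" for w
  define dih where "dih g \<longleftrightarrow> (\<exists>\<gamma>\<in>roots S.N. g = (\<lambda>z. \<gamma> * z) \<or> g = (\<lambda>z. \<gamma> * cnj z))" for g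
  \<comment> \<open>The group \<open>G\<close> transported to the polygon. As \<open>lin\<close> is
    bijective, a matrix in \<open>G\<close> and the map in \<open>\<G>\<close> belonging to it
    determine each other.\<close>
  define \<G> where "\<G> = {g. dih g \<and> (\<exists>A\<in>G. \<forall>w. lin (g w) = A *v lin w)}"
  have lin_inj: "v = w" if "lin v = lin w" for v w
    using that unfolding lin_def by (metis plane_unplane(2) skew_skew_inv(2)[OF ab])
  have lin_surj: "\<exists>w. v = lin w" for v
    unfolding lin_def by (metis plane_unplane(1) skew_skew_inv(1)[OF ab])
  have mult: "A ** B \<in> G" if "A \<in> G" "B \<in> G" for A B
    using subgroup.m_closed[OF assms(1) that] by (simp add: GL2_def)
  have one: "mat 1 \<in> G" using subgroup.one_closed[OF assms(1)] by (simp add: GL2_def)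
  have ex_\<G>: "\<exists>g\<in>\<G>. \<forall>w. lin (g w) = A *v lin w" if A: "A \<in> G" for A
  proof -
    obtain \<gamma> where "\<gamma> ^ n = 1" "(\<forall>w. lin (\<gamma> * w) = A *v lin w) \<or> (\<forall>w. lin (\<gamma> * cnj w) = A *v lin w)"
      using nf[OF A] unfolding lin_def by blast
    moreover define g where "g = (if \<forall>w. lin (\<gamma> * w) = A *v lin w then (\<lambda>z. \<gamma> * z) else (\<lambda>z. \<gamma> * cnj z))"
    ultimately have "\<forall>w. lin (g w) = A *v lin w" "dih g"
      using roots_n[of \<gamma>] by (auto simp: dih_def)
    then show ?thesis using A unfolding \<G>_def by blast
  qed
  have id: "id \<in> \<G>"
    unfolding \<G>_def dih_def using roots_1 one by (auto intro!: bexI[of _ 1] bexI[of _ "mat 1"])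
  have dih_comp: "dih (g \<circ> h)" if gh: "dih g" "dih h" for g h
  proof -
    obtain x where x: "x \<in> roots S.N" "g = (\<lambda>z. x * z) \<or> g = (\<lambda>z. x * cnj z)"
      using gh(1) unfolding dih_def by blast
    obtain y where y: "y \<in> roots S.N" "h = (\<lambda>z. y * z) \<or> h = (\<lambda>z. y * cnj z)"
      using gh(2) unfolding dih_def by blast
    have "x * y \<in> roots S.N" "x * cnj y \<in> roots S.N" using x y by (auto intro: roots_mult roots_cnj)
    moreover have "g \<circ> h = (\<lambda>z. x * y * z) \<or> g \<circ> h = (\<lambda>z. x * y * cnj z) \<or>
        g \<circ> h = (\<lambda>z. x * cnj y * z) \<or> g \<circ> h = (\<lambda>z. x * cnj y * cnj z)"
      using x(2) y(2) by (auto simp: fun_eq_iff mult.assoc)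
    ultimately show ?thesis unfolding dih_def by blast
  qed
  have comp: "g \<circ> h \<in> \<G>" if gh: "g \<in> \<G>" "h \<in> \<G>" for g h
  proof -
    obtain A B where AB: "A \<in> G" "\<forall>w. lin (g w) = A *v lin w" "B \<in> G" "\<forall>w. lin (h w) = B *v lin w"
      using gh unfolding \<G>_def by blast
    then have "\<forall>w. lin ((g \<circ> h) w) = (A ** B) *v lin w" by (simp add: matrix_vector_mul_assoc)
    then show ?thesis using mult[OF AB(1,3)] dih_comp gh unfolding \<G>_def by blast
  qed
  have "\<G> \<subseteq> (\<lambda>A w. skew_inv a b (unplane (A *v lin w))) ` G"
  proof
    fix g assume "g \<in> \<G>"
    then obtain A where A: "A \<in> G" "\<And>w. lin (g w) = A *v lin w" unfolding \<G>_def by blast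
    have "g = (\<lambda>w. skew_inv a b (unplane (A *v lin w)))"
      unfolding A(2)[symmetric] by (simp add: lin_def skew_skew_inv[OF ab])
    then show "g \<in> (\<lambda>A w. skew_inv a b (unplane (A *v lin w))) ` G" using A(1) by blast
  qed
  then have fin_\<G>: "finite \<G>" using assms(2) finite_surj by blast
  have dih_inj: "inj g" if "dih g" for g
    using that roots_nonzero[OF S.N(1)] unfolding dih_def inj_def by auto
  \<comment> \<open>Composition with \<open>g\<close> permutes a finite set. This yields inverses in
    \<open>\<G>\<close>, and later that \<open>g\<close> permutes the marked orbit of
    \<open>q\<close>.\<close>
  have comp_surj: "(\<lambda>h. g \<circ> h) ` \<G> = \<G>" if g: "g \<in> \<G>" for g
  proof (rule endo_inj_surj[OF fin_\<G>])
    show "(\<lambda>h. g \<circ> h) ` \<G> \<subseteq> \<G>" using comp[OF g] by blast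
    have "inj g" using dih_inj g unfolding \<G>_def by blast
    show "inj_on (\<lambda>h. g \<circ> h) \<G>"
    proof (rule inj_onI)
      fix h h' assume "g \<circ> h = g \<circ> h'"
      then have "g (h x) = g (h' x)" for x by (metis comp_apply)
      then show "h = h'" using injD[OF \<open>inj g\<close>] by blast
    qed
  qed
  have inverse: "\<exists>h\<in>\<G>. (\<forall>x. h (g x) = x) \<and> (\<forall>x. g (h x) = x)" if g: "g \<in> \<G>" for g
  proof -
    have "id \<in> (\<lambda>h. g \<circ> h) ` \<G>" using id comp_surj[OF g] by simp
    then obtain h where h: "h \<in> \<G>" "id = g \<circ> h" by blast
    then have gh: "g (h x) = x" for x by (metis comp_apply id_apply)
    have "inj g" using dih_inj g unfolding \<G>_def by blast
    then have "h (g x) = x" for x using gh[of "g x"] by (simp add: inj_eq)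
    then show ?thesis using h(1) gh by blast
  qed
  have dih_P: "g z \<in> S.P" if "dih g" "z \<in> S.P" for g z
    using that ngon_mult[OF S.N(1)] ngon_cnj unfolding dih_def S.P_def by auto
  have dih_glued: "glued S.N (g x) (g y)" if "dih g" "glued S.N x y" for g x y
    using that glued_mult[OF S.N(1)] glued_cnj unfolding dih_def by auto
  have dih_corner: "g z \<in> corners S.N" if "dih g" "z \<in> corners S.N" for g z
    using that corners_mult[OF S.N(1)] corners_cnj unfolding dih_def by auto
  have dih_linear: "linear g" if "dih g" for g
    using that unfolding dih_def by (auto intro!: linearI simp: algebra_simps)
  define C where "C = insert (pr S.\<tau>) ((\<lambda>g. pr (g q)) ` \<G>)"
  have \<G>_dih: "dih g" if "g \<in> \<G>" for g using that by (simp add: \<G>_def)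
  have C_X: "C \<subseteq> topspace S.X"
    using S.\<tau>_corner(2) dih_P[OF \<G>_dih qP] by (auto simp: C_def S.topspace_X)
  interpret M: marked_ngon k pr a b C
    by unfold_locales (use ab fin_\<G> C_X in \<open>auto simp: C_def\<close>)
  have L: "M.L = lin" by (simp add: M.L_def[abs_def] lin_def[abs_def])
  have sym: "M.symmetry g" if g: "g \<in> \<G>" for g
  proof -
    obtain h where h: "h \<in> \<G>" "\<And>x. h (g x) = x" "\<And>x. g (h x) = x" using inverse[OF g] by blast
    note dg = \<G>_dih[OF g] and dh = \<G>_dih[OF h(1)]
    have gP: "g ` S.P = S.P"
    proof
      show "S.P \<subseteq> g ` S.P" using dih_P[OF dh] h(3) by (metis image_eqI subsetI)
    qed (use dih_P[OF dg] in blast)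
    have dp: "M.descend g (pr x) = pr (g x)" if "x \<in> S.P" for x
      by (rule M.descend_pr_if[OF dih_P[OF dg] dih_glued[OF dg] that])
    have "M.descend g ` C = C"
    proof -
      have "M.descend g (pr S.\<tau>) = pr S.\<tau>"
        using dp[OF S.\<tau>_corner(2)] S.pr_corner[OF dih_corner[OF dg S.\<tau>_corner(1)]] by simp
      moreover have "M.descend g ` (\<lambda>f. pr (f q)) ` \<G> = (\<lambda>f. pr (f q)) ` (\<lambda>h. g \<circ> h) ` \<G>"
        unfolding image_image using dp[OF dih_P[OF \<G>_dih qP]] by (intro image_cong) auto
      ultimately show ?thesis unfolding C_def comp_surj[OF g] by simp
    qed
    then show ?thesis unfolding M.symmetry_def using dih_linear[OF dg] gP dih_glued[OF dg] by blast
  qed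
  have "veech_group M.T = G"
  proof
    show "veech_group M.T \<subseteq> G"
    proof
      fix A assume A: "A \<in> veech_group M.T"
      have "\<exists>g\<in>\<G>. \<forall>w. M.L (g w) = A *v M.L w"
      proof (rule veech_group_subset[OF M.marked_ngon_axioms K(3-6) _ _ _ _ id qP q_strict q(2) C_def A])
        show "S.\<tau> \<in> K" "cnj S.\<tau> \<in> K" "roots S.N \<subseteq> K" using K(2) by auto
        then show "g q \<in> S.P \<and> (\<exists>\<gamma>\<in>K. g = (\<lambda>z. \<gamma> * z) \<or> g = (\<lambda>z. \<gamma> * cnj z))" if "g \<in> \<G>" for g
          using dih_P[OF \<G>_dih[OF that] qP] \<G>_dih[OF that] unfolding dih_def by blast
      qed auto
      then obtain g B where gB: "\<forall>w. lin (g w) = A *v lin w" "B \<in> G" "\<forall>w. lin (g w) = B *v lin w"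
        unfolding L \<G>_def by blast
      then have "A *v v = B *v v" for v using lin_surj[of v] by metis
      then have "A = B" by (simp add: matrix_eq)
      then show "A \<in> G" using gB(2) by simp
    qed
    show "G \<subseteq> veech_group M.T"
    proof
      fix A assume "A \<in> G"
      then obtain g where g: "g \<in> \<G>" "\<And>w. lin (g w) = A *v lin w" using ex_\<G> by blast
      obtain h where h: "h \<in> \<G>" "\<And>x. h (g x) = x" "\<And>x. g (h x) = x" using inverse[OF g(1)] by blast
      obtain B where B: "\<And>w. lin (h w) = B *v lin w" using h(1) unfolding \<G>_def by blast
      show "A \<in> veech_group M.T"
        by (rule M.symmetry_in_veech_group[OF sym[OF g(1)] sym[OF h(1)] h(2,3)])
          (use g(2) B in \<open>auto simp: L\<close>)
    qed
  qed
  then show ?thesis using M.translation_surface_T by blast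
qed

end
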